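(* For the class $\mathfrak{N}_n$ of nilpotent groups of order $n$, $$\sigma_{\iota}(\mathfrak{N}_n),\ \sigma(\mathfrak{N}_n)\in \prod_{p\mid n}p^{\nu_p(n)^2/4+\Theta(\nu_p(n))}.$$ Indeed, there are at least $\prod_{p\mid n}p^{\nu_p(n)^3/108+\Theta(\nu_p(n)^2)}$ pairwise non-isomorphic groups $G$ of order $n$ having $\sigma_{\iota}(G)\in\prod_{p\mid n}p^{\nu_p(n)^2/36+\Omega(\nu_p(n))}$. As a consequence, for the class $\mathfrak{N}_{\leq n}$ of nilpotent groups of order at most $n$ we have $$\sigma_{\iota}(\mathfrak{N}_{\leq n}),\ \sigma(\mathfrak{N}_{\leq n})\in 2^{(\log_2 n)^2/4+\Theta(\log_2 n)}.$$
   Context: For a finite group $G$, $\sigma(G)$ is the number of subgroups of $G$ and $\sigma_\iota(G)$ is the number of isomorphism types of subgroups of $G$. For a class $\mathfrak{X}$ of finite groups of bounded order (such as $\mathfrak{N}_n$ or $\mathfrak{N}_{\le n}$), $\sigma(\mathfrak{X})=\max\{\sigma(G)\mid G\in\mathfrak{X}\}$ and $\sigma_\iota(\mathfrak{X})=\max\{\sigma_\iota(G)\mid G\in\mathfrak{X}\}$. For a prime $p$ and positive integer $n$, $\nu_p(n)$ is the largest $\nu$ with $p^\nu\mid n$; products $\prod_{p\mid n}$ run over primes $p$ dividing $n$. Landau symbols in exponents denote lower-order error terms of the indicated order of magnitude, which are not required to be positive. *)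

theory Defs
  imports
    Complex_Main
    "HOL-Algebra.Generated_Groups"
    "HOL-Computational_Algebra.Primes"
    "HOL-Library.Set_Algebras"
begin

definition num_subgroups :: "('a, 'b) monoid_scheme \<Rightarrow> nat" where
  "num_subgroups G = card {H. subgroup H G}"

definition subgroup_iso_rel :: "('a, 'b) monoid_scheme \<Rightarrow> ('a set \<times> 'a set) set" where
  "subgroup_iso_rel G =
     {(H, K). subgroup H G \<and> subgroup K G \<and> G\<lparr>carrier := H\<rparr> \<cong> G\<lparr>carrier := K\<rparr>}"

definition num_subgroup_types :: "('a, 'b) monoid_scheme \<Rightarrow> nat" where
  "num_subgroup_types G = card ({H. subgroup H G} // subgroup_iso_rel G)"

fun lower_central :: "('a, 'b) monoid_scheme \<Rightarrow> nat \<Rightarrow> 'a set" where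
  "lower_central G 0 = carrier G"
| "lower_central G (Suc i) =
     generate G (\<Union>x \<in> lower_central G i. \<Union>y \<in> carrier G.
       {x \<otimes>\<^bsub>G\<^esub> y \<otimes>\<^bsub>G\<^esub> inv\<^bsub>G\<^esub> x \<otimes>\<^bsub>G\<^esub> inv\<^bsub>G\<^esub> y})"

definition nilpotent_group :: "('a, 'b) monoid_scheme \<Rightarrow> bool" where
  "nilpotent_group G \<longleftrightarrow> group G \<and> (\<exists>c. lower_central G c = {\<one>\<^bsub>G\<^esub>})"

text \<open>Every finite group is isomorphic to one whose carrier is a set of natural numbers, so
  classes of finite groups are represented by sets of groups over \<^typ>\<open>nat\<close>.
  Note that \<^const>\<open>order\<close> is 0 for a group with infinite carrier.\<close>

definition nilpotent_groups :: "nat \<Rightarrow> nat monoid set" where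
  "nilpotent_groups n = {G. nilpotent_group G \<and> finite (carrier G) \<and> order G = n}"

definition nilpotent_groups_le :: "nat \<Rightarrow> nat monoid set" where
  "nilpotent_groups_le n = {G. nilpotent_group G \<and> finite (carrier G) \<and> order G \<le> n}"

definition max_num_subgroups :: "nat monoid set \<Rightarrow> nat" where
  "max_num_subgroups X = Max (num_subgroups ` X)"

definition max_num_subgroup_types :: "nat monoid set \<Rightarrow> nat" where
  "max_num_subgroup_types X = Max (num_subgroup_types ` X)"

text \<open>Landau symbols in exponents stand for error terms that need not be positive. So an error
  term is \<open>\<Theta>(x)\<close> if it lies between two constant multiples of \<open>x\<close>, and \<open>\<Omega>(x)\<close> if it is
  bounded below by a constant multiple of \<open>x\<close>, where the constants may have any sign. A lower
  bound on the absolute value of the error is not part of this: among the groups of order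
  \<open>p ^ v\<close> the elementary abelian one has the most subgroups, \<open>p powr (v\<^sup>2/4 + O(1))\<close>.\<close>

definition Theta_err :: "real \<Rightarrow> real \<Rightarrow> real \<Rightarrow> real set" where
  "Theta_err a b x = {a * x..b * x}"

definition Omega_err :: "real \<Rightarrow> real \<Rightarrow> real set" where
  "Omega_err a x = {a * x..}"

text \<open>The products of \<open>p powr e p\<close> over the primes \<open>p\<close> dividing \<open>n\<close>, where each exponent
  \<open>e p\<close> is chosen in the set \<open>E v\<close>, with \<open>v\<close> the multiplicity of \<open>p\<close> in \<open>n\<close>; the choices at
  different primes are independent.\<close>

definition prime_powr_prods :: "nat \<Rightarrow> (real \<Rightarrow> real set) \<Rightarrow> real set" where
  "prime_powr_prods n E =
     {(\<Prod>p\<in>prime_factors n. real p powr e p) | e.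
        \<forall>p\<in>prime_factors n. e p \<in> E (real (multiplicity p n))}"

end

theory Submission
  imports Defs "HOL-Algebra.Multiplicative_Group" "HOL-Library.FuncSet"
begin

text \<open>
  Write \<open>v\<close> for the multiplicity of a prime \<open>p\<close> in \<open>n\<close>.

  Upper bound. In a finite nilpotent group \<open>G\<close>, every normal subgroup \<open>N \<noteq> G\<close> lies below a normal
  subgroup \<open>M\<close> such that \<open>M/N\<close> has prime order \<open>p\<close> and is central in \<open>G/N\<close>. A subgroup \<open>H \<ge> N\<close> of
  order \<open>m\<close> either contains \<open>M\<close>, or it has index \<open>p\<close> in \<open>K = HM\<close> and avoids a fixed element of \<open>M\<close>;
  for given \<open>K\<close> there are at most \<open>p ^ i\<close> subgroups of the second kind, where \<open>i\<close> is the multiplicity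
  of \<open>p\<close> in \<open>m / |N|\<close> (lemma \<open>card_index_p_subgroups\<close>). For a \<open>p\<close>-group this is the recursion of the
  Gaussian binomial coefficients, so no group of order \<open>n\<close> has essentially more subgroups of order
  \<open>m\<close> than an elementary abelian group would have: lemma \<open>card_between_le\<close> bounds their number by
  \<open>n\<close> times the product of the \<open>p ^ (i * (v - i))\<close>, and \<open>i * (v - i) \<le> v\<^sup>2 / 4\<close>.

  Lower bound for the number of isomorphism types. All subgroups of an elementary abelian group of
  the same order are isomorphic, so the group has to be perturbed, but by so little that its
  quotient by a centre of bounded rank is still elementary abelian of rank \<open>v - O(1)\<close>. Take this
  quotient to be \<open>X \<oplus> Y\<close> with both summands of dimension \<open>2k\<close>, and consider the graphs of the
  \<open>p ^ (4 k\<^sup>2)\<close> linear maps \<open>\<phi> : X \<rightarrow> Y\<close>, each together with a centre of order \<open>p ^ 6\<close>. The commutator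
  map is given by six bilinear forms. Four of them pair the halves of \<open>X\<close> with \<open>Y\<close> in such a way
  that commutators in the graph reveal all entries of \<open>\<phi>\<close>. The other two are alternating forms
  \<open>\<alpha>\<close>, \<open>\<beta>\<close> on \<open>X\<close> with \<open>\<alpha>\<close> non-degenerate and \<open>\<beta>(x, y) = \<alpha>(T x, y)\<close> for a shift operator \<open>T\<close>. They make
  the graph rigid: an isomorphism from the graph to a group \<open>K\<close> has to respect \<open>T\<close>, and \<open>X\<close> is
  generated by two vectors under \<open>T\<close>, so the images of two vectors and of six central elements
  determine \<open>\<phi>\<close> (lemma \<open>iso_graph_determined\<close>). Hence at most \<open>|K| ^ 8 = p ^ O(v)\<close> graphs are isomorphic
  to \<open>K\<close>, and with \<open>4k\<close> close to \<open>v\<close> there are \<open>p ^ (v\<^sup>2 / 4 - O(v))\<close> isomorphism types.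

  Many groups. A further block of generators, with commutators given by an arbitrary \<open>a \<times> a \<times> a\<close>
  tensor over the prime field, gives \<open>p ^ (a ^ 3)\<close> groups. The tensor can be read off from the images of the
  \<open>v\<close> basis elements, so at most \<open>p ^ (v\<^sup>2)\<close> of these groups are isomorphic to each other (lemma
  \<open>card_iso_tensors\<close>). The block uses \<open>3a\<close> of the \<open>v\<close> coordinates. With \<open>a\<close> close to \<open>2v/9\<close> this gives
  \<open>a ^ 3\<close> about \<open>8 v ^ 3 / 729 > v ^ 3 / 108\<close> and leaves about \<open>v/3\<close> coordinates for the graphs, which
  amounts to \<open>(v/3)\<^sup>2 / 4 = v\<^sup>2 / 36\<close> in the exponent of the number of subgroup types.

  Several primes. For groups of coprime orders, isomorphism of direct products can be tested on the
  factors, so both the numbers of subgroup types and the numbers of groups multiply (lemma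
  \<open>nilpotent_family_mult\<close>).
\<close>

section \<open>Extending a subgroup by an element of prime order\<close>

lemma (in group) finite_closed_subgroup:
  assumes "finite (carrier G)" "H \<subseteq> carrier G" "H \<noteq> {}"
    and closed: "\<And>x y. x \<in> H \<Longrightarrow> y \<in> H \<Longrightarrow> x \<otimes> y \<in> H"
  shows "subgroup H G"
proof (rule subgroupI)
  fix a assume a: "a \<in> H"
  then have ac: "a \<in> carrier G" using assms by auto
  have pw: "a [^] Suc k \<in> H" for k :: nat
    by (induction k) (use a ac closed in auto)
  have "ord a \<ge> 1" using ord_ge_1[OF assms(1) ac] .
  then consider "ord a = 1" | k where "ord a = Suc (Suc k)"
    by (metis One_nat_def Suc_le_D not0_implies_Suc)
  then show "inv a \<in> H"
  proof cases
    case 1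
    then have "a = \<one>" using ord_eq_1[OF ac] by simp
    then show ?thesis using a by simp
  next
    case 2
    have "a [^] Suc k \<otimes> a = \<one>"
      using pow_ord_eq_1[OF ac] 2 by simp
    then have "inv a = a [^] Suc k" using ac by (metis inv_equality nat_pow_closed)
    then show ?thesis using pw by metis
  qed
qed (use assms in auto)

text \<open>
  The exponents \<open>t\<close> with \<open>x ^ t \<in> H\<close> are closed under integer combinations, so if one of them were
  prime to \<open>p\<close>, then a Bezout combination would put \<open>x\<close> itself into \<open>H\<close>.
\<close>

lemma (in group) pow_mem_subgroup_iff:
  assumes H: "subgroup H G" and x: "x \<in> carrier G" "x \<notin> H"
    and p: "prime (p::nat)" "x [^] p \<in> H"
  shows "x [^] (t::nat) \<in> H \<longleftrightarrow> p dvd t"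
proof
  have pw: "a [^] (k::nat) \<in> H" if "a \<in> H" for a k
    using that by (induction k) (use H in \<open>auto simp: subgroup.one_closed subgroup.m_closed\<close>)
  { assume "p dvd t"
    then obtain k where "t = p * k" by blast
    then show "x [^] t \<in> H" using pw[OF p(2), of k] x by (simp add: nat_pow_pow) }
  assume t: "x [^] t \<in> H"
  show "p dvd t"
  proof (rule ccontr)
    assume "\<not> p dvd t"
    then have cop: "coprime t p" using p(1) by (simp add: coprime_commute prime_imp_coprime)
    have "t \<noteq> 0" using \<open>\<not> p dvd t\<close> by (metis dvd_0_right)
    then obtain a b where ab: "t * a = p * b + 1"
      using bezout_nat[of t p] cop by (auto simp: coprime_iff_gcd_eq_1)
    have "x [^] (p * b) \<otimes> x = x [^] (t * a)" using x ab by simp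
    then have "x = inv (x [^] (p * b)) \<otimes> x [^] (t * a)"
      using x by (metis inv_solve_left nat_pow_closed)
    moreover have "x [^] (p*b) \<in> H" "x [^] (t * a) \<in> H"
      using pw[OF p(2), of b] pw[OF t, of a] x by (auto simp: nat_pow_pow)
    ultimately have "x \<in> H" using H by (metis subgroup.m_closed subgroup.m_inv_closed)
    then show False using x by simp
  qed
qed

lemma (in group) cancel_inv:
  assumes "x \<in> carrier G" "y \<in> carrier G"
  shows "inv x \<otimes> (x \<otimes> y) = y" "x \<otimes> (inv x \<otimes> y) = y"
  using assms by (simp_all flip: m_assoc)

lemma (in group) card_subgroup_dvd:
  assumes "subgroup N G" "subgroup L G" "N \<subseteq> L"
  shows "card N dvd card L"
proof -
  have "order (G\<lparr>carrier := L\<rparr>) = card L" by (simp add: order_def)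
  then show ?thesis
    using group.lagrange[OF subgroup_imp_group[OF assms(2)] subgroup_incl[OF assms]]
    by (metis dvd_triv_right)
qed

text \<open>
  In the situation of the locale below this is the subgroup generated by \<open>H\<close> and \<open>x\<close>. Writing it as
  a union of \<open>p\<close> right cosets makes its order \<open>p * |H|\<close> apparent.
\<close>

definition prime_extension :: "('a, 'b) monoid_scheme \<Rightarrow> nat \<Rightarrow> 'a \<Rightarrow> 'a set \<Rightarrow> 'a set" where
  "prime_extension G p x H = (\<Union>j<p. H #>\<^bsub>G\<^esub> (x [^]\<^bsub>G\<^esub> j))"

text \<open>
  The element \<open>x\<close> normalises \<open>H\<close> and has order \<open>p\<close> modulo \<open>H\<close>, so \<open>H\<close> is normal of index \<open>p\<close> in the
  subgroup that it generates together with \<open>x\<close>.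
\<close>

locale prime_step = group G for G (structure) +
  fixes p :: nat and x and H
  assumes fin: "finite (carrier G)" and H: "subgroup H G"
    and x: "x \<in> carrier G" "x \<notin> H"
    and p: "prime p" and xp: "x [^] p \<in> H"
    and norm: "\<And>h. h \<in> H \<Longrightarrow> x \<otimes> h \<otimes> inv x \<in> H"
begin

lemma HG: "h \<in> H \<Longrightarrow> h \<in> carrier G"
  using H subgroup.mem_carrier by metis

lemma norm_pow: "h \<in> H \<Longrightarrow> x [^] (j::nat) \<otimes> h \<otimes> inv (x [^] j) \<in> H"
proof (induction j)
  case (Suc j)
  have eq: "x [^] Suc j \<otimes> h \<otimes> inv (x [^] Suc j) = x \<otimes> (x [^] j \<otimes> h \<otimes> inv (x [^] j)) \<otimes> inv x"
    using Suc.prems x HG by (simp only: nat_pow_Suc2) (simp add: inv_mult_group m_assoc)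
  show ?case unfolding eq using norm Suc by blast
qed (use HG in simp)

lemma pow_reduce:
  "\<exists>h\<in>H. x [^] (t::nat) = h \<otimes> x [^] (t mod p)"
proof -
  have "x [^] t = x [^] (p * (t div p)) \<otimes> x [^] (t mod p)"
    using x by (simp add: nat_pow_mult)
  moreover have "x [^] (p * (t div p)) \<in> H"
    using pow_mem_subgroup_iff[OF H x p xp] by simp
  ultimately show ?thesis by blast
qed

lemma mem_ext_iff: "y \<in> prime_extension G p x H \<longleftrightarrow> (\<exists>h\<in>H. \<exists>j::nat. y = h \<otimes> x [^] j)"
proof
  assume "y \<in> prime_extension G p x H"
  then show "\<exists>h\<in>H. \<exists>j::nat. y = h \<otimes> x [^] j"
    unfolding prime_extension_def r_coset_def by auto
next
  assume "\<exists>h\<in>H. \<exists>j::nat. y = h \<otimes> x [^] j"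
  then obtain h j where hj: "h \<in> H" "y = h \<otimes> x [^] (j::nat)" by blast
  obtain h' where h': "h' \<in> H" "x [^] j = h' \<otimes> x [^] (j mod p)" using pow_reduce by blast
  have "y = (h \<otimes> h') \<otimes> x [^] (j mod p)"
    using hj h' HG x by (simp add: m_assoc)
  moreover have "h \<otimes> h' \<in> H" using hj h' H by (simp add: subgroup.m_closed)
  moreover have "j mod p < p" using p by (simp add: prime_gt_0_nat)
  ultimately show "y \<in> prime_extension G p x H"
    unfolding prime_extension_def r_coset_def by auto
qed

lemma mult_form:
  assumes "h \<in> H" "h' \<in> H"
  shows "\<exists>k\<in>H. (h \<otimes> x [^] (i::nat)) \<otimes> (h' \<otimes> x [^] (j::nat)) = k \<otimes> x [^] (i + j)"
proof -
  have "(h \<otimes> x [^] i) \<otimes> (h' \<otimes> x [^] j) = (h \<otimes> (x [^] i \<otimes> h' \<otimes> inv (x [^] i))) \<otimes> x [^] (i + j)"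
  proof -
    have "x [^] (i + j) = x [^] i \<otimes> x [^] j" using x by (simp add: nat_pow_mult)
    then show ?thesis using assms HG x by (simp add: m_assoc inv_solve_left)
  qed
  moreover have "h \<otimes> (x [^] i \<otimes> h' \<otimes> inv (x [^] i)) \<in> H"
    using assms norm_pow H by (simp add: subgroup.m_closed)
  ultimately show ?thesis by blast
qed

lemma subgroup_ext: "subgroup (prime_extension G p x H) G"
proof (rule finite_closed_subgroup[OF fin])
  show "prime_extension G p x H \<subseteq> carrier G"
    using mem_ext_iff HG x by auto
  show "prime_extension G p x H \<noteq> {}"
    using mem_ext_iff subgroup.one_closed[OF H] by blast
  fix a b assume "a \<in> prime_extension G p x H" "b \<in> prime_extension G p x H"
  then show "a \<otimes> b \<in> prime_extension G p x H"
    unfolding mem_ext_iff using mult_form by metis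
qed

lemma H_subset_ext: "H \<subseteq> prime_extension G p x H"
proof
  fix h assume h: "h \<in> H"
  then have "h = h \<otimes> x [^] (0::nat)" using HG by simp
  then show "h \<in> prime_extension G p x H" using h mem_ext_iff by blast
qed

lemma x_in_ext: "x \<in> prime_extension G p x H"
proof -
  have "x = \<one> \<otimes> x [^] (1::nat)" using x by simp
  then show ?thesis using subgroup.one_closed[OF H] mem_ext_iff by blast
qed

lemma ext_least: "subgroup L G \<Longrightarrow> H \<subseteq> L \<Longrightarrow> x \<in> L \<Longrightarrow> prime_extension G p x H \<subseteq> L"
proof
  fix y assume L: "subgroup L G" "H \<subseteq> L" "x \<in> L" and y: "y \<in> prime_extension G p x H"
  have "x [^] (j::nat) \<in> L" for j
    by (induction j) (use L in \<open>auto simp: subgroup.one_closed subgroup.m_closed\<close>)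
  then show "y \<in> L" using y mem_ext_iff L subgroup.m_closed[OF L(1)] by auto
qed

lemma card_ext: "card (prime_extension G p x H) = p * card H"
proof -
  have Hs: "H \<subseteq> carrier G" using HG by auto
  have "card (\<Union>j<p. H #> (x [^] j)) = (\<Sum>j<p. card (H #> (x [^] j)))"
  proof (rule card_UN_disjoint)
    show "\<forall>j\<in>{..<p}. finite (H #> (x [^] j))"
      using r_coset_subset_G[OF Hs] x fin by (meson finite_subset nat_pow_closed)
    have *: "(H #> (x [^] i)) \<inter> (H #> (x [^] j)) = {}" if "i < j" "j < p" for i j :: nat
    proof (rule ccontr)
      assume "(H #> (x [^] i)) \<inter> (H #> (x [^] j)) \<noteq> {}"
      then obtain h h' where h: "h \<in> H" "h' \<in> H" "h \<otimes> x [^] i = h' \<otimes> x [^] j"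
        unfolding r_coset_def by auto
      have "x [^] j = x [^] (j - i) \<otimes> x [^] i" using x that by (simp add: nat_pow_mult)
      then have "h \<otimes> x [^] i = (h' \<otimes> x [^] (j - i)) \<otimes> x [^] i"
        using h HG x by (simp add: m_assoc)
      then have "h = h' \<otimes> x [^] (j - i)" using h HG x by (metis m_closed nat_pow_closed right_cancel)
      then have "x [^] (j - i) = inv h' \<otimes> h" using h HG x by (metis inv_solve_left nat_pow_closed)
      then have "x [^] (j - i) \<in> H" using h H by (simp add: subgroup.m_closed subgroup.m_inv_closed)
      then have "p dvd j - i" using pow_mem_subgroup_iff[OF H x p xp] by blast
      then show False using that by (auto dest: dvd_imp_le)
    qed
    show "\<forall>i\<in>{..<p}. \<forall>j\<in>{..<p}. i \<noteq> j \<longrightarrow> (H #> (x [^] i)) \<inter> (H #> (x [^] j)) = {}"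
      using * by (metis Int_commute lessThan_iff nat_neq_iff)
  qed simp
  also have "\<dots> = (\<Sum>j<p. card H)"
  proof (rule sum.cong)
    fix j :: nat
    show "card (H #> (x [^] j)) = card H"
      using card_rcosets_equal[OF _ Hs, of "H #> (x [^] j)"] rcosetsI[OF Hs, of "x [^] j"] x by simp
  qed simp
  finally show ?thesis unfolding prime_extension_def by simp
qed

lemma inv_pow_coset:
  assumes "y \<in> prime_extension G p x H"
  shows "\<exists>j<p. y \<otimes> inv (x [^] j) \<in> H"
proof -
  obtain j h where "j < p" "h \<in> H" "y = h \<otimes> x [^] j"
    using assms unfolding prime_extension_def r_coset_def by auto
  then show ?thesis using HG x by (intro exI[of _ j]) (simp add: m_assoc)
qed

lemma pow_form:
  assumes h: "h \<in> H"
  shows "\<exists>k\<in>H. (h \<otimes> x [^] (i::nat)) [^] (t::nat) = k \<otimes> x [^] (i * t)"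
proof (induction t)
  case 0
  then show ?case using subgroup.one_closed[OF H] by (intro bexI[of _ \<one>]) auto
next
  case (Suc t)
  then obtain k where k: "k \<in> H" "(h \<otimes> x [^] i) [^] t = k \<otimes> x [^] (i * t)" by blast
  then show ?case using mult_form[OF k(1) h, of "i * t" i] by (simp add: add.commute)
qed

text \<open>
  Modulo \<open>H\<close> the extension is cyclic of prime order. So the given \<open>y\<close> normalises \<open>L \<inter> H\<close> and has order
  \<open>p\<close> modulo it, and \<open>L\<close> contains the extension of \<open>L \<inter> H\<close> by \<open>y\<close>.
\<close>

lemma dvd_card_Int:
  assumes L: "subgroup L G" and LE: "L \<subseteq> prime_extension G p x H" and y: "y \<in> L" "y \<notin> H"
  shows "p * card (L \<inter> H) dvd card L"
proof -
  obtain h j where hj: "h \<in> H" "y = h \<otimes> x [^] (j::nat)" using y LE mem_ext_iff by blast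
  have yc: "y \<in> carrier G" using L y subgroup.mem_carrier by metis
  have yL: "y [^] (t::nat) \<in> L" for t
    by (induction t) (use L y in \<open>auto simp: subgroup.one_closed subgroup.m_closed\<close>)
  have yp: "y [^] p \<in> H"
  proof -
    obtain k where k: "k \<in> H" "y [^] p = k \<otimes> x [^] (j * p)" using pow_form[OF hj(1)] hj(2) by blast
    moreover have "x [^] (j * p) \<in> H" using pow_mem_subgroup_iff[OF H x p xp] by simp
    ultimately show ?thesis using H by (simp add: subgroup.m_closed)
  qed
  have norm_y: "y \<otimes> a \<otimes> inv y \<in> L \<inter> H" if a: "a \<in> L \<inter> H" for a
  proof -
    have "y \<otimes> a \<otimes> inv y = h \<otimes> (x [^] j \<otimes> a \<otimes> inv (x [^] j)) \<otimes> inv h"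
      using hj a HG x by (simp add: inv_mult_group m_assoc)
    then have "y \<otimes> a \<otimes> inv y \<in> H"
      using norm_pow[of a j] a hj H by (simp add: subgroup.m_closed subgroup.m_inv_closed)
    then show ?thesis
      using a y L by (auto simp: subgroup.m_closed subgroup.m_inv_closed)
  qed
  interpret Y: prime_step G p y "L \<inter> H"
    by (intro prime_step.intro prime_step_axioms.intro group_axioms fin p)
      (use yc y yp yL norm_y subgroups_Inter_pair[OF L H] in auto)
  have sub: "prime_extension G p y (L \<inter> H) \<subseteq> L" using Y.ext_least[OF L] y by auto
  have "card (prime_extension G p y (L \<inter> H)) dvd card L"
    using card_subgroup_dvd[OF Y.subgroup_ext L sub] .
  then show ?thesis using Y.card_ext by simp
qed

end

text \<open>
  The members of \<open>\<F>\<close> are normal subgroups of index \<open>p\<close> in \<open>K\<close> that avoid \<open>x\<close>. If \<open>K/N\<close> is elementary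
  abelian of rank \<open>d\<close>, then those above \<open>N\<close> are hyperplanes missing a given vector, of which there
  are \<open>p ^ (d - 1)\<close>; the claim is that no other \<open>K/N\<close> with the same power of \<open>p\<close> in its order has more.
  
  Given two members \<open>H1\<close>, \<open>H2\<close> above \<open>N\<close> and \<open>y \<in> H2 - H1\<close>, every member contains one of the \<open>p\<close> elements
  \<open>y x^-j\<close>. Each of these elements lies outside \<open>H1\<close> (if \<open>j = 0\<close>) or outside \<open>H2\<close> (if \<open>j > 0\<close>), so adding
  it to \<open>N\<close> removes a factor \<open>p\<close> from the index. Thus \<open>p\<close> families are left, each with a bound that is
  smaller by a factor \<open>p\<close>.
\<close>

lemma (in group) card_index_p_subgroups:
  assumes fin: "finite (carrier G)" and p: "prime p" and K: "subgroup K G"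
    and N: "subgroup N G" "N \<subseteq> K"
    and \<F>: "\<And>H. H \<in> \<F> \<Longrightarrow> prime_step G p x H" "\<And>H. H \<in> \<F> \<Longrightarrow> prime_extension G p x H = K"
  shows "p * card {H \<in> \<F>. N \<subseteq> H} \<le> p ^ multiplicity p (card K div card N)"
  using N
proof (induction "card K - card N" arbitrary: N rule: less_induct)
  case less
  have finK: "finite K" using K fin subgroup.subset finite_subset by metis
  have p0: "p > 0" "p \<noteq> 1" using prime_gt_1_nat[OF p] by simp_all
  have F_sub: "\<F> \<subseteq> Pow (carrier G)"
    using prime_step.HG[OF \<F>(1)] by blast
  have finF: "finite \<F>" using F_sub fin by (simp add: finite_subset)
  have pos: "card L > 0" if "subgroup L G" for L
    using subgroup.finite_imp_card_positive[OF that fin] .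
  have mult_step: "multiplicity p (card K div card M) + 1 \<le> multiplicity p (card K div card N)"
    if M: "subgroup M G" "M \<subseteq> K" and dv: "p * card N dvd card M" for M
  proof -
    obtain c where c: "card M = p * card N * c" using dv by blast
    obtain d where d: "card K = card M * d" using card_subgroup_dvd[OF M(1) K M(2)] by blast
    have nz: "card K > 0" "card M > 0" "card N > 0" using pos K M less.prems by auto
    then have cd: "c \<noteq> 0" "d \<noteq> 0" using c d by (auto intro: Nat.gr0I)
    have 1: "card K div card M = d" using d nz by simp
    have 2: "card K div card N = p * (c * d)" using c d nz by simp
    have "multiplicity p d \<le> multiplicity p (c * d)"
      using cd by (intro dvd_imp_multiplicity_le) auto
    then show ?thesis unfolding 1 2 using p0 cd
      by (subst multiplicity_times_same) auto
  qed
  let ?f = "\<lambda>N. {H \<in> \<F>. N \<subseteq> H}"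
  show ?case
  proof (cases "card (?f N) \<le> 1")
    case True
    show ?thesis
    proof (cases "?f N = {}")
      case False
      then obtain H where H: "H \<in> \<F>" "N \<subseteq> H" by blast
      interpret S: prime_step G p x H using \<F>(1) H(1) by blast
      have "card N dvd card H" using card_subgroup_dvd[OF less.prems(1) S.H H(2)] .
      then have "p * card N dvd card K" using S.card_ext \<F>(2)[OF H(1)] by (metis dvd_refl mult_dvd_mono)
      from mult_step[OF K subset_refl this] have "1 \<le> multiplicity p (card K div card N)" by simp
      then have "p ^ 1 \<le> p ^ multiplicity p (card K div card N)"
        using p0 by (intro power_increasing) auto
      moreover have "p * card (?f N) \<le> p" using True by (cases "card (?f N)") auto
      ultimately show ?thesis by (metis le_trans power_one_right)
    qed (simp only: card.empty mult_0_right le0)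
  next
    case False
    then obtain H1 H2 where H12: "H1 \<in> ?f N" "H2 \<in> ?f N" "H1 \<noteq> H2"
      by (metis (no_types, lifting) One_nat_def card.infinite card_le_Suc0_iff_eq le0)
    interpret S1: prime_step G p x H1 using \<F>(1) H12 by blast
    interpret S2: prime_step G p x H2 using \<F>(1) H12 by blast
    have e1: "prime_extension G p x H1 = K" and e2: "prime_extension G p x H2 = K"
      using \<F>(2) H12 by auto
    have "card H1 = card H2" using S1.card_ext S2.card_ext e1 e2 p0 by simp
    moreover have "finite H1" using S1.H fin subgroup.subset finite_subset by metis
    ultimately obtain y where y: "y \<in> H2" "y \<notin> H1"
      using H12(3) card_subset_eq by (metis subsetI)
    have yK: "y \<in> K" using y S2.H_subset_ext e2 by auto
    have yc: "y \<in> carrier G" using y S2.HG by blast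
    have xK: "x \<in> K" using S1.x_in_ext e1 by auto
    define z where "z j = y \<otimes> inv (x [^] j)" for j :: nat
    define M where "M j = generate G (insert (z j) N)" for j
    have xj: "x [^] j \<in> K" for j :: nat
      by (induction j) (use xK K in \<open>auto simp: subgroup.one_closed subgroup.m_closed\<close>)
    have zK: "z j \<in> K" for j
      unfolding z_def using yK xj K by (simp add: subgroup.m_closed subgroup.m_inv_closed)
    have insK: "insert (z j) N \<subseteq> K" for j using zK less.prems by auto
    have KG: "K \<subseteq> carrier G" using K subgroup.subset by blast
    have Msub: "subgroup (M j) G" for j
      unfolding M_def using insK KG by (intro generate_is_subgroup) blast
    have MK: "M j \<subseteq> K" for j
      unfolding M_def using generate_subgroup_incl[OF insK K] .
    have NM: "N \<subseteq> M j" and zM: "z j \<in> M j" for j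
      unfolding M_def using generate.incl[of _ "insert (z j) N" G] by auto
    (* In the case j = 0, H1 misses the new element y; otherwise H2 contains y but not x ^ j. *)
    have dv: "p * card N dvd card (M j)" if j: "j < p" for j
    proof -
      have "\<exists>H\<in>{H1, H2}. z j \<notin> H"
      proof (cases "j = 0")
        case True
        then show ?thesis using y yK KG by (auto simp: z_def)
      next
        case False
        have "z j \<notin> H2"
        proof
          assume "z j \<in> H2"
          then have "inv (y \<otimes> inv (x [^] j)) \<otimes> y \<in> H2" unfolding z_def
            using y S2.H by (meson subgroup.m_closed subgroup.m_inv_closed)
          moreover have "inv (y \<otimes> inv (x [^] j)) \<otimes> y = x [^] j"
            using yc S1.x by (simp add: inv_mult_group m_assoc)
          ultimately have "x [^] j \<in> H2" by simp
          then show False using pow_mem_subgroup_iff[OF S2.H S2.x S2.p S2.xp] False j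
            by (auto dest: dvd_imp_le)
        qed
        then show ?thesis by blast
      qed
      then obtain H where H: "H \<in> ?f N" "z j \<notin> H" using H12 by blast
      interpret S: prime_step G p x H using \<F>(1) H by blast
      have "p * card (M j \<inter> H) dvd card (M j)"
        using S.dvd_card_Int[OF Msub _ zM H(2)] MK \<F>(2) H by auto
      moreover have "card N dvd card (M j \<inter> H)"
        using card_subgroup_dvd[OF less.prems(1) subgroups_Inter_pair[OF Msub S.H]] NM H by auto
      ultimately show ?thesis by (metis dvd_trans mult_dvd_mono dvd_refl)
    qed
    have IH: "p * card (?f (M j)) \<le> p ^ (multiplicity p (card K div card N) - 1)" if j: "j < p" for j
    proof -
      have le: "p * card N \<le> card (M j)" using dv[OF j] pos[OF Msub] by (auto intro: dvd_imp_le)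
      have "card N < p * card N" using pos[OF less.prems(1)] prime_gt_1_nat[OF p] by simp
      then have "card N < card (M j)" using le by linarith
      moreover have "card (M j) \<le> card K" using MK finK by (simp add: card_mono)
      ultimately have "card K - card (M j) < card K - card N" by simp
      from less.hyps[OF this Msub MK]
      have "p * card (?f (M j)) \<le> p ^ multiplicity p (card K div card (M j))" .
      also have "\<dots> \<le> p ^ (multiplicity p (card K div card N) - 1)"
        using mult_step[OF Msub MK dv[OF j]] p0 by (intro power_increasing) auto
      finally show ?thesis .
    qed
    have cover: "?f N \<subseteq> (\<Union>j<p. ?f (M j))"
    proof
      fix H assume H: "H \<in> ?f N"
      interpret S: prime_step G p x H using \<F>(1) H by blast
      obtain j where j: "j < p" "z j \<in> H"
        using S.inv_pow_coset[of y] yK \<F>(2) H unfolding z_def by auto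
      have "M j \<subseteq> H" unfolding M_def using j H S.H by (intro generate_subgroup_incl) auto
      then show "H \<in> (\<Union>j<p. ?f (M j))" using j H by auto
    qed
    have ge1: "multiplicity p (card K div card N) \<ge> 1"
      using mult_step[OF Msub MK dv[of 0]] p0 by simp
    have "card (?f N) \<le> card (\<Union>j<p. ?f (M j))"
      using cover finF by (intro card_mono) auto
    also have "\<dots> \<le> (\<Sum>j<p. card (?f (M j)))" by (rule card_UN_le) simp
    finally have "p * card (?f N) \<le> (\<Sum>j<p. p * card (?f (M j)))"
      by (simp add: sum_distrib_left[symmetric])
    also have "\<dots> \<le> (\<Sum>j<p. p ^ (multiplicity p (card K div card N) - 1))"
      using IH by (intro sum_mono) auto
    also have "\<dots> = p ^ multiplicity p (card K div card N)"
      using ge1 by (simp add: power_eq_if)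
    finally show ?thesis .
  qed
qed

section \<open>Counting the subgroups of a nilpotent group\<close>

abbreviation (input) commutator_of :: "('a, 'b) monoid_scheme \<Rightarrow> 'a \<Rightarrow> 'a \<Rightarrow> 'a" where
  "commutator_of G x y \<equiv> x \<otimes>\<^bsub>G\<^esub> y \<otimes>\<^bsub>G\<^esub> inv\<^bsub>G\<^esub> x \<otimes>\<^bsub>G\<^esub> inv\<^bsub>G\<^esub> y"

lemma lower_central_sub:
  assumes "group G"
  shows "lower_central G i \<subseteq> carrier G"
proof (induction i)
  case (Suc i)
  interpret group G by fact
  have "(\<Union>x \<in> lower_central G i. \<Union>y \<in> carrier G.
       {commutator_of G x y}) \<subseteq> carrier G"
    using Suc by auto
  then show ?case using generate_in_carrier by auto
qed simp

text \<open>
  Take \<open>y\<close> outside \<open>N\<close> in the last term of the lower central series that is not contained in \<open>N\<close>; its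
  commutators lie in the next term.
\<close>

lemma nilpotent_commutators:
  assumes G: "nilpotent_group G" and N: "subgroup N G" "N \<noteq> carrier G"
  obtains y where "y \<in> carrier G" "y \<notin> N"
    "\<And>g. g \<in> carrier G \<Longrightarrow> commutator_of G y g \<in> N"
proof -
  interpret group G using G by (simp add: nilpotent_group_def)
  obtain c where c: "lower_central G c = {\<one>\<^bsub>G\<^esub>}" using G by (auto simp: nilpotent_group_def)
  have "\<exists>i. lower_central G (Suc i) \<subseteq> N \<and> \<not> lower_central G i \<subseteq> N"
  proof (rule ccontr)
    assume "\<nexists>i. lower_central G (Suc i) \<subseteq> N \<and> \<not> lower_central G i \<subseteq> N"
    then have step: "lower_central G (Suc i) \<subseteq> N \<Longrightarrow> lower_central G i \<subseteq> N" for i by blast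
    have "lower_central G i \<subseteq> N \<Longrightarrow> lower_central G 0 \<subseteq> N" for i
    proof (induction i)
      case (Suc i)
      then show ?case using step by blast
    qed
    moreover have "lower_central G c \<subseteq> N" using c subgroup.one_closed[OF N(1)] by simp
    ultimately show False using N subgroup.subset[OF N(1)] by auto
  qed
  then obtain i y where i: "lower_central G (Suc i) \<subseteq> N" "y \<in> lower_central G i" "y \<notin> N" by blast
  have "y \<in> carrier G" using i lower_central_sub[OF is_group] by blast
  moreover have "commutator_of G y g \<in> N" if "g \<in> carrier G" for g
  proof -
    have "commutator_of G y g \<in> lower_central G (Suc i)"
      using i that by (auto intro!: generate.incl)
    then show ?thesis using i by blast
  qed
  ultimately show thesis using that i by blast
qed

text \<open>
  Since \<open>N\<close> is normal, the elements that are central modulo \<open>N\<close> are closed under powers. So an element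
  \<open>y\<close> of order \<open>t\<close> modulo \<open>N\<close> can be replaced by \<open>y ^ (t / p)\<close> for a prime divisor \<open>p\<close> of \<open>t\<close>.
\<close>

lemma nilpotent_prime_step:
  fixes G (structure)
  assumes G: "nilpotent_group G" "finite (carrier G)" and N: "N \<lhd> G" "N \<noteq> carrier G"
  shows "\<exists>p x. prime (p::nat) \<and> x \<in> carrier G \<and> x \<notin> N \<and> x [^] p \<in> N \<and>
    (\<forall>g\<in>carrier G. x \<otimes> g \<otimes> inv x \<otimes> inv g \<in> N)"
proof -
  interpret normal N G by fact
  have Ns: "subgroup N G" by (rule subgroup_axioms)
  obtain y where y: "y \<in> carrier G" "y \<notin> N"
    "\<And>g. g \<in> carrier G \<Longrightarrow> commutator_of G y g \<in> N"
    using nilpotent_commutators[OF G(1) Ns N(2)] by blast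
  have pow_comm: "y [^] (j::nat) \<otimes> g \<otimes> inv (y [^] j) \<otimes> inv g \<in> N" if g: "g \<in> carrier G" for j g
  proof (induction j)
    case (Suc j)
    have "y [^] Suc j \<otimes> g \<otimes> inv (y [^] Suc j) \<otimes> inv g
        = (y [^] j \<otimes> (y \<otimes> g \<otimes> inv y \<otimes> inv g) \<otimes> inv (y [^] j)) \<otimes> (y [^] j \<otimes> g \<otimes> inv (y [^] j) \<otimes> inv g)"
      using y(1) g by (simp add: inv_mult_group m_assoc cancel_inv)
    moreover have "y [^] j \<otimes> (y \<otimes> g \<otimes> inv y \<otimes> inv g) \<otimes> inv (y [^] j) \<in> N"
      using y g by (intro inv_op_closed2) auto
    ultimately show ?case using Suc by simp
  qed (use g in simp)
  define t where "t = (LEAST t::nat. t > 0 \<and> y [^] t \<in> N)"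
  have "\<exists>t::nat. t > 0 \<and> y [^] t \<in> N"
    using ord_ge_1[OF G(2) y(1)] pow_ord_eq_1[OF y(1)] one_closed by (intro exI[of _ "ord y"]) auto
  then have t: "t > 0" "y [^] t \<in> N" unfolding t_def by (metis (mono_tags, lifting) LeastI)+
  have tmin: "y [^] s \<notin> N" if "s > 0" "s < t" for s :: nat
    using that not_less_Least[of s "\<lambda>t. t > 0 \<and> y [^] t \<in> N"] unfolding t_def by blast
  have "t \<noteq> 1" using t y by auto
  then obtain p where p: "prime p" "p dvd t" using prime_factor_nat by blast
  then obtain s where s: "t = s * p" by (metis dvd_div_mult_self)
  have s0: "s > 0" "s < t" using s t prime_gt_1_nat[OF p(1)] by (auto intro: Nat.gr0I)
  have "(y [^] s) [^] p \<in> N" using t s y by (simp add: nat_pow_pow)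
  then show ?thesis using p s0 tmin y(1) pow_comm
    by (intro exI[of _ p] exI[of _ "y [^] s"]) auto
qed

text \<open>
  If \<open>w = p ^ i\<close> and \<open>z = p ^ j\<close>, this is \<open>p ^ (i * j)\<close>, the order of magnitude of the Gaussian binomial
  coefficient that counts the \<open>i\<close>-dimensional subspaces of a space of dimension \<open>i + j\<close>.
\<close>

definition mult_pairing :: "nat set \<Rightarrow> nat \<Rightarrow> nat \<Rightarrow> nat" where
  "mult_pairing P w z = (\<Prod>q\<in>P. q ^ (multiplicity q w * multiplicity q z))"

lemma mult_pairing_mono_left:
  assumes "\<And>q. q \<in> P \<Longrightarrow> prime q" "w' dvd w" "w > 0"
  shows "mult_pairing P w' z \<le> mult_pairing P w z"
  unfolding mult_pairing_def
proof (rule prod_mono, safe)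
  fix q assume "q \<in> P"
  then have "q > 0" using assms(1) prime_gt_0_nat by blast
  moreover have "multiplicity q w' \<le> multiplicity q w"
    using assms by (intro dvd_imp_multiplicity_le) auto
  ultimately show "q ^ (multiplicity q w' * multiplicity q z) \<le> q ^ (multiplicity q w * multiplicity q z)"
    by (intro power_increasing mult_right_mono) auto
qed

lemma mult_pairing_prime_times:
  assumes P: "finite P" "\<And>q. q \<in> P \<Longrightarrow> prime q" "p \<in> P" and z: "z > 0"
  shows "mult_pairing P w (p * z) = p ^ multiplicity p w * mult_pairing P w z"
proof -
  have mp: "multiplicity q (p * z) = multiplicity q z" if "q \<in> P - {p}" for q
  proof -
    have "prime_elem q" using P that by auto
    moreover have "multiplicity q p = 0" using P that by (intro not_dvd_imp_multiplicity_0) (metis DiffE insertI1 primes_dvd_imp_eq)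
    ultimately show ?thesis using z P(2)[OF P(3)] by (subst prime_elem_multiplicity_mult_distrib) auto
  qed
  have mpp: "multiplicity p (p * z) = Suc (multiplicity p z)"
    using P(2)[OF P(3)] z prime_gt_1_nat[OF P(2)[OF P(3)]] by (subst multiplicity_times_same) auto
  have "mult_pairing P w (p * z) = p ^ (multiplicity p w * Suc (multiplicity p z)) *
      (\<Prod>q\<in>P - {p}. q ^ (multiplicity q w * multiplicity q z))"
    unfolding mult_pairing_def using P mp mpp by (subst prod.remove[of P p]) auto
  moreover have "mult_pairing P w z = p ^ (multiplicity p w * multiplicity p z) *
      (\<Prod>q\<in>P - {p}. q ^ (multiplicity q w * multiplicity q z))"
    unfolding mult_pairing_def using P by (subst prod.remove[of P p]) auto
  ultimately show ?thesis by (simp add: power_add)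
qed

definition between :: "('a, 'b) monoid_scheme \<Rightarrow> 'a set \<Rightarrow> nat \<Rightarrow> 'a set set" where
  "between G N m = {H. subgroup H G \<and> N \<subseteq> H \<and> card H = m}"

lemma finite_between: "finite (carrier G) \<Longrightarrow> finite (between G N m)"
  unfolding between_def by (rule finite_subset[of _ "Pow (carrier G)"]) (auto dest: subgroup.subset)

text \<open>
  Put \<open>w = m / |N|\<close> and \<open>z = |G| / m\<close>, and let \<open>M\<close> be the extension of \<open>N\<close> by an element \<open>x\<close> of order \<open>p\<close>
  that is central modulo \<open>N\<close>. The subgroups that contain \<open>x\<close> lie above \<open>M\<close>, and for them the pair
  \<open>(w, z)\<close> changes to \<open>(w / p, z)\<close>. The extension of any other \<open>H\<close> by \<open>x\<close> lies above \<open>M\<close> and belongs to the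
  pair \<open>(w, z / p)\<close>; at most \<open>p ^ multiplicity p w\<close> of the \<open>H\<close> have the same extension, and this factor
  is exactly what the pairing loses when \<open>z\<close> is divided by \<open>p\<close>. So both parts have the same bound,
  with \<open>|G : M| = |G : N| / p\<close> in front, and \<open>2 \<le> p\<close> suffices to add them up.
\<close>

lemma card_between_le:
  fixes G (structure)
  assumes G: "nilpotent_group G" "finite (carrier G)" and N: "N \<lhd> G"
  shows "card (between G N m) \<le> (order G div card N) *
    mult_pairing (prime_factors (order G)) (m div card N) (order G div m)"
  using N
proof (induction "order G - card N" arbitrary: N m rule: less_induct)
  case less
  interpret normal N G by fact
  let ?g = "mult_pairing (prime_factors (order G))"
  let ?n = "order G"
  have Ns: "subgroup N G" by (rule subgroup_axioms)
  have n: "?n > 0" using G(2) order_gt_0_iff_finite by blast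
  have pos: "card L > 0" if "subgroup L G" for L
    using subgroup.finite_imp_card_positive[OF that G(2)] .
  show ?case
  proof (cases "between G N m = {}")
    case False
    then obtain H0 where H0: "subgroup H0 G" "N \<subseteq> H0" "card H0 = m" unfolding between_def by blast
    have m: "card N dvd m" using card_subgroup_dvd[OF Ns H0(1,2)] H0(3) by simp
    have mn: "m dvd ?n"
      using card_subgroup_dvd[OF H0(1) subgroup_self] H0 subgroup.subset[OF H0(1)] by (simp add: order_def)
    define w where "w = m div card N"
    define z where "z = ?n div m"
    have mw: "m = card N * w" and nz: "?n = card N * w * z"
      using m mn unfolding w_def z_def by auto
    have c0: "card N > 0" "w > 0" "z > 0" using nz n by (auto intro: Nat.gr0I)
    show ?thesis
    proof (cases "N = carrier G")
      case True
      have "between G N m \<subseteq> {carrier G}" unfolding between_def True using subgroup.subset by blast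
      then have "card (between G N m) \<le> 1" by (metis card.empty card_insert_disjoint card_mono empty_iff finite.intros One_nat_def)
      moreover have "card N = ?n" using True by (simp add: order_def)
      then have "w * z = 1" using nz c0 by simp
      then have "?n div card N * ?g (m div card N) (?n div m) = 1"
        using \<open>card N = ?n\<close> n unfolding w_def[symmetric] z_def[symmetric] by (simp add: mult_pairing_def)
      ultimately show ?thesis by simp
    next
      case False
      obtain p x where p: "prime (p::nat)" and x: "x \<in> carrier G" "x \<notin> N" "x [^] p \<in> N"
        and comm: "\<And>g. g \<in> carrier G \<Longrightarrow> x \<otimes> g \<otimes> inv x \<otimes> inv g \<in> N"
        using nilpotent_prime_step[OF G less.prems False] by blast
      have p1: "p > 1" using prime_gt_1_nat[OF p] .
      have step: "prime_step G p x H" if H: "subgroup H G" "N \<subseteq> H" "x \<notin> H" for H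
      proof (intro prime_step.intro prime_step_axioms.intro group_axioms G(2) p H(1) x(1))
        fix h assume h: "h \<in> H"
        then have hc: "h \<in> carrier G" using H subgroup.mem_carrier by metis
        have "x \<otimes> h \<otimes> inv x = (x \<otimes> h \<otimes> inv x \<otimes> inv h) \<otimes> h" using hc x by (simp add: m_assoc)
        moreover have "(x \<otimes> h \<otimes> inv x \<otimes> inv h) \<otimes> h \<in> H"
          by (rule subgroup.m_closed[OF H(1) _ h]) (use comm[OF hc] H(2) in blast)
        ultimately show "x \<otimes> h \<otimes> inv x \<in> H" by simp
      qed (use H x in auto)
      define M where "M = prime_extension G p x N"
      interpret N: prime_step G p x N using step[OF Ns _ x(2)] by simp
      have Msub: "subgroup M G" and cM: "card M = p * card N" and NM: "N \<subseteq> M" and xM: "x \<in> M"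
        unfolding M_def using N.subgroup_ext N.card_ext N.H_subset_ext N.x_in_ext by auto
      have Mnorm: "M \<lhd> G"
      proof (rule normal_invI[OF Msub])
        fix a b assume a: "a \<in> carrier G" and b: "b \<in> M"
        have bc: "b \<in> carrier G" using b Msub subgroup.mem_carrier by metis
        obtain h j where hj: "h \<in> N" "b = h \<otimes> x [^] (j::nat)" using b N.mem_ext_iff unfolding M_def by blast
        have ax: "a \<otimes> x \<otimes> inv a \<in> M"
        proof -
          have "inv (x \<otimes> a \<otimes> inv x \<otimes> inv a) \<otimes> x = a \<otimes> x \<otimes> inv a"
            using a x by (simp add: inv_mult_group m_assoc cancel_inv)
          moreover have "inv (x \<otimes> a \<otimes> inv x \<otimes> inv a) \<otimes> x \<in> M"
            by (rule subgroup.m_closed[OF Msub subgroup.m_inv_closed[OF Msub] xM]) (use comm[OF a] NM in blast)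
          ultimately show ?thesis by simp
        qed
        have apow: "a \<otimes> x [^] (j::nat) \<otimes> inv a \<in> M" for j
        proof (induction j)
          case 0
          then show ?case using a subgroup.one_closed[OF Msub] by simp
        next
          case (Suc j)
          have "a \<otimes> x [^] Suc j \<otimes> inv a = (a \<otimes> x [^] j \<otimes> inv a) \<otimes> (a \<otimes> x \<otimes> inv a)"
            using a x by (simp add: m_assoc cancel_inv)
          then show ?case using Suc ax subgroup.m_closed[OF Msub] by simp
        qed
        have "a \<otimes> b \<otimes> inv a = (a \<otimes> h \<otimes> inv a) \<otimes> (a \<otimes> x [^] j \<otimes> inv a)"
          using a x hj N.HG by (simp add: m_assoc cancel_inv)
        moreover have "a \<otimes> h \<otimes> inv a \<in> M" using inv_op_closed2[OF a hj(1)] NM by blast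
        ultimately show "a \<otimes> b \<otimes> inv a \<in> M" using apow subgroup.m_closed[OF Msub] by simp
      qed
      have cMn: "card M dvd ?n"
        using card_subgroup_dvd[OF Msub subgroup_self subgroup.subset[OF Msub]] by (simp add: order_def)
      then have "p dvd w * z" using c0 unfolding cM nz by (simp add: mult.assoc mult.commute[of p])
      then have pn: "p \<in> prime_factors ?n" using p n nz
        by (simp add: prime_factors_dvd mult.assoc)
      have dec: "?n - card M < ?n - card N"
      proof -
        have "card N < p * card N" using p1 c0 by simp
        moreover have "p * card N \<le> ?n" using cMn cM n by (metis dvd_imp_le)
        ultimately show ?thesis unfolding cM by linarith
      qed
      note IH = less.hyps[OF dec Mnorm]
      have Pfin: "finite (prime_factors ?n)" and Pp: "\<And>q. q \<in> prime_factors ?n \<Longrightarrow> prime q"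
        by auto
      define u where "u = w * z div p"
      have u: "w * z = p * u" using \<open>p dvd w * z\<close> unfolding u_def by simp
      have nM: "?n div card M = u" unfolding cM nz using u c0 p1 by (simp add: mult.assoc)
      have nN: "?n div card N = p * u" unfolding nz using u c0 by (simp add: mult.assoc)
      have ext_between: "prime_extension G p x H \<in> between G M (p * m)"
        if H: "subgroup H G" "N \<subseteq> H" "card H = m" "x \<notin> H" for H
      proof -
        interpret H: prime_step G p x H using step H by blast
        show ?thesis unfolding between_def M_def
          using H.subgroup_ext H.card_ext H H.H_subset_ext H.x_in_ext N.ext_least[OF H.subgroup_ext] by auto
      qed
      (* A: subgroups that contain x. B: the others, which are grouped by their extension K. *)
      let ?A = "between G M m"
      let ?B = "{H \<in> between G N m. x \<notin> H}"
      have split: "between G N m \<subseteq> ?A \<union> ?B"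
      proof
        fix H assume H: "H \<in> between G N m"
        then have "x \<in> H \<Longrightarrow> M \<subseteq> H" unfolding between_def M_def using N.ext_least[of H] by auto
        then show "H \<in> ?A \<union> ?B" using H unfolding between_def by auto
      qed
      have A: "card ?A \<le> u * ?g w z"
      proof (cases "?A = {}")
        case False
        then obtain H where H: "subgroup H G" "M \<subseteq> H" "card H = m" unfolding between_def by blast
        have "p * card N dvd card N * w"
          using card_subgroup_dvd[OF Msub H(1,2)] H(3) cM mw by simp
        then have pw: "p dvd w" using c0 by (simp add: mult.commute[of p])
        then obtain w' where w': "w = p * w'" by blast
        have "m div card M = w'" unfolding cM mw w' using c0 p1 by simp
        then have "card ?A \<le> u * ?g w' z" using IH[of m] nM unfolding z_def by simp
        also have "\<dots> \<le> u * ?g w z"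
          using mult_pairing_mono_left[of "prime_factors ?n" w' w z] Pp w' c0 by (intro mult_left_mono) auto
        finally show ?thesis .
      qed (simp only: card.empty le0)
      have B: "card ?B \<le> u * ?g w z"
      proof (cases "between G M (p * m) = {}")
        case True
        have "?B = {}"
        proof (rule ccontr)
          assume "?B \<noteq> {}"
          then obtain H where H: "subgroup H G" "N \<subseteq> H" "card H = m" "x \<notin> H" unfolding between_def by blast
          then have "prime_extension G p x H \<in> between G M (p * m)" by (intro ext_between)
          then show False using True by blast
        qed
        then show ?thesis by (simp only: card.empty le0)
      next
        case False
        then obtain K where K: "subgroup K G" "M \<subseteq> K" "card K = p * m" unfolding between_def by blast
        have "card N * w * p dvd card N * w * z"
          using card_subgroup_dvd[OF K(1) subgroup_self subgroup.subset[OF K(1)]] K(3) mw nz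
          by (simp add: order_def ac_simps)
        then have "p dvd z" using c0 by simp
        then obtain z' where z': "z = p * z'" by blast
        have z'0: "z' > 0" using z' c0 by (auto intro: Nat.gr0I)
        have e1: "p * m div card M = w" unfolding cM mw using c0 p1 by (simp add: mult.left_commute)
        have e2: "?n div (p * m) = z'" unfolding nz z' mw using c0 p1 by (simp add: mult.left_commute mult.assoc)
        have fib: "card {H \<in> ?B. prime_extension G p x H = K} \<le> p ^ multiplicity p w"
          if K: "K \<in> between G M (p * m)" for K
        proof -
          have Ks: "subgroup K G" "M \<subseteq> K" "card K = p * m" using K unfolding between_def by auto
          let ?F = "{H \<in> ?B. prime_extension G p x H = K}"
          have "p * card {H \<in> ?F. N \<subseteq> H} \<le> p ^ multiplicity p (card K div card N)"
          proof (rule card_index_p_subgroups[OF G(2) p Ks(1) Ns])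
            show "N \<subseteq> K" using NM Ks by blast
            show "prime_step G p x H" if "H \<in> ?F" for H
              using that by (intro step) (simp_all add: between_def)
            show "prime_extension G p x H = K" if "H \<in> ?F" for H
              using that by simp
          qed
          moreover have "{H \<in> ?F. N \<subseteq> H} = ?F" unfolding between_def by auto
          moreover have "card K div card N = p * w" unfolding Ks(3) mw using c0 by simp
          moreover have "multiplicity p (p * w) = Suc (multiplicity p w)"
            using c0 p1 by (subst multiplicity_times_same) auto
          ultimately have "p * card ?F \<le> p * p ^ multiplicity p w" by simp
          then show ?thesis using p1 by simp
        qed
        have "?B \<subseteq> (\<Union>K\<in>between G M (p * m). {H \<in> ?B. prime_extension G p x H = K})"
        proof
          fix H assume HB: "H \<in> ?B"
          then have H: "subgroup H G" "N \<subseteq> H" "card H = m" "x \<notin> H" unfolding between_def by auto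
          then have "prime_extension G p x H \<in> between G M (p * m)" by (intro ext_between)
          then show "H \<in> (\<Union>K\<in>between G M (p * m). {H \<in> ?B. prime_extension G p x H = K})"
            using HB by blast
        qed
        then have "card ?B \<le> card (\<Union>K\<in>between G M (p * m). {H \<in> ?B. prime_extension G p x H = K})"
          using finite_between[OF G(2)] by (intro card_mono) auto
        also have "\<dots> \<le> (\<Sum>K\<in>between G M (p * m). card {H \<in> ?B. prime_extension G p x H = K})"
          using finite_between[OF G(2)] by (intro card_UN_le)
        also have "\<dots> \<le> (\<Sum>K\<in>between G M (p * m). p ^ multiplicity p w)"
          by (intro sum_mono fib)
        also have "\<dots> = card (between G M (p * m)) * p ^ multiplicity p w" by simp
        also have "\<dots> \<le> (u * ?g w z') * p ^ multiplicity p w"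
          using IH[of "p * m"] unfolding nM e1 e2 by (intro mult_right_mono) auto
        also have "\<dots> = u * ?g w z"
          using mult_pairing_prime_times[OF Pfin Pp pn z'0, of w] z' by simp
        finally show ?thesis .
      qed
      have "card (between G N m) \<le> card (?A \<union> ?B)"
        using split finite_between[OF G(2)] by (intro card_mono) auto
      also have "\<dots> \<le> card ?A + card ?B" by (rule card_Un_le)
      also have "\<dots> \<le> 2 * (u * ?g w z)" using A B by linarith
      also have "\<dots> \<le> p * (u * ?g w z)" using p1 by (intro mult_right_mono) auto
      finally show ?thesis unfolding nN w_def[symmetric] z_def[symmetric] by (simp add: mult.assoc)
    qed
  qed (simp only: card.empty le0)
qed

section \<open>Subgroup types, copies and direct products\<close>

text \<open>
  In a maximal set of pairwise unrelated values, every value is related to some member, and each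
  member accounts for at most \<open>m\<close> elements of \<open>T\<close>.
\<close>

lemma large_inequivalent_subset:
  assumes T: "finite T" and refl: "\<And>t. t \<in> T \<Longrightarrow> R (F t) (F t)"
    and sym: "\<And>s t. s \<in> T \<Longrightarrow> t \<in> T \<Longrightarrow> R (F s) (F t) \<Longrightarrow> R (F t) (F s)"
    and bound: "\<And>s. s \<in> T \<Longrightarrow> card {t \<in> T. R (F t) (F s)} \<le> m"
  obtains S where "S \<subseteq> F ` T" "pairwise (\<lambda>x y. \<not> R x y) S" "card T \<le> m * card S"
proof -
  define \<S> where "\<S> = {S. S \<subseteq> F ` T \<and> pairwise (\<lambda>x y. \<not> R x y) S}"
  have fin: "finite \<S>" unfolding \<S>_def by (rule finite_subset[of _ "Pow (F ` T)"]) (use T in auto)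
  have "{} \<in> \<S>" unfolding \<S>_def by simp
  then have "Max (card ` \<S>) \<in> card ` \<S>" using fin by (intro Max_in) auto
  then obtain S where S: "S \<in> \<S>" "card S = Max (card ` \<S>)" by auto
  have Smax: "card S' \<le> card S" if "S' \<in> \<S>" for S'
    unfolding S(2) using fin that by (intro Max_ge) auto
  have SF: "S \<subseteq> F ` T" and pw: "pairwise (\<lambda>x y. \<not> R x y) S" using S(1) unfolding \<S>_def by auto
  have finS: "finite S" using SF T finite_subset by blast
  (* A value related to no member could be added, against maximality. *)
  have cover: "\<exists>s\<in>S. R (F t) s" if t: "t \<in> T" for t
  proof (rule ccontr)
    assume no: "\<not> (\<exists>s\<in>S. R (F t) s)"
    then have notin: "F t \<notin> S" using refl t by blast
    have "\<not> R s (F t)" if "s \<in> S" for s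
      using that SF no sym[OF _ t] by blast
    then have "pairwise (\<lambda>x y. \<not> R x y) (insert (F t) S)"
      using pw no by (auto simp: pairwise_insert)
    then have "insert (F t) S \<in> \<S>" using SF t unfolding \<S>_def by blast
    then have "card (insert (F t) S) \<le> card S" by (rule Smax)
    then show False using notin finS by simp
  qed
  have "T \<subseteq> (\<Union>s\<in>S. {t \<in> T. R (F t) s})" using cover by blast
  then have "card T \<le> card (\<Union>s\<in>S. {t \<in> T. R (F t) s})"
    using T finS by (intro card_mono) auto
  also have "\<dots> \<le> (\<Sum>s\<in>S. card {t \<in> T. R (F t) s})" by (rule card_UN_le[OF finS])
  also have "\<dots> \<le> (\<Sum>s\<in>S. m)"
  proof (rule sum_mono)
    fix s assume "s \<in> S"
    then obtain t where "t \<in> T" "s = F t" using SF by blast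
    then show "card {t \<in> T. R (F t) s} \<le> m" using bound by simp
  qed
  finally show thesis using that[OF SF pw] by (simp add: mult.commute)
qed

abbreviation (input) isomorphic_in :: "('a, 'b) monoid_scheme \<Rightarrow> 'a set \<Rightarrow> 'a set \<Rightarrow> bool" where
  "isomorphic_in G H K \<equiv> G\<lparr>carrier := H\<rparr> \<cong> G\<lparr>carrier := K\<rparr>"

lemma finite_subgroups: "finite (carrier G) \<Longrightarrow> finite {H. subgroup H G}"
  by (rule finite_subset[of _ "Pow (carrier G)"]) (auto dest: subgroup.subset)

lemma equiv_subgroup_iso:
  assumes "group G"
  shows "equiv {H. subgroup H G} (subgroup_iso_rel G)"
proof (rule equivI)
  show "subgroup_iso_rel G \<subseteq> {H. subgroup H G} \<times> {H. subgroup H G}"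
    by (auto simp: subgroup_iso_rel_def)
  show "refl_on {H. subgroup H G} (subgroup_iso_rel G)"
    by (auto simp: refl_on_def subgroup_iso_rel_def)
  show "sym (subgroup_iso_rel G)"
    using group.iso_sym[OF group.subgroup_imp_group[OF assms]]
    by (auto simp: sym_def subgroup_iso_rel_def)
  show "trans (subgroup_iso_rel G)"
    by (rule transI) (auto simp: subgroup_iso_rel_def intro: iso_trans)
qed

text \<open>
  Together with \<open>subgroup_type_representatives\<close> this describes the number of types as the size of a
  largest set of pairwise non-isomorphic subgroups, a form that is easily moved from one group to
  another.
\<close>

lemma card_le_num_subgroup_types:
  assumes G: "group G" "finite (carrier G)" and S: "S \<subseteq> {H. subgroup H G}"
    and pw: "pairwise (\<lambda>H K. \<not> isomorphic_in G H K) S"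
  shows "card S \<le> num_subgroup_types G"
  unfolding num_subgroup_types_def
proof (rule card_inj_on_le[of "\<lambda>H. subgroup_iso_rel G `` {H}"])
  show "inj_on (\<lambda>H. subgroup_iso_rel G `` {H}) S"
  proof (rule inj_onI)
    fix H K assume HK: "H \<in> S" "K \<in> S" "subgroup_iso_rel G `` {H} = subgroup_iso_rel G `` {K}"
    then have "(H, K) \<in> subgroup_iso_rel G"
      using eq_equiv_class[OF HK(3) equiv_subgroup_iso[OF G(1)]] S by blast
    then have "isomorphic_in G H K" by (simp add: subgroup_iso_rel_def)
    then show "H = K" using pw HK by (auto simp: pairwise_def)
  qed
  show "(\<lambda>H. subgroup_iso_rel G `` {H}) ` S \<subseteq> {H. subgroup H G} // subgroup_iso_rel G"
    using S by (auto intro: quotientI)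
  show "finite ({H. subgroup H G} // subgroup_iso_rel G)"
    using finite_subgroups[OF G(2)] equiv_subgroup_iso[OF G(1)]
    by (intro finite_quotient) (auto simp: equiv_def)
qed

lemma subgroup_type_representatives:
  assumes G: "group G"
  obtains S where "S \<subseteq> {H. subgroup H G}"
    "pairwise (\<lambda>H K. \<not> isomorphic_in G H K) S" "card S = num_subgroup_types G"
proof -
  let ?A = "{H. subgroup H G}" and ?r = "subgroup_iso_rel G"
  note eq = equiv_subgroup_iso[OF G]
  define rep where "rep X = (SOME H. H \<in> X)" for X :: "'a set set"
  have rep: "rep X \<in> X" if "X \<in> ?A // ?r" for X
    using in_quotient_imp_non_empty[OF eq that] unfolding rep_def by (simp add: some_in_eq)
  have repA: "rep X \<in> ?A" if "X \<in> ?A // ?r" for X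
    using rep[OF that] in_quotient_imp_subset[OF eq that] by blast
  have same: "X = Y" if X: "X \<in> ?A // ?r" "Y \<in> ?A // ?r" and iso: "isomorphic_in G (rep X) (rep Y)" for X Y
  proof -
    have "(rep X, rep Y) \<in> ?r" using repA X iso by (auto simp: subgroup_iso_rel_def)
    then show ?thesis using quotient_eqI[OF eq X rep[OF X(1)] rep[OF X(2)]] by blast
  qed
  show thesis
  proof (rule that[of "rep ` (?A // ?r)"])
    show "rep ` (?A // ?r) \<subseteq> ?A" using repA by blast
    show "pairwise (\<lambda>H K. \<not> isomorphic_in G H K) (rep ` (?A // ?r))"
      using same unfolding pairwise_def by blast
    have "inj_on rep (?A // ?r)"
      by (rule inj_onI) (use same in force)
    then show "card (rep ` (?A // ?r)) = num_subgroup_types G"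
      unfolding num_subgroup_types_def by (rule card_image)
  qed
qed

lemma num_subgroup_types_pos:
  assumes "group G" "finite (carrier G)"
  shows "num_subgroup_types G \<ge> 1"
  using card_le_num_subgroup_types[OF assms, of "{{\<one>\<^bsub>G\<^esub>}}"] group.triv_subgroup[OF assms(1)]
  by simp

lemma num_subgroup_types_le:
  assumes "finite (carrier G)"
  shows "num_subgroup_types G \<le> num_subgroups G"
proof -
  have "{H. subgroup H G} // subgroup_iso_rel G = (\<lambda>H. subgroup_iso_rel G `` {H}) ` {H. subgroup H G}"
    by (auto simp: quotient_def)
  then show ?thesis unfolding num_subgroup_types_def num_subgroups_def
    using card_image_le[OF finite_subgroups[OF assms]] by simp
qed

lemma num_subgroup_types_iso:
  assumes G: "group G" "group K" "finite (carrier K)" and iso: "G \<cong> K"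
  shows "num_subgroup_types G \<le> num_subgroup_types K"
proof -
  obtain h where h: "h \<in> iso G K" using iso by (auto simp: is_iso_def)
  obtain S where S: "S \<subseteq> {H. subgroup H G}"
    "pairwise (\<lambda>H K. \<not> isomorphic_in G H K) S" "card S = num_subgroup_types G"
    by (rule subgroup_type_representatives[OF G(1)])
  have hi: "G\<lparr>carrier := H\<rparr> \<cong> K\<lparr>carrier := h ` H\<rparr>" if "H \<in> S" for H
    using iso_restrict[OF h G(1,2)] S(1) that by (auto intro: is_isoI)
  have same: "H = L" if "H \<in> S" "L \<in> S" "isomorphic_in K (h ` H) (h ` L)" for H L
  proof -
    have "K\<lparr>carrier := h ` L\<rparr> \<cong> G\<lparr>carrier := L\<rparr>"
      using hi[OF that(2)] S(1) that(2) group.iso_sym[OF group.subgroup_imp_group[OF G(1)]] by blast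
    then have "isomorphic_in G H L"
      by (rule iso_trans[OF iso_trans[OF hi[OF that(1)] that(3)]])
    then show ?thesis using S(2) that by (auto simp: pairwise_def)
  qed
  have inj: "inj_on ((`) h) S" by (rule inj_onI) (use same in force)
  have "card ((`) h ` S) \<le> num_subgroup_types K"
  proof (rule card_le_num_subgroup_types[OF G(2,3)])
    show "(`) h ` S \<subseteq> {H. subgroup H K}"
      using S(1) subgroup.iso_subgroup[OF _ G(1,2) h] by blast
    show "pairwise (\<lambda>H L. \<not> isomorphic_in K H L) ((`) h ` S)"
      using same unfolding pairwise_def by blast
  qed
  then show ?thesis using card_image[OF inj] S(3) by simp
qed

lemma nilpotent_group_iso:
  assumes G: "nilpotent_group G" and K: "group K" and iso: "G \<cong> K"
  shows "nilpotent_group K"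
proof -
  obtain h where h: "h \<in> iso G K" using iso by (auto simp: is_iso_def)
  have gG: "group G" using G by (simp add: nilpotent_group_def)
  interpret group_hom G K h
    using h gG K by (auto simp: group_hom_def group_hom_axioms_def iso_def)
  have surj: "h ` carrier G = carrier K" using h by (auto simp: iso_def bij_betw_def)
  have sub: "lower_central K i \<subseteq> h ` lower_central G i" for i
  proof (induction i)
    case (Suc i)
    let ?C = "\<Union>x \<in> lower_central G i. \<Union>y \<in> carrier G.
       {commutator_of G x y}"
    have C: "?C \<subseteq> carrier G" using lower_central_sub[OF gG, of i] by auto
    have "(\<Union>x \<in> lower_central K i. \<Union>y \<in> carrier K.
       {commutator_of K x y}) \<subseteq> h ` ?C"
    proof (rule UN_least, rule UN_least)
      fix x y assume "x \<in> lower_central K i" "y \<in> carrier K"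
      then obtain a b where ab: "a \<in> lower_central G i" "x = h a" "b \<in> carrier G" "y = h b"
        using Suc surj by blast
      have "a \<in> carrier G" using ab lower_central_sub[OF gG] by blast
      then have "commutator_of K x y = h (commutator_of G a b)"
        using ab by simp
      then show "{commutator_of K x y} \<subseteq> h ` ?C" using ab by blast
    qed
    then have "lower_central K (Suc i) \<subseteq> generate K (h ` ?C)"
      unfolding lower_central.simps by (rule H.mono_generate)
    then show ?case unfolding generate_img[OF C] lower_central.simps .
  qed (simp add: surj)
  obtain c where "lower_central G c = {\<one>\<^bsub>G\<^esub>}" using G by (auto simp: nilpotent_group_def)
  then have le: "lower_central K c \<subseteq> {\<one>\<^bsub>K\<^esub>}" using sub[of c] by simp
  moreover have "\<one>\<^bsub>K\<^esub> \<in> lower_central K c" by (cases c) (auto intro: generate.one)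
  ultimately have "lower_central K c = {\<one>\<^bsub>K\<^esub>}" by blast
  then show ?thesis using K unfolding nilpotent_group_def by blast
qed

lemma nat_copy:
  fixes G (structure)
  assumes G: "group G" and fin: "finite (carrier G)"
  shows "\<exists>K :: nat monoid. group K \<and> G \<cong> K"
proof -
  interpret group G by fact
  obtain f :: "'a \<Rightarrow> nat" where inj: "inj_on f (carrier G)"
    using finite_imp_inj_to_nat_seg[OF fin] by blast
  define K :: "nat monoid" where "K = \<lparr>carrier = UNIV,
    monoid.mult = (\<lambda>x y. f (inv_into (carrier G) f x \<otimes> inv_into (carrier G) f y)), one = f \<one>\<rparr>"
  have hom: "f \<in> hom G K" using inj by (auto simp: hom_def K_def)
  let ?K = "K\<lparr>carrier := f ` carrier G, one := f \<one>\<rparr>"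
  have "f \<in> iso G ?K" using hom inj by (auto simp: iso_def hom_def bij_betw_def)
  then show ?thesis using hom_imp_img_group[OF hom] by (auto intro: is_isoI)
qed

lemma nilpotent_DirProd:
  assumes G: "nilpotent_group G" and K: "nilpotent_group K"
  shows "nilpotent_group (G \<times>\<times> K)"
proof -
  have gG: "group G" and gK: "group K" using G K by (auto simp: nilpotent_group_def)
  interpret GK: group "G \<times>\<times> K" by (rule DirProd_group[OF gG gK])
  have lc: "subgroup (lower_central L i) L" if "group L" for L :: "('x, 'y) monoid_scheme" and i
  proof (cases i)
    case (Suc j)
    interpret group L by fact
    show ?thesis unfolding Suc lower_central.simps
      using lower_central_sub[OF that, of j] by (intro generate_is_subgroup) auto
  qed (simp add: group.subgroup_self that)
  have sub: "lower_central (G \<times>\<times> K) i \<subseteq> lower_central G i \<times> lower_central K i" for i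
  proof (induction i)
    case (Suc i)
    show ?case unfolding lower_central.simps(2)[of "G \<times>\<times> K"]
    proof (rule GK.generate_subgroup_incl)
      show "subgroup (lower_central G (Suc i) \<times> lower_central K (Suc i)) (G \<times>\<times> K)"
        by (rule DirProd_subgroups[OF gG lc[OF gG] gK lc[OF gK]])
      show "(\<Union>x \<in> lower_central (G \<times>\<times> K) i. \<Union>y \<in> carrier (G \<times>\<times> K).
       {commutator_of (G \<times>\<times> K) x y})
       \<subseteq> lower_central G (Suc i) \<times> lower_central K (Suc i)"
      proof (rule UN_least, rule UN_least)
        fix x y assume "x \<in> lower_central (G \<times>\<times> K) i" "y \<in> carrier (G \<times>\<times> K)"
        then obtain a b a' b' where ab: "x = (a, b)" "y = (a', b')" "a \<in> lower_central G i" "b \<in> lower_central K i"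
          "a' \<in> carrier G" "b' \<in> carrier K" using Suc by auto
        have c: "a \<in> carrier G" "b \<in> carrier K"
          using ab lower_central_sub[OF gG] lower_central_sub[OF gK] by blast+
        have "commutator_of G a a' \<in> lower_central G (Suc i)"
          "commutator_of K b b' \<in> lower_central K (Suc i)"
          unfolding lower_central.simps using ab by (auto intro!: generate.incl)
        then show "{commutator_of (G \<times>\<times> K) x y}
          \<subseteq> lower_central G (Suc i) \<times> lower_central K (Suc i)"
          using ab c by (simp add: inv_DirProd[OF gG gK] del: lower_central.simps)
      qed
    qed
  qed simp
  obtain c where c: "lower_central G c = {\<one>\<^bsub>G\<^esub>}" using G by (auto simp: nilpotent_group_def)
  obtain d where d: "lower_central K d = {\<one>\<^bsub>K\<^esub>}" using K by (auto simp: nilpotent_group_def)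
  have mono: "lower_central L (i + j) \<subseteq> {\<one>\<^bsub>L\<^esub>}" if "group L" "lower_central L i = {\<one>\<^bsub>L\<^esub>}"
    for L :: "('x, 'y) monoid_scheme" and i j
  proof (induction j)
    case (Suc j)
    interpret group L by fact
    have "(\<Union>x \<in> lower_central L (i + j). \<Union>y \<in> carrier L.
       {commutator_of L x y}) \<subseteq> {\<one>\<^bsub>L\<^esub>}"
    proof (rule UN_least, rule UN_least)
      fix x y assume "x \<in> lower_central L (i + j)" "y \<in> carrier L"
      then show "{commutator_of L x y} \<subseteq> {\<one>\<^bsub>L\<^esub>}" using Suc by auto
    qed
    then show ?case unfolding add_Suc_right lower_central.simps
      by (rule generate_subgroup_incl[OF _ triv_subgroup])
  qed (use that in simp)
  have "lower_central (G \<times>\<times> K) (c + d) \<subseteq> {\<one>\<^bsub>G \<times>\<times> K\<^esub>}"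
    using sub[of "c + d"] mono[OF gG c, of d] mono[OF gK d, of c] by (auto simp: add.commute)
  moreover have "\<one>\<^bsub>G \<times>\<times> K\<^esub> \<in> lower_central (G \<times>\<times> K) (c + d)"
    by (rule subgroup.one_closed[OF lc]) (rule GK.is_group)
  ultimately have "lower_central (G \<times>\<times> K) (c + d) = {\<one>\<^bsub>G \<times>\<times> K\<^esub>}" by blast
  then show ?thesis unfolding nilpotent_group_def using GK.is_group by blast
qed

text \<open>
  The order of the \<open>D\<close>-component of \<open>\<theta> (x, 1)\<close> divides the orders of \<open>A\<close> and of \<open>D\<close>, so this component
  is trivial and the \<open>C\<close>-component determines \<open>x\<close>.
\<close>

lemma coprime_DirProd_embeds:
  assumes g: "group A" "group B" "group C" "group D" and cop: "coprime (order A) (order D)"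
    and \<theta>: "\<theta> \<in> iso (A \<times>\<times> B) (C \<times>\<times> D)"
  shows "\<exists>f \<in> hom A C. inj_on f (carrier A)"
proof -
  interpret A: group A by fact
  interpret B: group B by fact
  interpret D: group D by fact
  have hom: "\<theta> \<in> hom (A \<times>\<times> B) (C \<times>\<times> D)" and inj: "inj_on \<theta> (carrier A \<times> carrier B)"
    using \<theta> by (auto simp: iso_def bij_betw_def)
  define \<alpha> where "\<alpha> x = \<theta> (x, \<one>\<^bsub>B\<^esub>)" for x
  have \<alpha>c: "\<alpha> x \<in> carrier C \<times> carrier D" if "x \<in> carrier A" for x
    using hom that by (auto simp: hom_def \<alpha>_def)
  have \<alpha>m: "\<alpha> (x \<otimes>\<^bsub>A\<^esub> y) = \<alpha> x \<otimes>\<^bsub>C \<times>\<times> D\<^esub> \<alpha> y" if "x \<in> carrier A" "y \<in> carrier A" for x y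
  proof -
    have "\<theta> ((x, \<one>\<^bsub>B\<^esub>) \<otimes>\<^bsub>A \<times>\<times> B\<^esub> (y, \<one>\<^bsub>B\<^esub>)) = \<theta> (x, \<one>\<^bsub>B\<^esub>) \<otimes>\<^bsub>C \<times>\<times> D\<^esub> \<theta> (y, \<one>\<^bsub>B\<^esub>)"
      by (rule hom_mult[OF hom]) (use that in auto)
    then show ?thesis by (simp add: \<alpha>_def)
  qed
  have hf: "(\<lambda>x. fst (\<alpha> x)) \<in> hom A C" and hs: "(\<lambda>x. snd (\<alpha> x)) \<in> hom A D"
    using \<alpha>c \<alpha>m by (auto simp: hom_def mult_DirProd' mem_Times_iff)
  have snd: "snd (\<alpha> x) = \<one>\<^bsub>D\<^esub>" if x: "x \<in> carrier A" for x
  proof -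
    have sc: "snd (\<alpha> x) \<in> carrier D" using \<alpha>c[OF x] by auto
    interpret h: group_hom A D "\<lambda>x. snd (\<alpha> x)" by unfold_locales (rule hs)
    have "snd (\<alpha> x) [^]\<^bsub>D\<^esub> order A = snd (\<alpha> (x [^]\<^bsub>A\<^esub> order A))"
      using h.hom_nat_pow[OF x] by simp
    also have "\<dots> = \<one>\<^bsub>D\<^esub>" using A.pow_order_eq_1[OF x] h.hom_one by simp
    finally have "D.ord (snd (\<alpha> x)) dvd order A" using D.pow_eq_id[OF sc] by simp
    moreover have "D.ord (snd (\<alpha> x)) dvd order D" using D.ord_dvd_group_order[OF sc] .
    ultimately have "D.ord (snd (\<alpha> x)) = 1" using cop by (metis coprime_common_divisor nat_dvd_1_iff_1 One_nat_def is_unit_gcd coprime_def)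
    then show ?thesis using D.ord_eq_1[OF sc] by simp
  qed
  have "inj_on (\<lambda>x. fst (\<alpha> x)) (carrier A)"
  proof (rule inj_onI)
    fix x y assume xy: "x \<in> carrier A" "y \<in> carrier A" "fst (\<alpha> x) = fst (\<alpha> y)"
    then have "\<alpha> x = \<alpha> y" using snd by (simp add: prod_eq_iff)
    then show "x = y"
      using inj_onD[OF inj, of "(x, \<one>\<^bsub>B\<^esub>)" "(y, \<one>\<^bsub>B\<^esub>)"] xy by (simp add: \<alpha>_def)
  qed
  then show ?thesis using hf by blast
qed

lemma coprime_DirProd_iso:
  assumes g: "group A" "group B" "group C" "group D"
    and fin: "finite (carrier A)" "finite (carrier C)"
    and cop: "coprime (order A) (order D)" "coprime (order C) (order B)"
    and iso: "A \<times>\<times> B \<cong> C \<times>\<times> D"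
  shows "A \<cong> C"
proof -
  have "C \<times>\<times> D \<cong> A \<times>\<times> B" using group.iso_sym[OF DirProd_group[OF g(1,2)] iso] .
  then obtain \<theta> \<theta>' where \<theta>: "\<theta> \<in> iso (A \<times>\<times> B) (C \<times>\<times> D)" "\<theta>' \<in> iso (C \<times>\<times> D) (A \<times>\<times> B)"
    using iso by (auto simp: is_iso_def)
  obtain f where f: "f \<in> hom A C" "inj_on f (carrier A)"
    using coprime_DirProd_embeds[OF g cop(1) \<theta>(1)] by blast
  obtain f' where f': "f' \<in> hom C A" "inj_on f' (carrier C)"
    using coprime_DirProd_embeds[OF g(3,4,1,2) cop(2) \<theta>(2)] by blast
  have s: "f ` carrier A \<subseteq> carrier C" "f' ` carrier C \<subseteq> carrier A"
    using f f' by (auto simp: hom_def)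
  have "card (carrier C) \<le> card (carrier A)" by (rule card_inj_on_le[OF f'(2) s(2) fin(1)])
  then have "f ` carrier A = carrier C"
    using s(1) fin f(2) by (intro card_seteq) (simp_all add: card_image)
  then show ?thesis using f by (intro is_isoI isoI) (auto simp: bij_betw_def)
qed

lemma coprime_DirProd_iso_both:
  assumes g: "group A" "group B" "group C" "group D"
    and fin: "finite (carrier A)" "finite (carrier B)" "finite (carrier C)" "finite (carrier D)"
    and cop: "coprime (order A) (order D)" "coprime (order C) (order B)"
    and iso: "A \<times>\<times> B \<cong> C \<times>\<times> D"
  shows "A \<cong> C" "B \<cong> D"
proof -
  show "A \<cong> C" by (rule coprime_DirProd_iso[OF g fin(1,3) cop iso])
  have "B \<times>\<times> A \<cong> D \<times>\<times> C"
    using iso_trans[OF iso_trans[OF DirProd_commute_iso iso] DirProd_commute_iso] .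
  then show "B \<cong> D"
    using coprime_DirProd_iso[OF g(2,1,4,3) fin(2,4)] cop by (simp add: coprime_commute)
qed

lemma subgroup_group_facts:
  assumes G: "group G" "finite (carrier G)" and H: "subgroup H G"
  shows "order (G\<lparr>carrier := H\<rparr>) dvd order G" "group (G\<lparr>carrier := H\<rparr>)" "finite H"
  using group.card_subgroup_dvd[OF G(1) H group.subgroup_self[OF G(1)] subgroup.subset[OF H]]
    group.subgroup_imp_group[OF G(1) H] finite_subset[OF subgroup.subset[OF H] G(2)]
  by (simp_all add: order_def)

text \<open>
  Products of representatives in the two factors are pairwise non-isomorphic, because their factors
  again have coprime orders and can be recovered up to isomorphism.
\<close>

lemma num_subgroup_types_DirProd:
  assumes g: "group G" "group K" and fin: "finite (carrier G)" "finite (carrier K)"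
    and cop: "coprime (order G) (order K)"
  shows "num_subgroup_types G * num_subgroup_types K \<le> num_subgroup_types (G \<times>\<times> K)"
proof -
  obtain S where S: "S \<subseteq> {H. subgroup H G}"
    "pairwise (\<lambda>H K. \<not> isomorphic_in G H K) S" "card S = num_subgroup_types G"
    by (rule subgroup_type_representatives[OF g(1)])
  obtain T where T: "T \<subseteq> {H. subgroup H K}"
    "pairwise (\<lambda>H L. \<not> isomorphic_in K H L) T" "card T = num_subgroup_types K"
    by (rule subgroup_type_representatives[OF g(2)])
  define F where "F = (\<lambda>(H, L). H \<times> L :: ('a \<times> 'c) set)"
  have ordS: "order (G\<lparr>carrier := H\<rparr>) dvd order G" "group (G\<lparr>carrier := H\<rparr>)" "finite H" if "H \<in> S" for H
    using subgroup_group_facts[OF g(1) fin(1)] S(1) that by blast+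
  have ordT: "order (K\<lparr>carrier := H\<rparr>) dvd order K" "group (K\<lparr>carrier := H\<rparr>)" "finite H" if "H \<in> T" for H
    using subgroup_group_facts[OF g(2) fin(2)] T(1) that by blast+
  have eqc: "(G \<times>\<times> K)\<lparr>carrier := H \<times> L\<rparr> = G\<lparr>carrier := H\<rparr> \<times>\<times> K\<lparr>carrier := L\<rparr>" for H L
    by (simp add: DirProd_def)
  have same: "H = H' \<and> L = L'"
    if m: "H \<in> S" "H' \<in> S" "L \<in> T" "L' \<in> T"
      and iso: "isomorphic_in (G \<times>\<times> K) (H \<times> L) (H' \<times> L')" for H H' L L'
  proof -
    have c: "coprime (order (G\<lparr>carrier := H1\<rparr>)) (order (K\<lparr>carrier := L1\<rparr>))" if "H1 \<in> S" "L1 \<in> T" for H1 L1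
      using cop ordS(1)[OF that(1)] ordT(1)[OF that(2)] by (meson coprime_divisors)
    have f: "finite (carrier (G\<lparr>carrier := H\<rparr>))" "finite (carrier (K\<lparr>carrier := L\<rparr>))"
      "finite (carrier (G\<lparr>carrier := H'\<rparr>))" "finite (carrier (K\<lparr>carrier := L'\<rparr>))"
      using ordS(3) ordT(3) m by auto
    note b = coprime_DirProd_iso_both[OF ordS(2)[OF m(1)] ordT(2)[OF m(3)] ordS(2)[OF m(2)] ordT(2)[OF m(4)] f
       c[OF m(1,4)] c[OF m(2,3)] iso[unfolded eqc]]
    show ?thesis using b S(2) T(2) m unfolding pairwise_def by metis
  qed
  have inj: "inj_on F (S \<times> T)"
  proof (rule inj_onI)
    fix x y assume xy: "x \<in> S \<times> T" "y \<in> S \<times> T" "F x = F y"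
    then show "x = y" using same[of "fst x" "fst y" "snd x" "snd y"] unfolding F_def by (auto simp: prod_eq_iff split: prod.splits)
  qed
  have "card (F ` (S \<times> T)) \<le> num_subgroup_types (G \<times>\<times> K)"
  proof (rule card_le_num_subgroup_types)
    show "group (G \<times>\<times> K)" by (rule DirProd_group[OF g])
    show "finite (carrier (G \<times>\<times> K))" using fin by simp
    show "F ` (S \<times> T) \<subseteq> {H. subgroup H (G \<times>\<times> K)}"
      using S(1) T(1) DirProd_subgroups[OF g(1) _ g(2)] by (auto simp: F_def)
    show "pairwise (\<lambda>H L. \<not> isomorphic_in (G \<times>\<times> K) H L) (F ` (S \<times> T))"
      unfolding pairwise_def F_def using same by fastforce
  qed
  then show ?thesis using card_image[OF inj] S(3) T(3) by (simp add: card_cartesian_product)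
qed

section \<open>Class-2 groups from bilinear maps\<close>

lemma mod_add3: "(a mod m + b + c mod m) mod m = (a + b + c) mod (m::int)"
  by (simp only: mod_add_right_eq) (simp only: add.assoc mod_add_left_eq)

lemma mod_add3': "(a + b mod m + c mod m) mod m = (a + b + c) mod (m::int)"
  using mod_add3[of b m a c] by (simp only: add.commute)

text \<open>
  The central extension with the bilinear map \<open>\<omega>\<close> as its cocycle. Its elements are coordinate vectors
  modulo \<open>p\<close>: the coordinates in \<open>B\<close> are those of the quotient, the other ones belong to the centre.
  Arbitrary bilinear maps are allowed, since an alternating cocycle modulo 2 is symmetric and has only
  trivial commutators; the commutators are given by the alternating map \<open>\<omega> f g - \<omega> g f\<close>.
\<close>

locale bilinear_extension =
  fixes p :: nat and I B :: "'i set" and \<omega> :: "('i \<Rightarrow> int) \<Rightarrow> ('i \<Rightarrow> int) \<Rightarrow> 'i \<Rightarrow> int"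
  assumes p: "p > 1" and finI: "finite I" and BI: "B \<subseteq> I"
    and \<omega>B: "i \<in> B \<Longrightarrow> \<omega> f g i = 0"
    and add_left: "\<omega> (\<lambda>j. f j + f' j) g i = \<omega> f g i + \<omega> f' g i"
    and add_right: "\<omega> f (\<lambda>j. g j + g' j) i = \<omega> f g i + \<omega> f g' i"
    and \<omega>_cong: "\<lbrakk>\<And>j. j \<in> B \<Longrightarrow> f j mod int p = f' j mod int p; \<And>j. j \<in> B \<Longrightarrow> g j mod int p = g' j mod int p\<rbrakk>
      \<Longrightarrow> \<omega> f g i mod int p = \<omega> f' g' i mod int p"
begin

definition ext_group :: "('i \<Rightarrow> int) monoid" where
  "ext_group = \<lparr>carrier = I \<rightarrow>\<^sub>E {0..<int p},
     monoid.mult = (\<lambda>f g. \<lambda>i\<in>I. (f i + g i + \<omega> f g i) mod int p), one = (\<lambda>i\<in>I. 0)\<rparr>"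

abbreviation "V \<equiv> carrier ext_group"

abbreviation vec_mult (infixl \<open>\<odot>\<close> 70) where
  "f \<odot> g \<equiv> f \<otimes>\<^bsub>ext_group\<^esub> g"

lemma V_def: "V = I \<rightarrow>\<^sub>E {0..<int p}" by (simp add: ext_group_def)

lemma V_ext: "f \<in> V \<Longrightarrow> g \<in> V \<Longrightarrow> (\<And>i. i \<in> I \<Longrightarrow> f i mod int p = g i mod int p) \<Longrightarrow> f = g"
  unfolding V_def by (rule PiE_ext) (auto simp: PiE_iff)

lemma V_mod: "f \<in> V \<Longrightarrow> i \<in> I \<Longrightarrow> f i mod int p = f i"
  unfolding V_def by (auto simp: PiE_iff)

lemma V_restrict: "(\<lambda>i\<in>I. h i mod int p) \<in> V"
  unfolding V_def using p by (auto simp: PiE_iff)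

lemma mult_eq: "f \<odot> g = (\<lambda>i\<in>I. (f i + g i + \<omega> f g i) mod int p)"
  by (simp add: ext_group_def)

lemma one_eq: "\<one>\<^bsub>ext_group\<^esub> = (\<lambda>i\<in>I. 0)"
  by (simp add: ext_group_def)

lemma mult_app: "i \<in> I \<Longrightarrow> (f \<odot> g) i = (f i + g i + \<omega> f g i) mod int p"
  by (simp add: mult_eq)

lemma mult_app_B: "i \<in> B \<Longrightarrow> (f \<odot> g) i = (f i + g i) mod int p"
  using BI \<omega>B by (auto simp: mult_eq)

lemma mult_closed: "f \<odot> g \<in> V"
  unfolding mult_eq by (rule V_restrict)

lemma one_closed: "\<one>\<^bsub>ext_group\<^esub> \<in> V"
  unfolding one_eq V_def using p by (auto simp: PiE_iff)

lemma zero_left: "\<omega> (\<lambda>j. 0) g i = 0"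
  using add_left[of "\<lambda>j. 0" "\<lambda>j. 0" g i] by simp

lemma zero_right: "\<omega> f (\<lambda>j. 0) i = 0"
  using add_right[of f "\<lambda>j. 0" "\<lambda>j. 0" i] by simp

lemma minus_left: "\<omega> (\<lambda>j. - f j) g i = - \<omega> f g i"
  using add_left[of "\<lambda>j. - f j" f g i] zero_left by simp

lemma \<omega>_mult_left: "\<omega> (f \<odot> g) h i mod int p = (\<omega> f h i + \<omega> g h i) mod int p"
  unfolding add_left[symmetric] by (rule \<omega>_cong) (simp_all add: mult_app_B)

lemma \<omega>_mult_right: "\<omega> h (f \<odot> g) i mod int p = (\<omega> h f i + \<omega> h g i) mod int p"
  unfolding add_right[symmetric] by (rule \<omega>_cong) (simp_all add: mult_app_B)

definition central_vec :: "('i \<Rightarrow> int) \<Rightarrow> bool" where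
  "central_vec r \<longleftrightarrow> r \<in> V \<and> (\<forall>i\<in>B. r i = 0)"

lemma \<omega>_central_left: "central_vec r \<Longrightarrow> \<omega> r g i mod int p = 0"
  using \<omega>_cong[of r "\<lambda>j. 0" g g i] zero_left by (auto simp: central_vec_def)

lemma \<omega>_central_right: "central_vec r \<Longrightarrow> \<omega> g r i mod int p = 0"
  using \<omega>_cong[of g g r "\<lambda>j. 0" i] zero_right by (auto simp: central_vec_def)

lemma central_mult: "central_vec r \<Longrightarrow> r \<odot> g = (\<lambda>i\<in>I. (r i + g i) mod int p)"
  unfolding mult_eq using \<omega>_central_left
  by (intro restrict_ext) (metis add.right_neutral mod_add_right_eq)

lemma mult_central: "central_vec r \<Longrightarrow> g \<odot> r = (\<lambda>i\<in>I. (r i + g i) mod int p)"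
  unfolding mult_eq using \<omega>_central_right
  by (intro restrict_ext) (metis add.right_neutral mod_add_right_eq add.commute)

lemma central_commute: "central_vec r \<Longrightarrow> r \<odot> g = g \<odot> r"
  by (simp add: central_mult mult_central)

lemma central_one: "central_vec \<one>\<^bsub>ext_group\<^esub>"
  using one_closed BI by (auto simp: central_vec_def one_eq)

lemma central_closed: "central_vec r \<Longrightarrow> central_vec s \<Longrightarrow> central_vec (r \<odot> s)"
  using mult_closed by (auto simp: central_vec_def mult_app_B)

lemma is_group: "group ext_group"
proof (rule groupI)
  fix f g h
  show "f \<odot> g \<odot> h = f \<odot> (g \<odot> h)"
  proof (rule V_ext)
    fix i assume i: "i \<in> I"
    have "(f \<odot> g \<odot> h) i
        = ((f i + g i + \<omega> f g i) mod int p + h i + \<omega> (f \<odot> g) h i mod int p) mod int p"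
      by (simp add: mult_app i mod_simps)
    also have "\<dots> = (f i + g i + h i + \<omega> f g i + \<omega> f h i + \<omega> g h i) mod int p"
      unfolding \<omega>_mult_left mod_add3 by (simp only: ac_simps)
    also have "\<dots> = (f i + (g i + h i + \<omega> g h i) mod int p + \<omega> f (g \<odot> h) i mod int p) mod int p"
      unfolding \<omega>_mult_right mod_add3' by (simp only: ac_simps)
    also have "\<dots> = (f \<odot> (g \<odot> h)) i"
      by (simp add: mult_app i mod_simps)
    finally show "(f \<odot> g \<odot> h) i mod int p
        = (f \<odot> (g \<odot> h)) i mod int p" by simp
  qed (rule mult_closed)+
next
  fix f assume f: "f \<in> V"
  show "\<one>\<^bsub>ext_group\<^esub> \<odot> f = f"
  proof (rule V_ext[OF mult_closed f])
    fix i assume "i \<in> I"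
    then show "(\<one>\<^bsub>ext_group\<^esub> \<odot> f) i mod int p = f i mod int p"
      by (simp add: central_mult[OF central_one]) (simp add: one_eq)
  qed
  define g where "g = (\<lambda>i\<in>I. (- f i + \<omega> f f i) mod int p)"
  have "g \<odot> f = \<one>\<^bsub>ext_group\<^esub>"
  proof (rule V_ext[OF mult_closed one_closed])
    fix i assume i: "i \<in> I"
    have "\<omega> g f i mod int p = \<omega> (\<lambda>j. - f j) f i mod int p"
      by (rule \<omega>_cong) (use BI \<omega>B in \<open>auto simp: g_def\<close>)
    then have *: "\<omega> g f i mod int p = (- \<omega> f f i) mod int p" by (simp add: minus_left)
    have "(g \<odot> f) i = ((- f i + \<omega> f f i) mod int p + f i + \<omega> g f i mod int p) mod int p"
      using i by (simp add: mult_app mod_simps) (simp add: g_def mod_simps)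
    also have "\<dots> = 0" unfolding * mod_add3 by simp
    finally show "(g \<odot> f) i mod int p = \<one>\<^bsub>ext_group\<^esub> i mod int p"
      using i by (simp add: one_eq)
  qed
  moreover have "g \<in> V" unfolding g_def by (rule V_restrict)
  ultimately show "\<exists>g\<in>V. g \<odot> f = \<one>\<^bsub>ext_group\<^esub>" by blast
qed (rule mult_closed one_closed)+

sublocale group ext_group by (rule is_group)

lemma finite_V: "finite V"
  unfolding V_def using finI by (intro finite_PiE) auto

lemma order_ext_group: "order ext_group = p ^ card I"
  unfolding order_def V_def using finI by (simp add: card_PiE)

definition comm_vec :: "('i \<Rightarrow> int) \<Rightarrow> ('i \<Rightarrow> int) \<Rightarrow> 'i \<Rightarrow> int" where
  "comm_vec f g = (\<lambda>i\<in>I. (\<omega> f g i - \<omega> g f i) mod int p)"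

lemma comm_vec_V: "comm_vec f g \<in> V"
  unfolding comm_vec_def by (rule V_restrict)

lemma central_comm_vec: "central_vec (comm_vec f g)"
  using comm_vec_V \<omega>B BI by (auto simp: central_vec_def comm_vec_def)

text \<open>
  Commutators are handled through this identity rather than with inverses: multiplying elements in
  the other order costs the central factor \<open>comm_vec f g\<close>.
\<close>

lemma comm_vec_eq: "f \<odot> g = comm_vec f g \<odot> (g \<odot> f)"
proof (rule V_ext[OF mult_closed mult_closed])
  fix i assume "i \<in> I"
  then show "(f \<odot> g) i mod int p = (comm_vec f g \<odot> (g \<odot> f)) i mod int p"
    by (simp add: central_mult[OF central_comm_vec])
      (simp add: comm_vec_def mult_app mod_add_eq, simp add: algebra_simps)
qed

lemma comm_vec_central_mult:
  assumes "central_vec r"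
  shows "comm_vec (r \<odot> f) g = comm_vec f g"
proof (rule V_ext[OF comm_vec_V comm_vec_V])
  fix i assume i: "i \<in> I"
  have "\<omega> (r \<odot> f) g i mod int p = \<omega> f g i mod int p"
    unfolding \<omega>_mult_left using \<omega>_central_left[OF assms] by (metis add_0 mod_add_left_eq)
  moreover have "\<omega> g (r \<odot> f) i mod int p = \<omega> g f i mod int p"
    unfolding \<omega>_mult_right using \<omega>_central_right[OF assms] by (metis add_0 mod_add_left_eq)
  ultimately show "comm_vec (r \<odot> f) g i mod int p = comm_vec f g i mod int p"
    using i by (simp add: comm_vec_def) (metis mod_diff_cong)
qed

lemma comm_vec_central_mult_right:
  assumes "central_vec r"
  shows "comm_vec f (r \<odot> g) = comm_vec f g"
proof (rule V_ext[OF comm_vec_V comm_vec_V])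
  fix i assume i: "i \<in> I"
  have "(- comm_vec (r \<odot> g) f i) mod int p = (- comm_vec g f i) mod int p"
    by (simp only: comm_vec_central_mult[OF assms])
  then show "comm_vec f (r \<odot> g) i mod int p = comm_vec f g i mod int p"
    using i by (simp add: comm_vec_def mod_minus_eq)
qed

text \<open>
  All commutators are central, so the lower central series vanishes after two steps.
\<close>

lemma nilpotent: "nilpotent_group ext_group"
proof -
  have comm: "commutator_of ext_group f g = comm_vec f g"
    if "f \<in> V" "g \<in> V" for f g
    using that comm_vec_V comm_vec_eq[of f g] by (simp add: m_assoc)
  have sub: "subgroup {r. central_vec r} ext_group"
  proof (rule subgroupI)
    show "{r. central_vec r} \<subseteq> V" by (auto simp: central_vec_def)
    show "{r. central_vec r} \<noteq> {}" using central_one by blast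
    fix r assume "r \<in> {r. central_vec r}"
    then have r: "central_vec r" "r \<in> V" by (auto simp: central_vec_def)
    have ri: "inv\<^bsub>ext_group\<^esub> r \<in> V" using r by simp
    have "(inv\<^bsub>ext_group\<^esub> r) i = 0" if i: "i \<in> B" for i
    proof -
      have "(inv\<^bsub>ext_group\<^esub> r \<odot> r) i = \<one>\<^bsub>ext_group\<^esub> i" using r by simp
      then have "(inv\<^bsub>ext_group\<^esub> r) i mod int p = 0"
        using i BI r(1) by (auto simp: mult_app_B one_eq central_vec_def)
      then show ?thesis using V_mod[OF ri, of i] i BI by (metis subsetD)
    qed
    then show "inv\<^bsub>ext_group\<^esub> r \<in> {r. central_vec r}" using ri by (simp add: central_vec_def)
  qed (use central_closed in blast)
  have 1: "lower_central ext_group 1 \<subseteq> {r. central_vec r}"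
    unfolding One_nat_def lower_central.simps
    by (rule generate_subgroup_incl[OF _ sub]) (auto simp: comm central_comm_vec)
  have c1: "commutator_of ext_group f g = \<one>\<^bsub>ext_group\<^esub>"
    if "f \<in> lower_central ext_group 1" "g \<in> V" for f g
  proof -
    have f: "central_vec f" "f \<in> V" using 1 that by (auto simp: central_vec_def)
    have "f \<odot> g = g \<odot> f" by (rule central_commute[OF f(1)])
    then show ?thesis using f that by (simp add: m_assoc)
  qed
  have "lower_central ext_group (Suc 1) \<subseteq> {\<one>\<^bsub>ext_group\<^esub>}"
    unfolding lower_central.simps(2)
    by (rule generate_subgroup_incl[OF _ triv_subgroup]) (simp only: UN_subset_iff, intro ballI, simp add: c1)
  moreover have "\<one>\<^bsub>ext_group\<^esub> \<in> lower_central ext_group (Suc 1)"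
    unfolding lower_central.simps(2) by (rule generate.one)
  ultimately have "lower_central ext_group (Suc 1) = {\<one>\<^bsub>ext_group\<^esub>}" by blast
  then show ?thesis unfolding nilpotent_group_def using is_group by blast
qed

definition unit_vec :: "'i \<Rightarrow> 'i \<Rightarrow> int" where
  "unit_vec j = (\<lambda>i\<in>I. if i = j then 1 else 0)"

lemma unit_vec_V: "unit_vec j \<in> V"
  unfolding unit_vec_def V_def using p by (auto simp: PiE_iff)

lemma central_unit_vec: "j \<notin> B \<Longrightarrow> central_vec (unit_vec j)"
  using unit_vec_V BI by (auto simp: central_vec_def unit_vec_def)

text \<open>
  Vectors supported on \<open>J\<close> are multiplied by adding their coordinates, so every such vector is reached
  by multiplying unit vectors; the induction removes one of them at a time.
\<close>

lemma central_generated: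
  assumes J: "J \<subseteq> I - B"
    and S: "\<one>\<^bsub>ext_group\<^esub> \<in> S" "\<And>j. j \<in> J \<Longrightarrow> unit_vec j \<in> S"
      "\<And>r s. r \<in> S \<Longrightarrow> s \<in> S \<Longrightarrow> r \<odot> s \<in> S"
    and r: "r \<in> V" "\<And>i. i \<in> I - J \<Longrightarrow> r i = 0"
  shows "r \<in> S"
  using r
proof (induction "\<Sum>i\<in>I. nat (r i)" arbitrary: r rule: less_induct)
  case less
  show ?case
  proof (cases "\<forall>i\<in>I. r i = 0")
    case True
    then have "r = \<one>\<^bsub>ext_group\<^esub>" by (intro V_ext less.prems one_closed) (simp add: one_eq)
    then show ?thesis using S by simp
  next
    case False
    then obtain j where j: "j \<in> I" "r j \<noteq> 0" by blast
    then have jJ: "j \<in> J" using less.prems by blast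
    have rj: "0 < r j" "r j < int p"
      using less.prems(1) j by (fastforce simp: V_def PiE_iff)+
    define s where "s = r(j := r j - 1)"
    have sV: "s \<in> V"
      using less.prems(1) j rj unfolding V_def s_def by (auto simp: PiE_iff extensional_def)
    have "(\<Sum>i\<in>I. nat (s i)) < (\<Sum>i\<in>I. nat (r i))"
      by (rule sum_strict_mono_ex1[OF finI]) (use j rj in \<open>auto simp: s_def\<close>)
    moreover have "s i = 0" if "i \<in> I - J" for i
      using that jJ less.prems(2) unfolding s_def by auto
    ultimately have sS: "s \<in> S" using less.hyps[of s] sV by blast
    have "r = unit_vec j \<odot> s"
    proof (rule V_ext[OF less.prems(1) mult_closed])
      fix i assume i: "i \<in> I"
      have "central_vec (unit_vec j)" using jJ J by (intro central_unit_vec) auto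
      then show "r i mod int p = (unit_vec j \<odot> s) i mod int p"
        using i by (simp add: central_mult) (simp add: s_def unit_vec_def)
    qed
    then show ?thesis using S jJ sS by metis
  qed
qed

end

section \<open>The group of six forms and a tensor\<close>

text \<open>
  \<open>P\<close> and \<open>Q\<close> index the two halves of the domain of the linear maps \<open>\<phi>\<close>, and \<open>U\<close> and \<open>W\<close> the two halves
  of their codomain. \<open>C\<close> and \<open>D\<close> index the arguments of the tensor and \<open>E\<close> its values. The first six
  coordinates \<open>Z\<close> hold the values of the six forms, the remaining ones fill up the order of the group.
\<close>

datatype coord = P nat | Q nat | U nat | W nat | C nat | D nat | Z nat | E nat

definition outer_coords :: "nat \<Rightarrow> nat \<Rightarrow> coord set" where
  "outer_coords k a = P ` {..<k} \<union> Q ` {..<k} \<union> U ` {..<k} \<union> W ` {..<k} \<union> C ` {..<a} \<union> D ` {..<a}"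

definition coords :: "nat \<Rightarrow> nat \<Rightarrow> nat \<Rightarrow> coord set" where
  "coords k a c = outer_coords k a \<union> Z ` {..<c} \<union> E ` {..<a}"

text \<open>
  \<open>Z 0\<close> is the pairing of \<open>P\<close> and \<open>Q\<close>, and \<open>Z 1\<close> is the same pairing with a shift by one position.
  The forms \<open>Z 2\<close> to \<open>Z 5\<close> serve to read off the entries of \<open>\<phi>\<close>. An entry in a column of \<open>P\<close> is found by
  a form on \<open>Q\<close> and the codomain, and an entry in a column of \<open>Q\<close> by a form on \<open>P\<close> and the codomain; with
  this crossing, only one of the two terms of a commutator is non-zero, whereas a form on \<open>P\<close> would give the
  difference of two entries in columns of \<open>P\<close>.
\<close>

fun form :: "nat \<Rightarrow> nat \<Rightarrow> (nat \<times> nat \<times> nat \<Rightarrow> int) \<Rightarrow> (coord \<Rightarrow> int) \<Rightarrow> (coord \<Rightarrow> int) \<Rightarrow> coord \<Rightarrow> int" where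
  "form k a \<tau> f g (Z t) =
     (if t = 0 then \<Sum>i<k. f (P i) * g (Q i)
      else if t = 1 then \<Sum>i<k - 1. f (P i) * g (Q (Suc i))
      else if t = 2 then \<Sum>i<k. f (Q i) * g (U i)
      else if t = 3 then \<Sum>i<k. f (Q i) * g (W i)
      else if t = 4 then \<Sum>i<k. f (P i) * g (U i)
      else if t = 5 then \<Sum>i<k. f (P i) * g (W i)
      else 0)"
| "form k a \<tau> f g (E l) = (\<Sum>i<a. \<Sum>j<a. \<tau> (i, j, l) * f (C i) * g (D j))"
| "form k a \<tau> f g _ = 0"

lemma mod_sum_cong:
  fixes f g :: "'a \<Rightarrow> int"
  assumes "\<And>i. i \<in> A \<Longrightarrow> f i mod m = g i mod m"
  shows "(\<Sum>i\<in>A. f i) mod m = (\<Sum>i\<in>A. g i) mod m"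
  using assms by (induction A rule: infinite_finite_induct) (auto intro!: mod_add_cong)

lemma sum_unit:
  assumes "finite A" "j \<in> A"
  shows "(\<Sum>i\<in>A. (if i = j then 1 else 0) * h i) = (h j :: int)"
    "(\<Sum>i\<in>A. h i * (if i = j then 1 else 0)) = (h j :: int)"
proof -
  have "(if i = j then 1 else 0) * h i = (if i = j then h i else 0)"
    "h i * (if i = j then 1 else 0) = (if i = j then h i else 0)" for i by simp_all
  then show "(\<Sum>i\<in>A. (if i = j then 1 else 0) * h i) = h j"
    "(\<Sum>i\<in>A. h i * (if i = j then 1 else 0)) = h j" using assms by (simp_all add: sum.delta)
qed

lemma bilinear_form:
  assumes "p > 1"
  shows "bilinear_extension p (coords k a c) (outer_coords k a) (form k a \<tau>)"
proof
  show "finite (coords k a c)" "outer_coords k a \<subseteq> coords k a c"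
    by (auto simp: coords_def outer_coords_def)
  fix f f' g g' :: "coord \<Rightarrow> int" and i
  show "i \<in> outer_coords k a \<Longrightarrow> form k a \<tau> f g i = 0"
    by (auto simp: outer_coords_def)
  show "form k a \<tau> (\<lambda>j. f j + f' j) g i = form k a \<tau> f g i + form k a \<tau> f' g i"
    by (cases i) (simp_all add: distrib_left distrib_right sum.distrib)
  show "form k a \<tau> f (\<lambda>j. g j + g' j) i = form k a \<tau> f g i + form k a \<tau> f g' i"
    by (cases i) (simp_all add: distrib_left distrib_right sum.distrib)
  assume f: "\<And>j. j \<in> outer_coords k a \<Longrightarrow> f j mod int p = f' j mod int p"
    and g: "\<And>j. j \<in> outer_coords k a \<Longrightarrow> g j mod int p = g' j mod int p"
  show "form k a \<tau> f g i mod int p = form k a \<tau> f' g' i mod int p"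
    by (cases i)
      (auto simp: outer_coords_def intro!: mod_sum_cong mod_mult_cong f g)
qed (use assms in simp)

locale tensor_group =
  fixes p k a c :: nat
  assumes p1: "p > 1"
begin

definition form_group where
  "form_group \<tau> = bilinear_extension.ext_group p (coords k a c) (form k a \<tau>)"

definition vecs where "vecs = coords k a c \<rightarrow>\<^sub>E {0..<int p}"

lemma bilinear: "bilinear_extension p (coords k a c) (outer_coords k a) (form k a \<tau>)"
  by (rule bilinear_form[OF p1])

lemmas group_form_group = bilinear[THEN bilinear_extension.is_group, folded form_group_def]

lemma carrier_form_group: "carrier (form_group \<tau>) = vecs"
  unfolding form_group_def vecs_def by (rule bilinear_extension.V_def[OF bilinear])

lemma mult_form_group: "f \<otimes>\<^bsub>form_group \<tau>\<^esub> g = (\<lambda>i\<in>coords k a c. (f i + g i + form k a \<tau> f g i) mod int p)"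
  unfolding form_group_def by (rule bilinear_extension.mult_eq[OF bilinear])

lemma card_coords: "card (coords k a c) = 4 * k + 3 * a + c"
proof -
  have "card (P ` {..<k} \<union> Q ` {..<k} \<union> U ` {..<k} \<union> W ` {..<k} \<union> C ` {..<a} \<union> D ` {..<a} \<union> Z ` {..<c} \<union> E ` {..<a}) = 4 * k + 3 * a + c"
    by (subst card_Un_disjoint; (auto simp: card_image inj_on_def)?)+
  then show ?thesis by (simp add: coords_def outer_coords_def)
qed

lemma order_form_group: "order (form_group \<tau>) = p ^ (4 * k + 3 * a + c)"
  unfolding form_group_def using bilinear_extension.order_ext_group[OF bilinear] by (simp add: card_coords)

lemma nilpotent_form_group: "nilpotent_group (form_group \<tau>)"
  unfolding form_group_def by (rule bilinear_extension.nilpotent[OF bilinear])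

lemma finite_form_group: "finite (carrier (form_group \<tau>))"
  unfolding form_group_def by (rule bilinear_extension.finite_V[OF bilinear])

definition tensors where
  "tensors = ({..<a} \<times> {..<a} \<times> {..<a}) \<rightarrow>\<^sub>E {0..<int p}"

lemma card_tensors: "card tensors = p ^ (a ^ 3)"
  unfolding tensors_def by (simp add: card_PiE card_cartesian_product power3_eq_cube mult.assoc flip: power_mult)

lemma finite_tensors: "finite tensors"
  unfolding tensors_def by (intro finite_PiE) auto

definition basis_vec where "basis_vec j = (\<lambda>i\<in>coords k a c. if i = j then 1 else (0::int))"

lemma basis_vec_eq: "bilinear_extension.unit_vec (coords k a c) = basis_vec"
  unfolding basis_vec_def bilinear_extension.unit_vec_def[OF bilinear] by (simp add: fun_eq_iff)

lemma basis_vec_vecs: "basis_vec j \<in> vecs"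
  using bilinear_extension.unit_vec_V[OF bilinear] unfolding basis_vec_eq form_group_def[symmetric] carrier_form_group .

definition commutator where
  "commutator \<tau> f g = (\<lambda>i\<in>coords k a c. (form k a \<tau> f g i - form k a \<tau> g f i) mod int p)"

lemma commutator_eq: "bilinear_extension.comm_vec p (coords k a c) (form k a \<tau>) = commutator \<tau>"
  unfolding commutator_def bilinear_extension.comm_vec_def[OF bilinear] by (simp add: fun_eq_iff)

definition central_vec where "central_vec r \<longleftrightarrow> r \<in> vecs \<and> (\<forall>i\<in>outer_coords k a. r i = 0)"

lemma central_vec_eq: "bilinear_extension.central_vec p (coords k a c) (outer_coords k a) (form k a \<tau>) = central_vec"
  using carrier_form_group unfolding central_vec_def bilinear_extension.central_vec_def[OF bilinear] form_group_def by (simp add: fun_eq_iff)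

lemmas commutator_mult = bilinear[THEN bilinear_extension.comm_vec_eq, unfolded commutator_eq, folded form_group_def]
lemmas commutator_vecs = bilinear[THEN bilinear_extension.comm_vec_V, unfolded commutator_eq, folded form_group_def, unfolded carrier_form_group]
lemmas commutator_central_vec = bilinear[THEN bilinear_extension.central_comm_vec, unfolded commutator_eq central_vec_eq]
lemmas commutator_cmult = bilinear[THEN bilinear_extension.comm_vec_central_mult, unfolded commutator_eq central_vec_eq, folded form_group_def]
lemmas commutator_cmult_right = bilinear[THEN bilinear_extension.comm_vec_central_mult_right, unfolded commutator_eq central_vec_eq, folded form_group_def]
lemmas central_vec_mult = bilinear[THEN bilinear_extension.central_mult, unfolded central_vec_eq, folded form_group_def]
lemmas central_basis_vec = bilinear[THEN bilinear_extension.central_unit_vec, unfolded central_vec_eq basis_vec_eq]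
lemmas central_vec_closed = bilinear[THEN bilinear_extension.central_closed, unfolded central_vec_eq, folded form_group_def]
lemmas central_vec_one = bilinear[THEN bilinear_extension.central_one, unfolded central_vec_eq, folded form_group_def]
lemmas central_vec_generated = bilinear[THEN bilinear_extension.central_generated, unfolded basis_vec_eq, folded form_group_def, unfolded carrier_form_group]

text \<open>
  Products of central vectors do not depend on the tensor, so \<open>f\<close> and \<open>g\<close> agree on all of them as soon
  as they agree on the central basis vectors. The commutator of two basis vectors is central, and
  its images under \<open>f\<close> and \<open>g\<close> are equal, being the commutator of the images. So it is the same
  element for both tensors, and its coordinates are tensor entries.
\<close>

lemma basis_images_determine_tensor:
  assumes f: "f \<in> iso (form_group \<tau>1) K" "g \<in> iso (form_group \<tau>2) K" and K: "group K"
    and fg: "\<And>j. j \<in> coords k a c \<Longrightarrow> f (basis_vec j) = g (basis_vec j)"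
    and \<tau>: "\<tau>1 \<in> tensors" "\<tau>2 \<in> tensors"
  shows "\<tau>1 = \<tau>2"
proof -
  interpret K: group K by fact
  have fh: "f \<in> hom (form_group \<tau>1) K" "g \<in> hom (form_group \<tau>2) K" and inj: "inj_on f vecs"
    using f by (auto simp: iso_def bij_betw_def carrier_form_group)
  have fm: "f (x \<otimes>\<^bsub>form_group \<tau>1\<^esub> y) = f x \<otimes>\<^bsub>K\<^esub> f y" "g (x \<otimes>\<^bsub>form_group \<tau>2\<^esub> y) = g x \<otimes>\<^bsub>K\<^esub> g y"
    if "x \<in> vecs" "y \<in> vecs" for x y
    using fh that by (auto simp: hom_def carrier_form_group)
  have fc: "f x \<in> carrier K" "g x \<in> carrier K" if "x \<in> vecs" for x
    using fh that by (auto simp: hom_def carrier_form_group)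
  define S where "S = {r. central_vec r \<and> f r = g r}"
  have S: "r \<in> S" if r: "central_vec r" for r
  proof (rule central_vec_generated[where J = "coords k a c - outer_coords k a" and \<tau> = \<tau>1])
    have one: "\<one>\<^bsub>form_group \<tau>1\<^esub> = \<one>\<^bsub>form_group \<tau>2\<^esub>"
      unfolding form_group_def bilinear_extension.one_eq[OF bilinear] ..
    have "f \<one>\<^bsub>form_group \<tau>1\<^esub> = g \<one>\<^bsub>form_group \<tau>1\<^esub>"
      using hom_one[OF fh(1) group_form_group K] hom_one[OF fh(2) group_form_group K] one by simp
    then show "\<one>\<^bsub>form_group \<tau>1\<^esub> \<in> S" using central_vec_one unfolding S_def by blast
    show "\<And>j. j \<in> coords k a c - outer_coords k a \<Longrightarrow> basis_vec j \<in> S"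
      unfolding S_def using central_basis_vec fg by blast
    show "r \<otimes>\<^bsub>form_group \<tau>1\<^esub> s \<in> S" if "r \<in> S" "s \<in> S" for r s
    proof -
      have rs: "central_vec r" "central_vec s" "f r = g r" "f s = g s" using that unfolding S_def by auto
      have rv: "r \<in> vecs" "s \<in> vecs" using rs unfolding central_vec_def by auto
      have "r \<otimes>\<^bsub>form_group \<tau>1\<^esub> s = r \<otimes>\<^bsub>form_group \<tau>2\<^esub> s" unfolding central_vec_mult[OF rs(1)] ..
      then have "f (r \<otimes>\<^bsub>form_group \<tau>1\<^esub> s) = g (r \<otimes>\<^bsub>form_group \<tau>1\<^esub> s)" using fm rv rs by metis
      then show ?thesis unfolding S_def using central_vec_closed[OF rs(1,2)] by blast
    qed
    show "r \<in> vecs" using r unfolding central_vec_def by blast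
    show "\<And>i. i \<in> coords k a c - (coords k a c - outer_coords k a) \<Longrightarrow> r i = 0"
      using r unfolding central_vec_def by blast
  qed simp
  have commutator: "commutator \<tau>1 (basis_vec x) (basis_vec y) = commutator \<tau>2 (basis_vec x) (basis_vec y)" if x: "x \<in> coords k a c" and y: "y \<in> coords k a c" for x y
  proof -
    let ?k1 = "commutator \<tau>1 (basis_vec x) (basis_vec y)" and ?k2 = "commutator \<tau>2 (basis_vec x) (basis_vec y)"
    have v: "basis_vec x \<in> vecs" "basis_vec y \<in> vecs" "?k1 \<in> vecs" "?k2 \<in> vecs" using basis_vec_vecs commutator_vecs by auto
    have v2: "basis_vec y \<otimes>\<^bsub>form_group \<tau>\<^esub> basis_vec x \<in> vecs" for \<tau>
      using v group_form_group[of \<tau>] by (metis carrier_form_group group.subgroup_self subgroup.m_closed)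
    have "f (basis_vec x) \<otimes>\<^bsub>K\<^esub> f (basis_vec y) = f ?k1 \<otimes>\<^bsub>K\<^esub> (f (basis_vec y) \<otimes>\<^bsub>K\<^esub> f (basis_vec x))"
      using commutator_mult[where \<tau> = \<tau>1 and f = "basis_vec x" and g = "basis_vec y"] fm v v2 by metis
    moreover have "g (basis_vec x) \<otimes>\<^bsub>K\<^esub> g (basis_vec y) = g ?k2 \<otimes>\<^bsub>K\<^esub> (g (basis_vec y) \<otimes>\<^bsub>K\<^esub> g (basis_vec x))"
      using commutator_mult[where \<tau> = \<tau>2 and f = "basis_vec x" and g = "basis_vec y"] fm v v2 by metis
    ultimately have "f ?k1 \<otimes>\<^bsub>K\<^esub> (f (basis_vec y) \<otimes>\<^bsub>K\<^esub> f (basis_vec x)) = g ?k2 \<otimes>\<^bsub>K\<^esub> (f (basis_vec y) \<otimes>\<^bsub>K\<^esub> f (basis_vec x))"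
      using fg x y by simp
    then have "f ?k1 = g ?k2" using K.right_cancel fc v by (metis K.m_closed)
    also have "\<dots> = f ?k2" using S[OF commutator_central_vec] unfolding S_def by simp
    finally show ?thesis using inj v by (simp add: inj_on_eq_iff)
  qed
  show ?thesis
  proof (rule PiE_ext[OF \<tau>[unfolded tensors_def]])
    fix x assume x: "x \<in> {..<a} \<times> {..<a} \<times> {..<a}"
    then obtain i j l where ijl: "x = (i, j, l)" "i < a" "j < a" "l < a" by auto
    have mem: "C i' \<in> coords k a c" "D i' \<in> coords k a c" "E i' \<in> coords k a c" if "i' < a" for i'
      using that by (auto simp: coords_def outer_coords_def)
    have form1: "form k a \<tau> (basis_vec (C i)) (basis_vec (D j)) (E l) = \<tau> (i, j, l)" for \<tau>
      using ijl mem by (simp add: basis_vec_def sum_unit cong: sum.cong_simp)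
    have form2: "form k a \<tau> (basis_vec (D j)) (basis_vec (C i)) (E l) = 0" for \<tau>
      using ijl mem by (simp add: basis_vec_def sum_unit cong: sum.cong_simp)
    have "commutator \<tau> (basis_vec (C i)) (basis_vec (D j)) (E l) = \<tau> x" if "\<tau> \<in> tensors" for \<tau>
    proof -
      have "\<tau> x \<in> {0..<int p}" by (rule PiE_mem[OF that[unfolded tensors_def] x])
      then have "\<tau> x mod int p = \<tau> x" by simp
      then show ?thesis unfolding commutator_def restrict_apply'[OF mem(3)[OF ijl(4)]] form1 form2 ijl(1) by simp
    qed
    then show "\<tau>1 x = \<tau>2 x" using commutator[of "C i" "D j"] mem ijl \<tau> by metis
  qed
qed

lemma card_iso_tensors:
  assumes K: "group K" "finite (carrier K)" "order K = p ^ (4 * k + 3 * a + c)"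
  shows "card {\<tau> \<in> tensors. form_group \<tau> \<cong> K} \<le> p ^ ((4 * k + 3 * a + c) ^ 2)"
proof -
  define \<phi> where "\<phi> \<tau> = (SOME f. f \<in> iso (form_group \<tau>) K)" for \<tau>
  have \<phi>: "\<phi> \<tau> \<in> iso (form_group \<tau>) K" if "form_group \<tau> \<cong> K" for \<tau>
    using that unfolding \<phi>_def is_iso_def by (metis all_not_in_conv someI_ex)
  define code where "code \<tau> = (\<lambda>j\<in>coords k a c. \<phi> \<tau> (basis_vec j))" for \<tau>
  let ?X = "coords k a c \<rightarrow>\<^sub>E carrier K"
  have fin: "finite (coords k a c)" by (auto simp: coords_def outer_coords_def)
  have "card {\<tau> \<in> tensors. form_group \<tau> \<cong> K} \<le> card ?X"
  proof (rule card_inj_on_le[of code])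
    show "inj_on code {\<tau> \<in> tensors. form_group \<tau> \<cong> K}"
    proof (rule inj_onI, safe)
      fix s t assume st: "s \<in> tensors" "t \<in> tensors" "form_group s \<cong> K" "form_group t \<cong> K" and eq: "code s = code t"
      show "s = t"
      proof (rule basis_images_determine_tensor[OF \<phi>[OF st(3)] \<phi>[OF st(4)] K(1) _ st(1,2)])
        fix j assume "j \<in> coords k a c"
        then show "\<phi> s (basis_vec j) = \<phi> t (basis_vec j)" using fun_cong[OF eq, of j] by (simp add: code_def)
      qed
    qed
    show "code ` {\<tau> \<in> tensors. form_group \<tau> \<cong> K} \<subseteq> ?X"
    proof (rule image_subsetI)
      fix \<tau> assume "\<tau> \<in> {\<tau> \<in> tensors. form_group \<tau> \<cong> K}"
      then have "\<phi> \<tau> \<in> hom (form_group \<tau>) K" using \<phi> by (auto simp: iso_def)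
      then show "code \<tau> \<in> ?X"
        unfolding code_def using basis_vec_vecs by (auto simp: hom_def carrier_form_group)
    qed
    show "finite ?X" using fin K(2) by (intro finite_PiE) auto
  qed
  also have "\<dots> = p ^ ((4 * k + 3 * a + c) ^ 2)"
    using fin K(3) by (simp add: card_PiE card_coords order_def power2_eq_square flip: power_mult)
  finally show ?thesis .
qed

end

section \<open>Subgroups that are graphs of matrices\<close>

context tensor_group
begin

definition dom_coords where "dom_coords = P ` {..<k} \<union> Q ` {..<k}"
definition cod_coords where "cod_coords = U ` {..<k} \<union> W ` {..<k}"
definition centre_coords where "centre_coords = Z ` {..<6::nat}"
definition matrices where "matrices = (cod_coords \<times> dom_coords) \<rightarrow>\<^sub>E {0..<int p}"

text \<open>
  The six centre coordinates are left free because commutators of elements of the graph have to belong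
  to the subgroup.
\<close>

definition graph_subgroup where
  "graph_subgroup \<phi> = {g \<in> vecs. (\<forall>y\<in>cod_coords. g y = (\<Sum>x\<in>dom_coords. \<phi> (y, x) * g x) mod int p) \<and>
     (\<forall>i\<in>coords k a c - dom_coords - cod_coords - centre_coords. g i = 0)}"

text \<open>
  The element of the graph over the basis vector at \<open>x\<close> of the domain, with trivial centre part.
\<close>

definition lift where
  "lift \<phi> x = (\<lambda>i\<in>coords k a c. if i = x then 1 else if i \<in> cod_coords then \<phi> (i, x) else 0)"

lemma finite_dom_coords: "finite dom_coords" and finite_cod_coords: "finite cod_coords" by (auto simp: dom_coords_def cod_coords_def)

lemma card_dom_coords: "card dom_coords = 2 * k" unfolding dom_coords_def
  by (subst card_Un_disjoint) (auto simp: card_image inj_on_def)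
lemma card_cod_coords: "card cod_coords = 2 * k" unfolding cod_coords_def
  by (subst card_Un_disjoint) (auto simp: card_image inj_on_def)

lemma card_matrices: "card matrices = p ^ (4 * k ^ 2)"
  unfolding matrices_def using finite_dom_coords finite_cod_coords
  by (simp add: card_PiE card_cartesian_product card_dom_coords card_cod_coords power2_eq_square ac_simps flip: power_mult)

lemma coords_sub: "dom_coords \<subseteq> outer_coords k a" "cod_coords \<subseteq> outer_coords k a" "outer_coords k a \<subseteq> coords k a c"
  by (auto simp: dom_coords_def cod_coords_def outer_coords_def coords_def)

lemma disj: "dom_coords \<inter> cod_coords = {}" "centre_coords \<inter> outer_coords k a = {}"
  by (auto simp: dom_coords_def cod_coords_def centre_coords_def outer_coords_def)

lemma vecs_app: "g \<in> vecs \<Longrightarrow> i \<in> coords k a c \<Longrightarrow> g i mod int p = g i"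
  unfolding vecs_def by (auto simp: PiE_iff)

lemma graph_subgroup_C: "g \<in> graph_subgroup \<phi> \<Longrightarrow> i < a \<Longrightarrow> g (C i) = 0"
  unfolding graph_subgroup_def by (auto simp: dom_coords_def cod_coords_def centre_coords_def coords_def outer_coords_def)

lemma graph_subgroup_mult:
  assumes g: "g \<in> graph_subgroup \<phi>" and h: "h \<in> graph_subgroup \<phi>"
  shows "g \<otimes>\<^bsub>form_group \<tau>\<^esub> h \<in> graph_subgroup \<phi>"
proof -
  let ?m = "g \<otimes>\<^bsub>form_group \<tau>\<^esub> h"
  have mv: "?m \<in> vecs" using bilinear_extension.mult_closed[OF bilinear] unfolding form_group_def[symmetric] carrier_form_group .
  have outer: "?m i = (g i + h i) mod int p" if "i \<in> outer_coords k a" for i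
    using bilinear_extension.mult_app_B[OF bilinear that] unfolding form_group_def .
  have "?m y = (\<Sum>x\<in>dom_coords. \<phi> (y, x) * ?m x) mod int p" if y: "y \<in> cod_coords" for y
  proof -
    have "?m y = (g y + h y) mod int p" using outer y coords_sub by blast
    also have "\<dots> = ((\<Sum>x\<in>dom_coords. \<phi> (y, x) * g x) mod int p + (\<Sum>x\<in>dom_coords. \<phi> (y, x) * h x) mod int p) mod int p"
      using g h y unfolding graph_subgroup_def by simp
    also have "\<dots> = (\<Sum>x\<in>dom_coords. \<phi> (y, x) * (g x + h x)) mod int p"
      by (simp add: mod_add_eq distrib_left sum.distrib)
    also have "\<dots> = (\<Sum>x\<in>dom_coords. \<phi> (y, x) * ?m x) mod int p"
      by (rule mod_sum_cong) (use outer coords_sub in \<open>auto simp: mod_mult_right_eq\<close>)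
    finally show ?thesis .
  qed
  moreover have "?m i = 0" if i: "i \<in> coords k a c - dom_coords - cod_coords - centre_coords" for i
  proof -
    have gi: "g i = 0" "h i = 0" using g h i unfolding graph_subgroup_def by auto
    have "form k a \<tau> g h i = 0"
    proof (cases i)
      case (Z t)
      then have "t \<ge> 6" using i by (auto simp: centre_coords_def)
      then show ?thesis using Z by simp
    next
      case (E l)
      then show ?thesis using graph_subgroup_C[OF g] by simp
    qed simp_all
    then show ?thesis using gi i by (simp add: mult_form_group)
  qed
  ultimately show ?thesis using mv unfolding graph_subgroup_def by blast
qed

lemma subgroup_graph: "subgroup (graph_subgroup \<phi>) (form_group \<tau>)"
proof (rule group.finite_closed_subgroup[OF group_form_group finite_form_group])
  show "graph_subgroup \<phi> \<subseteq> carrier (form_group \<tau>)" unfolding carrier_form_group graph_subgroup_def by auto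
  have "(\<lambda>i\<in>coords k a c. 0) \<in> graph_subgroup \<phi>"
    unfolding graph_subgroup_def vecs_def using p1 coords_sub by (auto simp: subset_iff)
  then show "graph_subgroup \<phi> \<noteq> {}" by blast
qed (rule graph_subgroup_mult)

lemma graph_subgroup_eqI:
  assumes g: "g \<in> graph_subgroup \<phi>" and h: "h \<in> graph_subgroup \<phi>"
    and eq: "\<And>i. i \<in> dom_coords \<union> centre_coords \<Longrightarrow> i \<in> coords k a c \<Longrightarrow> g i = h i"
  shows "g = h"
proof (rule PiE_ext)
  have "g \<in> vecs" "h \<in> vecs" using g h unfolding graph_subgroup_def by auto
  then show "g \<in> coords k a c \<rightarrow>\<^sub>E {0..<int p}" "h \<in> coords k a c \<rightarrow>\<^sub>E {0..<int p}" unfolding vecs_def .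
  fix i assume i: "i \<in> coords k a c"
  have x: "g x = h x" if "x \<in> dom_coords" for x using eq that coords_sub by blast
  consider "i \<in> dom_coords \<union> centre_coords" | "i \<in> cod_coords" | "i \<in> coords k a c - dom_coords - cod_coords - centre_coords" using i by blast
  then show "g i = h i"
  proof cases
    case 2
    then have "g i = (\<Sum>x\<in>dom_coords. \<phi> (i, x) * g x) mod int p" "h i = (\<Sum>x\<in>dom_coords. \<phi> (i, x) * h x) mod int p"
      using g h unfolding graph_subgroup_def by auto
    then show ?thesis using x by simp
  qed (use eq i g h in \<open>auto simp: graph_subgroup_def\<close>)
qed

lemma card_graph_subgroup: "card (graph_subgroup \<phi>) \<le> p ^ (2 * k + 6)"
proof -
  let ?J = "(dom_coords \<union> centre_coords) \<inter> coords k a c"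
  let ?Y = "?J \<rightarrow>\<^sub>E {0..<int p}"
  have fin: "finite ?J" using finite_dom_coords by (auto simp: centre_coords_def)
  have "card (graph_subgroup \<phi>) \<le> card ?Y"
  proof (rule card_inj_on_le[of "\<lambda>g. restrict g ?J"])
    show "inj_on (\<lambda>g. restrict g ?J) (graph_subgroup \<phi>)"
    proof (rule inj_onI)
      fix g h assume gh: "g \<in> graph_subgroup \<phi>" "h \<in> graph_subgroup \<phi>" and eq: "restrict g ?J = restrict h ?J"
      show "g = h"
      proof (rule graph_subgroup_eqI[OF gh])
        fix i assume "i \<in> dom_coords \<union> centre_coords" "i \<in> coords k a c"
        then show "g i = h i" using fun_cong[OF eq, of i] by simp
      qed
    qed
    show "(\<lambda>g. restrict g ?J) ` graph_subgroup \<phi> \<subseteq> ?Y"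
    proof (rule image_subsetI)
      fix g assume "g \<in> graph_subgroup \<phi>"
      then have "\<forall>i\<in>coords k a c. g i \<in> {0..<int p}"
        unfolding graph_subgroup_def vecs_def by (simp add: PiE_iff)
      then show "restrict g ?J \<in> ?Y" unfolding restrict_PiE_iff by blast
    qed
    show "finite ?Y" using fin by (intro finite_PiE) auto
  qed
  also have "\<dots> = p ^ card ?J" using fin by (simp add: card_PiE)
  also have "\<dots> \<le> p ^ (2 * k + 6)"
  proof (rule power_increasing)
    have "card ?J \<le> card (dom_coords \<union> centre_coords)" using finite_dom_coords by (intro card_mono) (auto simp: centre_coords_def)
    also have "\<dots> \<le> card dom_coords + card centre_coords" by (rule card_Un_le)
    also have "card centre_coords \<le> 6" unfolding centre_coords_def using card_image_le[of "{..<6::nat}" Z] by simp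
    finally show "card ?J \<le> 2 * k + 6" using card_dom_coords by simp
  qed (use p1 in simp)
  finally show ?thesis .
qed

lemma lift_vecs:
  assumes "\<phi> \<in> matrices" "x \<in> dom_coords"
  shows "lift \<phi> x \<in> vecs"
  using assms p1 unfolding lift_def vecs_def matrices_def by (fastforce simp: PiE_iff)

lemma lift_app:
  assumes "x \<in> dom_coords"
  shows "x' \<in> dom_coords \<Longrightarrow> lift \<phi> x x' = (if x' = x then 1 else 0)"
    "y \<in> cod_coords \<Longrightarrow> lift \<phi> x y = \<phi> (y, x)"
    "i \<in> coords k a c - dom_coords - cod_coords \<Longrightarrow> lift \<phi> x i = 0"
  using assms disj coords_sub unfolding lift_def by auto

lemma lift_graph:
  assumes "\<phi> \<in> matrices" "x \<in> dom_coords"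
  shows "lift \<phi> x \<in> graph_subgroup \<phi>"
proof -
  have "lift \<phi> x y = (\<Sum>x'\<in>dom_coords. \<phi> (y, x') * lift \<phi> x x') mod int p" if y: "y \<in> cod_coords" for y
  proof -
    have "(\<Sum>x'\<in>dom_coords. \<phi> (y, x') * lift \<phi> x x') = \<phi> (y, x)"
      using assms finite_dom_coords by (simp add: lift_app sum_unit cong: sum.cong_simp)
    moreover have "\<phi> (y, x) \<in> {0..<int p}" using assms y unfolding matrices_def by auto
    ultimately show ?thesis using assms y by (simp add: lift_app)
  qed
  then show ?thesis using lift_vecs[OF assms] lift_app(3)[OF assms(2)] unfolding graph_subgroup_def by blast
qed

lemma dom_coords_mem: "i < k \<Longrightarrow> P i \<in> dom_coords" "i < k \<Longrightarrow> Q i \<in> dom_coords" "i < k \<Longrightarrow> U i \<in> cod_coords" "i < k \<Longrightarrow> W i \<in> cod_coords"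
  by (auto simp: dom_coords_def cod_coords_def)

lemma lift_unit:
  assumes "i < k" "j < k"
  shows "lift \<phi> (P i) (P j) = (if j = i then 1 else 0)" "lift \<phi> (Q i) (Q j) = (if j = i then 1 else 0)"
    "lift \<phi> (P i) (Q j) = 0" "lift \<phi> (Q i) (P j) = 0"
  using assms by (simp_all add: lift_app(1) dom_coords_mem)

lemma form_lift:
  assumes i: "i < k"
  shows "form k a \<tau> (lift \<phi> (P i)) g (Z 0) = g (Q i)"
    "form k a \<tau> g (lift \<phi> (P i)) (Z 0) = 0"
    "form k a \<tau> (lift \<phi> (Q i)) g (Z 0) = 0"
    "form k a \<tau> g (lift \<phi> (Q i)) (Z 0) = g (P i)"
    "Suc i < k \<Longrightarrow> form k a \<tau> (lift \<phi> (P i)) g (Z 1) = g (Q (Suc i))"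
    "form k a \<tau> g (lift \<phi> (P i)) (Z 1) = 0"
    "form k a \<tau> (lift \<phi> (Q i)) g (Z 1) = 0"
    "i' < k \<Longrightarrow> i = Suc i' \<Longrightarrow> form k a \<tau> g (lift \<phi> (Q i)) (Z 1) = g (P i')"
    "form k a \<tau> (lift \<phi> (Q i)) g (Z 2) = g (U i)"
    "form k a \<tau> (lift \<phi> (P i)) g (Z 2) = 0"
    "form k a \<tau> (lift \<phi> (Q i)) g (Z 3) = g (W i)"
    "form k a \<tau> (lift \<phi> (P i)) g (Z 3) = 0"
    "form k a \<tau> (lift \<phi> (P i)) g (Z 4) = g (U i)"
    "form k a \<tau> (lift \<phi> (Q i)) g (Z 4) = 0"
    "form k a \<tau> (lift \<phi> (P i)) g (Z 5) = g (W i)"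
    "form k a \<tau> (lift \<phi> (Q i)) g (Z 5) = 0"
  using i by (simp_all add: lift_unit sum_unit cong: sum.cong_simp)

lemma Z_coords: "c \<ge> 6 \<Longrightarrow> t < 6 \<Longrightarrow> Z t \<in> coords k a c"
  by (auto simp: coords_def)

lemma commutator_app: "i \<in> coords k a c \<Longrightarrow> commutator \<tau> f g i = (form k a \<tau> f g i - form k a \<tau> g f i) mod int p"
  by (simp add: commutator_def)

text \<open>
  The action of the operator \<open>T\<close> on basis vectors: it raises the index in \<open>P\<close> and lowers it in \<open>Q\<close>, as it
  has to if \<open>\<beta>(x, y) = \<alpha>(T x, y)\<close> for the alternating forms \<open>\<alpha>\<close> and \<open>\<beta>\<close> given by \<open>Z 0\<close> and \<open>Z 1\<close>.
\<close>

definition shift where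
  "shift x x' \<longleftrightarrow> (\<exists>i. Suc i < k \<and> (x = P i \<and> x' = P (Suc i) \<or> x = Q (Suc i) \<and> x' = Q i))"

lemma shift_dom_coords: "shift x x' \<Longrightarrow> x \<in> dom_coords \<and> x' \<in> dom_coords"
  unfolding shift_def dom_coords_def by auto

lemma commutator_shift:
  assumes c: "c \<ge> 6" and s: "shift x x'"
  shows "commutator \<tau> (lift \<phi> x) g (Z 1) = commutator \<tau> (lift \<phi> x') g (Z 0)"
proof -
  have Z01: "Z 0 \<in> coords k a c" "Z 1 \<in> coords k a c" using c Z_coords by auto
  obtain i where i: "Suc i < k" "x = P i \<and> x' = P (Suc i) \<or> x = Q (Suc i) \<and> x' = Q i"
    using s unfolding shift_def by blast
  then have ik: "i < k" by simp
  from i(2) show ?thesis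
  proof
    assume "x = P i \<and> x' = P (Suc i)"
    then have x: "x = P i" "x' = P (Suc i)" by auto
    show ?thesis unfolding commutator_app[OF Z01(1)] commutator_app[OF Z01(2)] x
        form_lift(5)[OF ik i(1)] form_lift(6)[OF ik] form_lift(1,2)[OF i(1)] ..
  next
    assume "x = Q (Suc i) \<and> x' = Q i"
    then have x: "x = Q (Suc i)" "x' = Q i" by auto
    show ?thesis unfolding commutator_app[OF Z01(1)] commutator_app[OF Z01(2)] x
        form_lift(8)[OF i(1) ik refl] form_lift(7)[OF i(1)] form_lift(3,4)[OF ik] ..
  qed
qed

text \<open>
  The form \<open>\<alpha>\<close> is non-degenerate on the domain: up to sign, its values at the lifts over \<open>Q i\<close> and \<open>P i\<close>
  are the coordinates at \<open>P i\<close> and \<open>Q i\<close>.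
\<close>

lemma commutator_nondegenerate:
  assumes c: "c \<ge> 6" and \<phi>: "\<phi> \<in> matrices"
    and g: "g \<in> vecs" and h: "h \<in> vecs"
    and eq: "\<And>y. y \<in> graph_subgroup \<phi> \<Longrightarrow> commutator \<tau> g y (Z 0) = commutator \<tau> h y (Z 0)"
    and x: "x \<in> dom_coords"
  shows "g x = h x"
proof -
  have Z0: "Z 0 \<in> coords k a c" using c Z_coords by auto
  have xc: "x \<in> coords k a c" using x coords_sub by blast
  have "g x mod int p = h x mod int p"
  proof -
    from x consider i where "i < k" "x = P i" | i where "i < k" "x = Q i" unfolding dom_coords_def by auto
    then show ?thesis
    proof cases
      case 1
      have "commutator \<tau> g (lift \<phi> (Q i)) (Z 0) = commutator \<tau> h (lift \<phi> (Q i)) (Z 0)"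
        by (intro eq lift_graph \<phi> dom_coords_mem 1)
      then show ?thesis
        unfolding commutator_app[OF Z0] form_lift(3,4)[OF 1(1)] 1(2) by simp
    next
      case 2
      have "commutator \<tau> g (lift \<phi> (P i)) (Z 0) = commutator \<tau> h (lift \<phi> (P i)) (Z 0)"
        by (intro eq lift_graph \<phi> dom_coords_mem 2)
      then have "(- g x) mod int p = (- h x) mod int p"
        unfolding commutator_app[OF Z0] form_lift(1,2)[OF 2(1)] 2(2) by simp
      then show ?thesis using mod_minus_cong[of "- g x" "int p" "- h x"] by simp
    qed
  qed
  then show ?thesis using vecs_app[OF g xc] vecs_app[OF h xc] by simp
qed

definition centre_vecs where "centre_vecs = {r \<in> vecs. \<forall>i\<in>coords k a c - centre_coords. r i = 0}"

lemma centre_vecs_central_vec: "r \<in> centre_vecs \<Longrightarrow> central_vec r"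
  unfolding centre_vecs_def central_vec_def using disj coords_sub by auto

lemma centre_vecs_graph:
  assumes r: "r \<in> centre_vecs"
  shows "r \<in> graph_subgroup \<phi>"
proof -
  have outer: "r i = 0" if "i \<in> outer_coords k a" for i
    using centre_vecs_central_vec[OF r] that unfolding central_vec_def by blast
  have "r y = (\<Sum>x\<in>dom_coords. \<phi> (y, x) * r x) mod int p" if "y \<in> cod_coords" for y
  proof -
    have "(\<Sum>x\<in>dom_coords. \<phi> (y, x) * r x) = 0"
      using outer coords_sub(1) by (intro sum.neutral) auto
    then show ?thesis using outer that coords_sub(2) by auto
  qed
  then show ?thesis using r unfolding centre_vecs_def graph_subgroup_def by blast
qed

lemma commutator_centre_vecs:
  assumes "g \<in> graph_subgroup \<phi>" "h \<in> graph_subgroup \<phi>"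
  shows "commutator \<tau> g h \<in> centre_vecs"
proof -
  have "commutator \<tau> g h i = 0" if i: "i \<in> coords k a c - centre_coords" for i
  proof (cases i)
    case (Z t)
    then have "t \<ge> 6" using i by (auto simp: centre_coords_def)
    then show ?thesis using Z i by (simp add: commutator_app)
  next
    case (E l)
    then show ?thesis using graph_subgroup_C[OF assms(1)] graph_subgroup_C[OF assms(2)] i
      by (simp add: commutator_app)
  qed (use i in \<open>simp_all add: commutator_app\<close>)
  then show ?thesis unfolding centre_vecs_def using commutator_vecs by blast
qed

text \<open>
  The crucial relation \<open>R x\<close> says that \<open>f1\<close> and \<open>f2\<close> agree on the lifts over \<open>x\<close> up to a central factor. It
  is inherited along the shift \<open>T\<close>. To see this, choose \<open>q\<close> with the same image under \<open>f1\<close> as the lift over \<open>T x\<close>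
  has under \<open>f2\<close>. For any \<open>y\<close>, and \<open>y'\<close> such that \<open>f1 y = f2 y'\<close>,
    \<open>\<alpha>(q, y) = \<alpha>(T x, y') = \<beta>(x, y') = \<beta>(x, y) = \<alpha>(T x, y)\<close>,
  where the first and the third equation hold because elements with the same images have the same
  commutators. As \<open>\<alpha>\<close> is non-degenerate, \<open>q\<close> agrees with the lift over \<open>T x\<close> up to a central factor.
  
  Hence \<open>R\<close> holds for all basis vectors, as it holds for \<open>P 0\<close> and \<open>Q (k - 1)\<close>. Then corresponding lifts in the
  two graphs have the same commutators, and these contain the entries of \<open>\<phi>1\<close> and \<open>\<phi>2\<close>.
\<close>

lemma iso_graph_determined:
  assumes k: "k > 0" and c: "c \<ge> 6" and \<phi>: "\<phi>1 \<in> matrices" "\<phi>2 \<in> matrices" and K: "group K"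
    and f: "f1 \<in> iso (form_group \<tau>\<lparr>carrier := graph_subgroup \<phi>1\<rparr>) K" "f2 \<in> iso (form_group \<tau>\<lparr>carrier := graph_subgroup \<phi>2\<rparr>) K"
    and eqP: "f1 (lift \<phi>1 (P 0)) = f2 (lift \<phi>2 (P 0))"
    and eqQ: "f1 (lift \<phi>1 (Q (k - 1))) = f2 (lift \<phi>2 (Q (k - 1)))"
    and eqZ: "\<And>t. t < 6 \<Longrightarrow> f1 (basis_vec (Z t)) = f2 (basis_vec (Z t))"
  shows "\<phi>1 = \<phi>2"
proof -
  interpret K: group K by fact
  interpret G: group "form_group \<tau>" by (rule group_form_group)
  let ?H1 = "graph_subgroup \<phi>1" and ?H2 = "graph_subgroup \<phi>2"
  have s1: "subgroup ?H1 (form_group \<tau>)" and s2: "subgroup ?H2 (form_group \<tau>)" by (rule subgroup_graph)+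
  have inj: "inj_on f1 ?H1" and surj: "f1 ` ?H1 = carrier K" "f2 ` ?H2 = carrier K"
    using f by (auto simp: iso_def bij_betw_def)
  have fm1: "f1 (x \<otimes>\<^bsub>form_group \<tau>\<^esub> y) = f1 x \<otimes>\<^bsub>K\<^esub> f1 y" if "x \<in> ?H1" "y \<in> ?H1" for x y
    using f(1) that by (auto simp: iso_def hom_def)
  have fm2: "f2 (x \<otimes>\<^bsub>form_group \<tau>\<^esub> y) = f2 x \<otimes>\<^bsub>K\<^esub> f2 y" if "x \<in> ?H2" "y \<in> ?H2" for x y
    using f(2) that by (auto simp: iso_def hom_def)
  have fc1: "f1 x \<in> carrier K" if "x \<in> ?H1" for x using surj that by blast
  have fc2: "f2 x \<in> carrier K" if "x \<in> ?H2" for x using surj that by blast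
  have zeq: "f1 r = f2 r" if r: "r \<in> centre_vecs" for r
  proof -
    define S where "S = {r \<in> centre_vecs. f1 r = f2 r}"
    have "r \<in> S"
    proof (rule central_vec_generated[where J = centre_coords and \<tau> = \<tau>])
      show "centre_coords \<subseteq> coords k a c - outer_coords k a"
        using disj c unfolding centre_coords_def coords_def by auto
      have one: "\<one>\<^bsub>form_group \<tau>\<^esub> \<in> centre_vecs"
        unfolding centre_vecs_def form_group_def bilinear_extension.one_eq[OF bilinear] vecs_def using p1 by auto
      have "f1 \<one>\<^bsub>form_group \<tau>\<^esub> = \<one>\<^bsub>K\<^esub>" "f2 \<one>\<^bsub>form_group \<tau>\<^esub> = \<one>\<^bsub>K\<^esub>"
        using hom_one[OF _ G.subgroup_imp_group[OF s1] K, of f1] hom_one[OF _ G.subgroup_imp_group[OF s2] K, of f2] f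
        by (auto simp: iso_def)
      then show "\<one>\<^bsub>form_group \<tau>\<^esub> \<in> S" using one unfolding S_def by simp
      show "basis_vec j \<in> S" if "j \<in> centre_coords" for j
      proof -
        have "basis_vec j \<in> centre_vecs" using that basis_vec_vecs unfolding centre_vecs_def by (auto simp: basis_vec_def)
        then show ?thesis using that eqZ unfolding S_def centre_coords_def by auto
      qed
      show "r \<otimes>\<^bsub>form_group \<tau>\<^esub> s \<in> S" if "r \<in> S" "s \<in> S" for r s
      proof -
        have rs: "r \<in> centre_vecs" "s \<in> centre_vecs" "f1 r = f2 r" "f1 s = f2 s" using that unfolding S_def by auto
        have "r \<otimes>\<^bsub>form_group \<tau>\<^esub> s \<in> vecs"
          using central_vec_closed[OF centre_vecs_central_vec[OF rs(1)] centre_vecs_central_vec[OF rs(2)]] unfolding central_vec_def by blast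
        then have "r \<otimes>\<^bsub>form_group \<tau>\<^esub> s \<in> centre_vecs"
          using rs(1,2) unfolding central_vec_mult[OF centre_vecs_central_vec[OF rs(1)]] centre_vecs_def by auto
        moreover have "f1 (r \<otimes>\<^bsub>form_group \<tau>\<^esub> s) = f2 (r \<otimes>\<^bsub>form_group \<tau>\<^esub> s)"
          using fm1 fm2 centre_vecs_graph rs by metis
        ultimately show ?thesis unfolding S_def by blast
      qed
      show "r \<in> vecs" "\<And>i. i \<in> coords k a c - centre_coords \<Longrightarrow> r i = 0"
        using r unfolding centre_vecs_def by auto
    qed
    then show ?thesis unfolding S_def by blast
  qed
  have commutator_eq: "commutator \<tau> x y = commutator \<tau> x' y'"
    if x: "x \<in> ?H1" "x' \<in> ?H2" "f1 x = f2 x'" and y: "y \<in> ?H1" "y' \<in> ?H2" "f1 y = f2 y'" for x x' y y'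
  proof -
    let ?k1 = "commutator \<tau> x y" and ?k2 = "commutator \<tau> x' y'"
    have k: "?k1 \<in> centre_vecs" "?k2 \<in> centre_vecs" using commutator_centre_vecs x y by auto
    have v: "y \<otimes>\<^bsub>form_group \<tau>\<^esub> x \<in> ?H1" "y' \<otimes>\<^bsub>form_group \<tau>\<^esub> x' \<in> ?H2" using graph_subgroup_mult x y by auto
    have "f1 x \<otimes>\<^bsub>K\<^esub> f1 y = f1 ?k1 \<otimes>\<^bsub>K\<^esub> (f1 y \<otimes>\<^bsub>K\<^esub> f1 x)"
      using commutator_mult[where \<tau> = \<tau> and f = x and g = y] fm1 x y v centre_vecs_graph[OF k(1)] by metis
    moreover have "f2 x' \<otimes>\<^bsub>K\<^esub> f2 y' = f2 ?k2 \<otimes>\<^bsub>K\<^esub> (f2 y' \<otimes>\<^bsub>K\<^esub> f2 x')"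
      using commutator_mult[where \<tau> = \<tau> and f = x' and g = y'] fm2 x y v centre_vecs_graph[OF k(2)] by metis
    ultimately have "f1 ?k1 \<otimes>\<^bsub>K\<^esub> (f1 y \<otimes>\<^bsub>K\<^esub> f1 x) = f2 ?k2 \<otimes>\<^bsub>K\<^esub> (f1 y \<otimes>\<^bsub>K\<^esub> f1 x)"
      using x y by simp
    moreover have "f1 ?k1 \<in> carrier K" "f2 ?k2 \<in> carrier K" "f1 y \<otimes>\<^bsub>K\<^esub> f1 x \<in> carrier K"
      using fc1 fc2 centre_vecs_graph k x y by auto
    ultimately have "f1 ?k1 = f2 ?k2" using K.right_cancel by metis
    also have "\<dots> = f1 ?k2" using zeq k by simp
    finally show ?thesis using inj centre_vecs_graph[OF k(1)] centre_vecs_graph[OF k(2)] by (simp add: inj_on_eq_iff)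
  qed
  define R where "R x \<longleftrightarrow> (\<exists>r\<in>centre_vecs. f2 (lift \<phi>2 x) = f1 (r \<otimes>\<^bsub>form_group \<tau>\<^esub> lift \<phi>1 x))" for x
  have rl: "r \<otimes>\<^bsub>form_group \<tau>\<^esub> lift \<phi>1 x \<in> ?H1" if "r \<in> centre_vecs" "x \<in> dom_coords" for r x
    using that \<phi> by (intro graph_subgroup_mult centre_vecs_graph lift_graph)
  have step: "R x'" if s: "shift x x'" and R: "R x" for x x'
  proof -
    have xx: "x \<in> dom_coords" "x' \<in> dom_coords" using shift_dom_coords[OF s] by auto
    note l1 = lift_graph[OF \<phi>(1)] and l2 = lift_graph[OF \<phi>(2)]
    obtain r where r: "r \<in> centre_vecs" "f2 (lift \<phi>2 x) = f1 (r \<otimes>\<^bsub>form_group \<tau>\<^esub> lift \<phi>1 x)"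
      using R unfolding R_def by blast
    have "f2 (lift \<phi>2 x') \<in> f1 ` ?H1" unfolding surj(1) by (rule fc2[OF l2[OF xx(2)]])
    then obtain q where q: "q \<in> ?H1" "f1 q = f2 (lift \<phi>2 x')" by auto
    have kq: "commutator \<tau> q y (Z 0) = commutator \<tau> (lift \<phi>1 x') y (Z 0)" if y: "y \<in> ?H1" for y
    proof -
      have "f1 y \<in> f2 ` ?H2" unfolding surj(2) by (rule fc1[OF y])
      then obtain y' where y': "y' \<in> ?H2" "f1 y = f2 y'" by auto
      have "commutator \<tau> q y (Z 0) = commutator \<tau> (lift \<phi>2 x') y' (Z 0)"
        using commutator_eq[OF q(1) l2[OF xx(2)] q(2) y y'] by simp
      also have "\<dots> = commutator \<tau> (lift \<phi>2 x) y' (Z 1)" by (rule commutator_shift[OF c s, symmetric])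
      also have "commutator \<tau> (lift \<phi>2 x) y' = commutator \<tau> (r \<otimes>\<^bsub>form_group \<tau>\<^esub> lift \<phi>1 x) y"
        using commutator_eq[OF rl[OF r(1) xx(1)] l2[OF xx(1)] r(2)[symmetric] y y'] by simp
      also have "\<dots> = commutator \<tau> (lift \<phi>1 x) y" by (rule commutator_cmult[OF centre_vecs_central_vec[OF r(1)]])
      also have "commutator \<tau> (lift \<phi>1 x) y (Z 1) = commutator \<tau> (lift \<phi>1 x') y (Z 0)" by (rule commutator_shift[OF c s])
      finally show ?thesis .
    qed
    have qv: "q \<in> vecs" using q unfolding graph_subgroup_def by blast
    have qx: "q u = lift \<phi>1 x' u" if "u \<in> dom_coords" for u
      using commutator_nondegenerate[OF c \<phi>(1) qv lift_vecs[OF \<phi>(1) xx(2)] kq that] .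
    (* The lift has trivial centre part, so the centre part of q is the central factor. *)
    define r' where "r' = (\<lambda>i\<in>coords k a c. if i \<in> centre_coords then q i else 0)"
    have r': "r' \<in> centre_vecs"
      using qv p1 unfolding r'_def centre_vecs_def vecs_def by (auto simp: PiE_iff)
    have "r' \<otimes>\<^bsub>form_group \<tau>\<^esub> lift \<phi>1 x' = q"
    proof (rule graph_subgroup_eqI[OF rl[OF r' xx(2)] q(1)])
      fix i assume i: "i \<in> dom_coords \<union> centre_coords" "i \<in> coords k a c"
      have m: "(r' \<otimes>\<^bsub>form_group \<tau>\<^esub> lift \<phi>1 x') i = (r' i + lift \<phi>1 x' i) mod int p"
        using central_vec_mult[OF centre_vecs_central_vec[OF r']] i by simp
      from i(1) show "(r' \<otimes>\<^bsub>form_group \<tau>\<^esub> lift \<phi>1 x') i = q i"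
      proof
        assume x: "i \<in> dom_coords"
        then have "i \<notin> centre_coords" using disj coords_sub by blast
        then have "r' i = 0" using i unfolding r'_def by simp
        then show ?thesis unfolding m using qx[OF x] vecs_app[OF qv i(2)] by simp
      next
        assume z: "i \<in> centre_coords"
        then have "i \<in> coords k a c - dom_coords - cod_coords" using i disj coords_sub by blast
        then have "lift \<phi>1 x' i = 0" by (rule lift_app(3)[OF xx(2)])
        moreover have "r' i = q i" using z i unfolding r'_def by simp
        ultimately show ?thesis unfolding m using vecs_app[OF qv i(2)] by simp
      qed
    qed
    then show ?thesis unfolding R_def using r' q(2) by metis
  qed
  have base: "R x" if "f1 (lift \<phi>1 x) = f2 (lift \<phi>2 x)" "x \<in> dom_coords" for x
  proof -
    have one: "\<one>\<^bsub>form_group \<tau>\<^esub> \<in> centre_vecs"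
      unfolding centre_vecs_def form_group_def bilinear_extension.one_eq[OF bilinear] vecs_def using p1 by auto
    have "lift \<phi>1 x \<in> carrier (form_group \<tau>)" unfolding carrier_form_group by (rule lift_vecs[OF \<phi>(1) that(2)])
    then have "\<one>\<^bsub>form_group \<tau>\<^esub> \<otimes>\<^bsub>form_group \<tau>\<^esub> lift \<phi>1 x = lift \<phi>1 x" by simp
    then show ?thesis unfolding R_def using one that by metis
  qed
  have RP: "R (P i)" if "i < k" for i
    using that
  proof (induction i)
    case 0
    then show ?case using base eqP dom_coords_mem by blast
  next
    case (Suc i)
    then have "shift (P i) (P (Suc i))" unfolding shift_def by blast
    then show ?case using step Suc by simp
  qed
  have RQ': "R (Q (k - 1 - i))" if "i < k" for i
    using that
  proof (induction i)
    case 0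
    then show ?case using base[OF eqQ] dom_coords_mem(2)[of "k - 1"] by simp
  next
    case (Suc i)
    have "Suc (k - 1 - Suc i) = k - 1 - i" "k - 1 - i < k" using Suc.prems by auto
    then have "shift (Q (k - 1 - i)) (Q (k - 1 - Suc i))" unfolding shift_def by metis
    then show ?case using step Suc by simp
  qed
  have RQ: "R (Q i)" if "i < k" for i
    using RQ'[of "k - 1 - i"] that by simp
  have Rxs: "R x" if "x \<in> dom_coords" for x using that RP RQ unfolding dom_coords_def by auto
  have kk: "commutator \<tau> (lift \<phi>1 x) (lift \<phi>1 x') = commutator \<tau> (lift \<phi>2 x) (lift \<phi>2 x')"
    if x: "x \<in> dom_coords" "x' \<in> dom_coords" for x x'
  proof -
    obtain r where r: "r \<in> centre_vecs" "f2 (lift \<phi>2 x) = f1 (r \<otimes>\<^bsub>form_group \<tau>\<^esub> lift \<phi>1 x)"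
      using Rxs[OF x(1)] unfolding R_def by blast
    obtain r' where r': "r' \<in> centre_vecs" "f2 (lift \<phi>2 x') = f1 (r' \<otimes>\<^bsub>form_group \<tau>\<^esub> lift \<phi>1 x')"
      using Rxs[OF x(2)] unfolding R_def by blast
    have "commutator \<tau> (lift \<phi>2 x) (lift \<phi>2 x') = commutator \<tau> (r \<otimes>\<^bsub>form_group \<tau>\<^esub> lift \<phi>1 x) (r' \<otimes>\<^bsub>form_group \<tau>\<^esub> lift \<phi>1 x')"
      by (rule commutator_eq[symmetric])
        (use rl r r' x lift_graph[OF \<phi>(2)] in simp_all)
    then show ?thesis using commutator_cmult[OF centre_vecs_central_vec[OF r(1)]] commutator_cmult_right[OF centre_vecs_central_vec[OF r'(1)]] by simp
  qed
  have val: "\<phi> (U j, P i) mod int p = commutator \<tau> (lift \<phi> (Q j)) (lift \<phi> (P i)) (Z 2)"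
    "\<phi> (W j, P i) mod int p = commutator \<tau> (lift \<phi> (Q j)) (lift \<phi> (P i)) (Z 3)"
    "\<phi> (U j, Q i) mod int p = commutator \<tau> (lift \<phi> (P j)) (lift \<phi> (Q i)) (Z 4)"
    "\<phi> (W j, Q i) mod int p = commutator \<tau> (lift \<phi> (P j)) (lift \<phi> (Q i)) (Z 5)"
    if "i < k" "j < k" for i j \<phi>
    using that by (simp_all only: commutator_app Z_coords[OF c] form_lift lift_app(2) dom_coords_mem) simp_all
  show ?thesis
  proof (rule PiE_ext[OF \<phi>[unfolded matrices_def]])
    fix z assume z: "z \<in> cod_coords \<times> dom_coords"
    then obtain y x where yx: "z = (y, x)" "y \<in> cod_coords" "x \<in> dom_coords" by auto
    have "\<phi>1 z mod int p = \<phi>2 z mod int p"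
    proof -
      obtain i j where "i < k" "j < k" "(y = U j \<or> y = W j) \<and> (x = P i \<or> x = Q i)"
        using yx unfolding dom_coords_def cod_coords_def by auto
      then show ?thesis using val kk dom_coords_mem yx(1) by metis
    qed
    moreover have "\<phi>1 z \<in> {0..<int p}" "\<phi>2 z \<in> {0..<int p}"
      using PiE_mem[OF \<phi>(1)[unfolded matrices_def] z] PiE_mem[OF \<phi>(2)[unfolded matrices_def] z] by auto
    ultimately show "\<phi>1 z = \<phi>2 z" by simp
  qed
qed

lemma card_iso_graphs:
  assumes k: "k > 0" and c: "c \<ge> 6" and K: "group K" "finite (carrier K)"
  shows "card {\<phi> \<in> matrices. form_group \<tau>\<lparr>carrier := graph_subgroup \<phi>\<rparr> \<cong> K} \<le> order K ^ 8"
proof -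
  let ?I = "\<lambda>\<phi>. form_group \<tau>\<lparr>carrier := graph_subgroup \<phi>\<rparr> \<cong> K"
  let ?A = "{\<phi> \<in> matrices. ?I \<phi>}"
  define F where "F \<phi> = (SOME f. f \<in> iso (form_group \<tau>\<lparr>carrier := graph_subgroup \<phi>\<rparr>) K)" for \<phi>
  have F: "F \<phi> \<in> iso (form_group \<tau>\<lparr>carrier := graph_subgroup \<phi>\<rparr>) K" if "?I \<phi>" for \<phi>
    using that unfolding F_def is_iso_def by (metis all_not_in_conv someI_ex)
  define code where "code \<phi> = (F \<phi> (lift \<phi> (P 0)), F \<phi> (lift \<phi> (Q (k - 1))), \<lambda>t\<in>{..<6::nat}. F \<phi> (basis_vec (Z t)))" for \<phi>
  let ?X = "carrier K \<times> carrier K \<times> ({..<6::nat} \<rightarrow>\<^sub>E carrier K)"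
  have "card ?A \<le> card ?X"
  proof (rule card_inj_on_le[of code])
    show "inj_on code ?A"
    proof (rule inj_onI)
      fix s t assume "s \<in> ?A" "t \<in> ?A" and eq: "code s = code t"
      then have st: "s \<in> matrices" "t \<in> matrices" "?I s" "?I t" by auto
      show "s = t"
      proof (rule iso_graph_determined[OF k c st(1,2) K(1) F[OF st(3)] F[OF st(4)]])
        show "F s (lift s (P 0)) = F t (lift t (P 0))" "F s (lift s (Q (k - 1))) = F t (lift t (Q (k - 1)))"
          using eq by (auto simp: code_def)
        fix i :: nat assume "i < 6"
        moreover have "(\<lambda>t\<in>{..<6::nat}. F s (basis_vec (Z t))) i = (\<lambda>j\<in>{..<6::nat}. F t (basis_vec (Z j))) i"
          using eq unfolding code_def by (metis prod.inject)
        ultimately show "F s (basis_vec (Z i)) = F t (basis_vec (Z i))" by simp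
      qed
    qed
    show "code ` ?A \<subseteq> ?X"
    proof (rule image_subsetI)
      fix \<phi> assume "\<phi> \<in> ?A"
      then have \<phi>: "\<phi> \<in> matrices" "?I \<phi>" by auto
      have cl: "F \<phi> x \<in> carrier K" if "x \<in> graph_subgroup \<phi>" for x
        using F[OF \<phi>(2)] that by (auto simp: iso_def hom_def)
      have "basis_vec (Z t) \<in> graph_subgroup \<phi>" if "t < 6" for t
        using that basis_vec_vecs by (intro centre_vecs_graph) (auto simp: centre_vecs_def basis_vec_def centre_coords_def)
      then show "code \<phi> \<in> ?X"
        unfolding code_def using cl lift_graph[OF \<phi>(1)] dom_coords_mem k by auto
    qed
    show "finite ?X" using K(2) by (auto intro!: finite_PiE)
  qed
  also have "\<dots> = order K ^ 8"
    by (simp add: card_cartesian_product card_PiE order_def eval_nat_numeral)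
  finally show ?thesis .
qed

end

section \<open>Families of nilpotent groups\<close>

text \<open>
  The bounds are real numbers because for small multiplicities they are negative powers of primes.
\<close>

definition nilpotent_family :: "nat \<Rightarrow> real \<Rightarrow> real \<Rightarrow> bool" where
  "nilpotent_family n N M \<longleftrightarrow> (\<exists>\<G> :: nat monoid set. finite \<G> \<and> N \<le> real (card \<G>) \<and>
     pairwise (\<lambda>G H. \<not> G \<cong> H) \<G> \<and>
     (\<forall>G\<in>\<G>. nilpotent_group G \<and> finite (carrier G) \<and> order G = n \<and> M \<le> real (num_subgroup_types G)))"

text \<open>
  Each group is replaced by a copy on the natural numbers, and among the copies a maximal set of
  pairwise non-isomorphic ones is chosen.
\<close>

lemma nilpotent_familyI:
  fixes F :: "'t \<Rightarrow> 'a monoid"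
  assumes T: "finite T" and N: "N * real m \<le> real (card T)" "m > 0"
    and G: "\<And>t. t \<in> T \<Longrightarrow> nilpotent_group (F t)" "\<And>t. t \<in> T \<Longrightarrow> finite (carrier (F t))"
      "\<And>t. t \<in> T \<Longrightarrow> order (F t) = n" "\<And>t. t \<in> T \<Longrightarrow> M \<le> real (num_subgroup_types (F t))"
    and bound: "\<And>K :: nat monoid. group K \<Longrightarrow> finite (carrier K) \<Longrightarrow> order K = n \<Longrightarrow> card {t \<in> T. F t \<cong> K} \<le> m"
  shows "nilpotent_family n N M"
proof -
  define C where "C t = (SOME K :: nat monoid. group K \<and> F t \<cong> K)" for t
  have gF: "group (F t)" if "t \<in> T" for t using G(1)[OF that] by (simp add: nilpotent_group_def)
  have C: "group (C t)" "F t \<cong> C t" if "t \<in> T" for t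
    using someI_ex[OF nat_copy[OF gF[OF that] G(2)[OF that]]] unfolding C_def by auto
  have Cfin: "finite (carrier (C t))" and Cord: "order (C t) = n" if "t \<in> T" for t
    using iso_finite[OF C(2)[OF that]] iso_same_card[OF C(2)[OF that]] G(2,3)[OF that] by (auto simp: order_def)
  obtain S where S: "S \<subseteq> C ` T" "pairwise (\<lambda>x y. \<not> x \<cong> y) S" "card T \<le> m * card S"
  proof (rule large_inequivalent_subset[of T "(\<cong>)" C m])
    show "C s \<cong> C t \<Longrightarrow> C t \<cong> C s" if "s \<in> T" "t \<in> T" for s t
      using group.iso_sym[OF C(1)[OF that(1)]] .
    show "card {t \<in> T. C t \<cong> C s} \<le> m" if s: "s \<in> T" for s
    proof -
      have "{t \<in> T. C t \<cong> C s} \<subseteq> {t \<in> T. F t \<cong> C s}"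
        using C(2) iso_trans by blast
      then have "card {t \<in> T. C t \<cong> C s} \<le> card {t \<in> T. F t \<cong> C s}"
        using T by (intro card_mono) auto
      also have "\<dots> \<le> m" by (rule bound[OF C(1) Cfin Cord]) (use s in simp_all)
      finally show ?thesis .
    qed
  qed (use T in auto)
  have "N * real m \<le> real (card S) * real m"
    using N(1) S(3) by (metis le_trans mult.commute of_nat_le_iff of_nat_mult order_trans)
  then have NS: "N \<le> real (card S)" using N(2) by simp
  have "\<forall>G\<in>S. nilpotent_group G \<and> finite (carrier G) \<and> order G = n \<and> M \<le> real (num_subgroup_types G)"
  proof
    fix K assume "K \<in> S"
    then obtain t where t: "t \<in> T" "K = C t" using S(1) by blast
    have "real (num_subgroup_types (F t)) \<le> real (num_subgroup_types K)"
      unfolding t(2) of_nat_le_iff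
      by (rule num_subgroup_types_iso[OF gF[OF t(1)] C(1)[OF t(1)] Cfin[OF t(1)] C(2)[OF t(1)]])
    then have "M \<le> real (num_subgroup_types K)" using G(4)[OF t(1)] by linarith
    moreover have "nilpotent_group K"
      unfolding t(2) by (rule nilpotent_group_iso[OF G(1)[OF t(1)] C(1)[OF t(1)] C(2)[OF t(1)]])
    ultimately show "nilpotent_group K \<and> finite (carrier K) \<and> order K = n \<and> M \<le> real (num_subgroup_types K)"
      using Cfin Cord t by blast
  qed
  moreover have "finite S" using S(1) T finite_subset by blast
  ultimately show ?thesis unfolding nilpotent_family_def using NS S(2) by blast
qed

lemma nilpotent_family_one: "nilpotent_family 1 1 1"
proof -
  define G :: "nat monoid" where "G = \<lparr>carrier = {0}, monoid.mult = (\<lambda>_ _. 0), one = 0\<rparr>"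
  have g: "group G" by (rule groupI) (auto simp: G_def)
  have "lower_central G 0 = {\<one>\<^bsub>G\<^esub>}" by (simp add: G_def)
  then have "nilpotent_group G" using g unfolding nilpotent_group_def by blast
  moreover have "finite (carrier G)" "order G = 1" by (simp_all add: G_def order_def)
  ultimately show ?thesis
    using num_subgroup_types_pos[OF g] unfolding nilpotent_family_def
    by (intro exI[of _ "{G}"]) auto
qed

lemma nilpotent_family_mult:
  assumes A: "nilpotent_family n1 N1 M1" and B: "nilpotent_family n2 N2 M2"
    and cop: "coprime n1 n2" and pos: "N1 \<ge> 0" "N2 \<ge> 0" "M1 \<ge> 0" "M2 \<ge> 0"
  shows "nilpotent_family (n1 * n2) (N1 * N2) (M1 * M2)"
proof -
  obtain \<G> :: "nat monoid set" where G: "finite \<G>" "N1 \<le> real (card \<G>)" "pairwise (\<lambda>G H. \<not> G \<cong> H) \<G>"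
    "\<And>G. G \<in> \<G> \<Longrightarrow> nilpotent_group G \<and> finite (carrier G) \<and> order G = n1 \<and> M1 \<le> real (num_subgroup_types G)"
    using A unfolding nilpotent_family_def by blast
  obtain \<H> :: "nat monoid set" where H: "finite \<H>" "N2 \<le> real (card \<H>)" "pairwise (\<lambda>G H. \<not> G \<cong> H) \<H>"
    "\<And>G. G \<in> \<H> \<Longrightarrow> nilpotent_group G \<and> finite (carrier G) \<and> order G = n2 \<and> M2 \<le> real (num_subgroup_types G)"
    using B unfolding nilpotent_family_def by blast
  define F where "F x = fst x \<times>\<times> snd x" for x :: "nat monoid \<times> nat monoid"
  have g: "group G" if "G \<in> \<G> \<union> \<H>" for G
    using that G(4) H(4) by (auto simp: nilpotent_group_def)
  have fin: "finite (carrier G)" if "G \<in> \<G> \<union> \<H>" for G using that G(4) H(4) by auto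
  have ord: "order G = n1" if "G \<in> \<G>" for G using that G(4) by auto
  have ord2: "order G = n2" if "G \<in> \<H>" for G using that H(4) by auto
  show ?thesis
  proof (rule nilpotent_familyI[of "\<G> \<times> \<H>" _ 1 F])
    show "finite (\<G> \<times> \<H>)" using G(1) H(1) by simp
    show "N1 * N2 * real 1 \<le> real (card (\<G> \<times> \<H>))"
      using G(2) H(2) pos by (simp add: card_cartesian_product mult_mono)
    fix t assume t: "t \<in> \<G> \<times> \<H>"
    show "nilpotent_group (F t)" unfolding F_def using G(4) H(4) t by (intro nilpotent_DirProd) auto
    show "finite (carrier (F t))" unfolding F_def using fin t by auto
    show "order (F t) = n1 * n2"
      using G(4) H(4) t unfolding F_def order_def carrier_DirProd by (auto simp: card_cartesian_product)
    have c: "coprime (order (fst t)) (order (snd t))" using cop ord ord2 t by auto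
    have "M1 * M2 \<le> real (num_subgroup_types (fst t)) * real (num_subgroup_types (snd t))"
      using G(4) H(4) t pos by (intro mult_mono) auto
    also have "\<dots> \<le> real (num_subgroup_types (F t))"
      unfolding of_nat_mult[symmetric] of_nat_le_iff F_def
      by (rule num_subgroup_types_DirProd[OF _ _ _ _ c]) (use g fin t in auto)
    finally show "M1 * M2 \<le> real (num_subgroup_types (F t))" .
  next
    fix K :: "nat monoid" assume K: "group K"
    have "s = t" if st: "s \<in> \<G> \<times> \<H>" "t \<in> \<G> \<times> \<H>" "F s \<cong> K" "F t \<cong> K" for s t
    proof -
      have gs: "group (fst s)" "group (snd s)" "group (fst t)" "group (snd t)"
        and fs: "finite (carrier (fst s))" "finite (carrier (snd s))" "finite (carrier (fst t))" "finite (carrier (snd t))"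
        using g fin st by auto
      have "K \<cong> F t" using group.iso_sym[OF DirProd_group[OF gs(3,4)] st(4)[unfolded F_def]] unfolding F_def .
      then have iso: "fst s \<times>\<times> snd s \<cong> fst t \<times>\<times> snd t" using iso_trans[OF st(3)] unfolding F_def by blast
      have cc: "coprime (order (fst s)) (order (snd t))" "coprime (order (fst t)) (order (snd s))"
        using cop ord ord2 st by auto
      note both = coprime_DirProd_iso_both[OF gs fs cc iso]
      have "fst s = fst t" using G(3) both(1) st unfolding pairwise_def by (metis mem_Times_iff)
      moreover have "snd s = snd t" using H(3) both(2) st unfolding pairwise_def by (metis mem_Times_iff)
      ultimately show ?thesis by (simp add: prod_eq_iff)
    qed
    then show "card {t \<in> \<G> \<times> \<H>. F t \<cong> K} \<le> 1"
      using G(1) H(1) by (subst One_nat_def, subst card_le_Suc0_iff_eq) auto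
  qed simp
qed

lemma nilpotent_family_prod:
  assumes S: "finite S" and p: "\<And>p. p \<in> S \<Longrightarrow> prime (p::nat)"
    and fam: "\<And>p. p \<in> S \<Longrightarrow> nilpotent_family (p ^ v p) (N p) (M p)"
    and pos: "\<And>p. p \<in> S \<Longrightarrow> N p \<ge> 0" "\<And>p. p \<in> S \<Longrightarrow> M p \<ge> 0"
  shows "nilpotent_family (\<Prod>p\<in>S. p ^ v p) (\<Prod>p\<in>S. N p) (\<Prod>p\<in>S. M p)"
  using S p fam pos
proof (induction S rule: finite_induct)
  case empty
  then show ?case using nilpotent_family_one by simp
next
  case (insert q S)
  have cop: "coprime (q ^ v q) (\<Prod>p\<in>S. p ^ v p)"
  proof (rule prod_coprime_right)
    fix p assume "p \<in> S"
    then have "coprime q p" using insert by (intro primes_coprime) auto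
    then show "coprime (q ^ v q) (p ^ v p)" by simp
  qed
  have "nilpotent_family (q ^ v q * (\<Prod>p\<in>S. p ^ v p)) (N q * (\<Prod>p\<in>S. N p)) (M q * (\<Prod>p\<in>S. M p))"
    by (rule nilpotent_family_mult[OF _ _ cop]) (use insert in \<open>auto intro: prod_nonneg\<close>)
  then show ?case using insert by simp
qed

context tensor_group
begin

lemma num_subgroup_types_form_group:
  assumes "c \<ge> 6 \<or> k = 0"
  shows "p ^ (4 * k ^ 2) \<le> p ^ (8 * (2 * k + 6)) * num_subgroup_types (form_group \<tau>)"
proof (cases "k = 0")
  case True
  have "1 \<le> num_subgroup_types (form_group \<tau>)" by (rule num_subgroup_types_pos[OF group_form_group finite_form_group])
  moreover have "1 \<le> p ^ (8 * (2 * k + 6))" using p1 by simp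
  ultimately show ?thesis using True by (metis mult_le_mono mult_0_right nat_mult_1 power_0 power_zero_numeral)
next
  case False
  then have kc: "k > 0" "c \<ge> 6" using assms by auto
  let ?m = "p ^ (8 * (2 * k + 6))"
  let ?R = "\<lambda>H K. isomorphic_in (form_group \<tau>) H K"
  have g: "group (form_group \<tau>\<lparr>carrier := graph_subgroup \<phi>\<rparr>)" for \<phi>
    by (rule group.subgroup_imp_group[OF group_form_group subgroup_graph])
  have fin: "finite (graph_subgroup \<phi>)" for \<phi>
    using subgroup.subset[OF subgroup_graph] finite_form_group finite_subset by metis
  obtain S where S: "S \<subseteq> graph_subgroup ` matrices" "pairwise (\<lambda>x y. \<not> ?R x y) S" "card matrices \<le> ?m * card S"
  proof (rule large_inequivalent_subset[of matrices ?R graph_subgroup ?m])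
    show "finite matrices" unfolding matrices_def using finite_dom_coords finite_cod_coords by (intro finite_PiE) auto
    show "?R (graph_subgroup s) (graph_subgroup t) \<Longrightarrow> ?R (graph_subgroup t) (graph_subgroup s)" for s t
      using group.iso_sym[OF g] .
    fix s
    have "card {t \<in> matrices. ?R (graph_subgroup t) (graph_subgroup s)} \<le> order (form_group \<tau>\<lparr>carrier := graph_subgroup s\<rparr>) ^ 8"
      by (rule card_iso_graphs[OF kc g]) (simp add: fin)
    also have "\<dots> \<le> (p ^ (2 * k + 6)) ^ 8"
      using card_graph_subgroup by (intro power_mono) (simp_all add: order_def)
    also have "\<dots> = ?m" by (simp add: mult.commute flip: power_mult)
    finally show "card {t \<in> matrices. ?R (graph_subgroup t) (graph_subgroup s)} \<le> ?m" .
  qed simp_all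
  have "card S \<le> num_subgroup_types (form_group \<tau>)"
    using S(1) subgroup_graph by (intro card_le_num_subgroup_types[OF group_form_group finite_form_group _ S(2)]) auto
  then have "?m * card S \<le> ?m * num_subgroup_types (form_group \<tau>)" by simp
  then show ?thesis using S(3) unfolding card_matrices by linarith
qed

end

lemma nilpotent_family_prime_power:
  assumes p: "prime (p::nat)" and c: "c \<ge> 6 \<or> k = 0"
  shows "nilpotent_family (p ^ (4 * k + 3 * a + c))
    (real p powr (real a ^ 3 - real (4 * k + 3 * a + c) ^ 2)) (real p powr (4 * real k ^ 2 - 8 * (2 * real k + 6)))"
proof -
  have p1: "p > 1" using prime_gt_1_nat[OF p] .
  interpret tensor_group p k a c by unfold_locales (rule p1)
  let ?v = "4 * k + 3 * a + c"
  have pw: "real (p ^ i) = real p powr real i" for i using p1 by (simp add: powr_realpow)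
  show ?thesis
  proof (rule nilpotent_familyI[of tensors _ "p ^ (?v ^ 2)" form_group])
    have "real p powr (real a ^ 3 - real ?v ^ 2) * real (p ^ (?v ^ 2)) = real p powr (real a ^ 3)"
      unfolding pw powr_add[symmetric] by simp
    also have "\<dots> = real (card tensors)" unfolding card_tensors pw by simp
    finally show "real p powr (real a ^ 3 - real ?v ^ 2) * real (p ^ (?v ^ 2)) \<le> real (card tensors)" by simp
    show "0 < p ^ ?v\<^sup>2" using p1 by simp
    show "real p powr (4 * real k ^ 2 - 8 * (2 * real k + 6)) \<le> real (num_subgroup_types (form_group \<tau>))" for \<tau>
    proof -
      have "real (p ^ (4 * k ^ 2)) \<le> real (p ^ (8 * (2 * k + 6))) * real (num_subgroup_types (form_group \<tau>))"
        using num_subgroup_types_form_group[OF c, of \<tau>] by (metis of_nat_le_iff of_nat_mult)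
      then have "real p powr (real (4 * k ^ 2)) / real p powr (real (8 * (2 * k + 6))) \<le> real (num_subgroup_types (form_group \<tau>))"
        unfolding pw using p1 by (simp add: divide_le_eq mult.commute)
      then show ?thesis unfolding powr_diff[symmetric] by simp
    qed
    show "card {t \<in> tensors. form_group t \<cong> K} \<le> p ^ ?v\<^sup>2" if "group K" "finite (carrier K)" "order K = p ^ ?v" for K :: "nat monoid"
      using card_iso_tensors[OF that] .
  qed (simp_all add: finite_tensors nilpotent_form_group order_form_group finite_form_group)
qed

section \<open>The asymptotic statements\<close>

hide_const (open) P Q U W C D Z E

lemma nilpotent_family_mono:
  assumes "nilpotent_family n N M" "N' \<le> N" "M' \<le> M"
  shows "nilpotent_family n N' M'"
proof -
  obtain \<G> :: "nat monoid set" where G: "finite \<G>" "N \<le> real (card \<G>)" "pairwise (\<lambda>G H. \<not> G \<cong> H) \<G>"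
    "\<forall>G\<in>\<G>. nilpotent_group G \<and> finite (carrier G) \<and> order G = n \<and> M \<le> real (num_subgroup_types G)"
    using assms(1) unfolding nilpotent_family_def by blast
  show ?thesis unfolding nilpotent_family_def
    by (rule exI[of _ \<G>]) (use G assms(2,3) in \<open>auto intro: order_trans\<close>)
qed

text \<open>
  Of \<open>r\<close> coordinates, six are reserved for the centre and the others are divided into four blocks of size
  \<open>k\<close>, so \<open>4 k \<ge> r - 9\<close> and only a linear term is lost.
\<close>

lemma square_types_exponent:
  fixes r :: nat
  defines "k \<equiv> (r - 6) div 4"
  shows "4 * real k ^ 2 - 8 * (2 * real k + 6) \<ge> real r ^ 2 / 4 - 9 * real r - 48"
proof (cases "r \<ge> 9")
  case True
  have le: "real (4 * k) \<le> real r" unfolding of_nat_le_iff k_def by simp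
  have "r - 6 \<le> 4 * k + 3" unfolding k_def by linarith
  then have "real r - 9 \<le> 4 * real k" using True by linarith
  then have "(real r - 9) ^ 2 \<le> (4 * real k) ^ 2" using True by (intro power_mono) auto
  then have "real r ^ 2 - 18 * real r + 81 \<le> 16 * real k ^ 2"
    by (simp add: power2_eq_square algebra_simps)
  then show ?thesis using le by simp
next
  case False
  then have "k = 0" unfolding k_def by simp
  moreover have "real r * real r \<le> 9 * real r" using False by (intro mult_right_mono) auto
  ultimately show ?thesis by (simp add: power2_eq_square)
qed

text \<open>
  The constant \<open>8 / 729\<close> of the leading term exceeds \<open>1 / 108\<close>, so rounding costs at most a quadratic
  term.
\<close>

lemma cube_exponent:
  fixes v :: nat
  shows "real ((2 * v) div 9) ^ 3 \<ge> real v ^ 3 / 108 - real v ^ 2"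
proof (cases "v \<ge> 4")
  case True
  define a where "a = (2 * v) div 9"
  have "2 * v \<le> 9 * a + 8" unfolding a_def by linarith
  then have "real (2 * v) \<le> real (9 * a + 8)" by (simp only: of_nat_le_iff)
  then have "2 / 9 * (real v - 4) \<le> real a" by simp
  then have "(2 / 9 * (real v - 4)) ^ 3 \<le> real a ^ 3" using True by (intro power_mono) auto
  moreover have "(2 / 9 * (real v - 4)) ^ 3 = 8 / 729 * (real v ^ 3 - 12 * real v ^ 2 + 48 * real v - 64)"
  proof -
    have "(real v - 4) ^ 3 = real v ^ 3 - 12 * real v ^ 2 + 48 * real v - 64"
      by (simp add: power3_eq_cube power2_eq_square algebra_simps)
    moreover have "(2 / 9) ^ 3 = (8 / 729 :: real)" by (simp add: power_divide)
    ultimately show ?thesis by (simp only: power_mult_distrib)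
  qed
  ultimately have cube: "8 / 729 * (real v ^ 3 - 12 * real v ^ 2 + 48 * real v - 64) \<le> real a ^ 3" by metis
  have "x / 108 - y \<le> z" if "8 / 729 * (x - 12 * y + 48 * w - 64) \<le> z" "0 \<le> x" "0 \<le> y" "4 \<le> w"
    for x y z w :: real using that by argo
  from this[OF cube] True show ?thesis unfolding a_def[symmetric] by simp
next
  case False
  have "real v * real v ^ 2 \<le> 4 * real v ^ 2" using False by (intro mult_right_mono) auto
  then have "real v ^ 3 \<le> 4 * real v ^ 2" by (simp add: power3_eq_cube power2_eq_square mult.assoc)
  moreover have "0 \<le> real v ^ 2" "0 \<le> real (2 * v div 9) ^ 3" by simp_all
  ultimately show ?thesis by argo
qed

lemma nilpotent_family_quarter:
  assumes p: "prime (p::nat)" and v: "v \<ge> 1"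
  shows "nilpotent_family (p ^ v) (real p powr (- (real v ^ 2))) (real p powr (real v ^ 2 / 4 - 57 * real v))"
proof -
  define k where "k = (v - 6) div 4"
  have vk: "4 * k + 3 * 0 + (v - 4 * k) = v" unfolding k_def by simp
  have c: "v - 4 * k \<ge> 6 \<or> k = 0" unfolding k_def by auto
  have p1: "real p \<ge> 1" using prime_ge_1_nat[OF p] by simp
  show ?thesis
  proof (rule nilpotent_family_mono[OF nilpotent_family_prime_power[OF p c, of 0, unfolded vk]])
    show "real p powr (real v ^ 2 / 4 - 57 * real v) \<le> real p powr (4 * (real k)\<^sup>2 - 8 * (2 * real k + 6))"
      using square_types_exponent[of v] v p1 unfolding k_def[symmetric] by (intro powr_mono) auto
  qed simp
qed

text \<open>
  The tensor takes \<open>3 a\<close> coordinates, about two thirds of \<open>v\<close>. The remaining \<open>r \<ge> v / 3\<close> are used for the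
  graphs, whose exponent \<open>r\<^sup>2 / 4\<close> is then at least \<open>v\<^sup>2 / 36\<close>.
\<close>

lemma nilpotent_family_cubic:
  assumes p: "prime (p::nat)" and v: "v \<ge> 1"
  shows "nilpotent_family (p ^ v) (real p powr (real v ^ 3 / 108 - 2 * real v ^ 2))
    (real p powr (real v ^ 2 / 36 - 57 * real v))"
proof -
  define a where "a = (2 * v) div 9"
  define r where "r = v - 3 * a"
  define k where "k = (r - 6) div 4"
  have va: "3 * a \<le> v" "v \<le> 3 * r" "r \<le> v" unfolding r_def a_def by linarith+
  have kr: "4 * k \<le> r" unfolding k_def by linarith
  have vk: "4 * k + 3 * a + (r - 4 * k) = v" using va kr unfolding r_def by linarith
  have c: "r - 4 * k \<ge> 6 \<or> k = 0" unfolding k_def by auto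
  have p1: "real p \<ge> 1" using prime_ge_1_nat[OF p] by simp
  show ?thesis
  proof (rule nilpotent_family_mono[OF nilpotent_family_prime_power[OF p c, of a, unfolded vk]])
    show "real p powr (real v ^ 3 / 108 - 2 * real v ^ 2) \<le> real p powr (real a ^ 3 - real v ^ 2)"
      using cube_exponent[of v] p1 unfolding a_def[symmetric] by (intro powr_mono) auto
    have "(real v / 3) ^ 2 \<le> real r ^ 2" using va by (intro power_mono) auto
    then have "real v ^ 2 / 36 \<le> real r ^ 2 / 4" by (simp add: power_divide)
    moreover have "real r \<le> real v" "1 \<le> real v" using va v by auto
    ultimately show "real p powr (real v ^ 2 / 36 - 57 * real v) \<le> real p powr (4 * (real k)\<^sup>2 - 8 * (2 * real k + 6))"
      using square_types_exponent[of r] p1 unfolding k_def[symmetric] by (intro powr_mono) auto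
  qed
qed

lemma nat_prime_factorization_power:
  assumes "n > (0::nat)"
  shows "(\<Prod>p\<in>prime_factors n. p ^ multiplicity p n) = n"
  using assms prime_factorization_nat by metis

lemma multiplicity_prime_factor_ge_1:
  "p \<in> prime_factors n \<Longrightarrow> multiplicity p (n::nat) \<ge> 1"
  by (metis One_nat_def Suc_leI prime_factors_multiplicity mem_Collect_eq)

lemma prod_prime_powr_pos: "(\<Prod>p\<in>prime_factors n. real p powr f p) > 0"
  by (intro prod_pos) (auto intro: prime_gt_0_nat in_prime_factors_imp_prime)

lemma prod_prime_powr:
  assumes n: "n > (0::nat)"
  shows "(\<Prod>p\<in>prime_factors n. real p powr (e (real (multiplicity p n)) + t * real (multiplicity p n)))
    = (\<Prod>p\<in>prime_factors n. real p powr e (real (multiplicity p n))) * real n powr t"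
proof -
  have "real n powr t = (\<Prod>p\<in>prime_factors n. real (p ^ multiplicity p n) powr t)"
    using arg_cong[OF nat_prime_factorization_power[OF n], of real]
    by (metis (no_types, lifting) of_nat_prod prod_powr_distrib of_nat_0_le_iff prod.cong)
  also have "\<dots> = (\<Prod>p\<in>prime_factors n. real p powr (t * real (multiplicity p n)))"
  proof (rule prod.cong)
    fix p assume "p \<in> prime_factors n"
    then have "p > 0" by (auto intro: prime_gt_0_nat)
    then show "real (p ^ multiplicity p n) powr t = real p powr (t * real (multiplicity p n))"
      by (simp add: powr_powr mult.commute flip: powr_realpow)
  qed simp
  finally show ?thesis by (simp add: powr_add prod.distrib)
qed

text \<open>
  It suffices to look for error terms of the form \<open>t * v\<close> with one \<open>t\<close> for all primes: the factors
  \<open>p powr (t * v)\<close> multiply to \<open>n powr t\<close>, so \<open>t\<close> can be found by taking a logarithm. This fails for \<open>n = 1\<close>,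
  where the only product is 1.
\<close>

lemma prime_powr_prods_memI:
  assumes n: "n > (0::nat)" and X: "X > 0" "n = 1 \<Longrightarrow> X = 1"
    and E: "\<And>t. X = (\<Prod>p\<in>prime_factors n. real p powr e (real (multiplicity p n))) * real n powr t \<Longrightarrow> n > 1 \<Longrightarrow>
      \<forall>v\<ge>0. e v + t * v \<in> E v"
  shows "X \<in> prime_powr_prods n E"
proof (cases "n = 1")
  case True
  then show ?thesis using X(2) unfolding prime_powr_prods_def by simp
next
  case False
  then have n1: "n > 1" using n by simp
  define K where "K = (\<Prod>p\<in>prime_factors n. real p powr e (real (multiplicity p n)))"
  have K: "K > 0" unfolding K_def by (rule prod_prime_powr_pos)
  define t where "t = log (real n) (X / K)"
  have "real n powr t = X / K" unfolding t_def using n1 X K by simp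
  then have XK: "X = K * real n powr t" using K by simp
  show ?thesis
    unfolding prime_powr_prods_def mem_Collect_eq
  proof (intro exI conjI ballI)
    show "X = (\<Prod>p\<in>prime_factors n. real p powr (e (real (multiplicity p n)) + t * real (multiplicity p n)))"
      unfolding prod_prime_powr[OF n] using XK K_def by simp
    show "e (real (multiplicity p n)) + t * real (multiplicity p n) \<in> E (real (multiplicity p n))" for p
      using E[OF XK[unfolded K_def] n1] by simp
  qed
qed

lemma mem_Theta_prods:
  assumes n: "n > (0::nat)" and K: "K = (\<Prod>p\<in>prime_factors n. real p powr e (real (multiplicity p n)))"
    and X: "K * real n powr a \<le> X" "X \<le> K * real n powr b"
  shows "X \<in> prime_powr_prods n (\<lambda>v. e v +o Theta_err a b v)"
proof (rule prime_powr_prods_memI[OF n, where e = e])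
  have K0: "K > 0" unfolding K by (rule prod_prime_powr_pos)
  then have "0 < K * real n powr a" using n by simp
  then show "X > 0" using X by linarith
  show "X = 1" if "n = 1" using X K that by simp
  fix t assume t: "X = (\<Prod>p\<in>prime_factors n. real p powr e (real (multiplicity p n))) * real n powr t" and n1: "n > 1"
  have ab: "a \<le> t" "t \<le> b" using X K0 n1 unfolding t K[symmetric] by simp_all
  show "\<forall>v\<ge>0. e v + t * v \<in> e v +o Theta_err a b v"
    using ab by (auto simp: elt_set_plus_def Theta_err_def mult_right_mono)
qed

lemma mem_Omega_prods:
  assumes n: "n > (0::nat)" and K: "K = (\<Prod>p\<in>prime_factors n. real p powr e (real (multiplicity p n)))"
    and X: "K * real n powr a \<le> X" "n = 1 \<Longrightarrow> X = 1"
  shows "X \<in> prime_powr_prods n (\<lambda>v. e v +o Omega_err a v)"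
proof (rule prime_powr_prods_memI[OF n, where e = e])
  have K0: "K > 0" unfolding K by (rule prod_prime_powr_pos)
  then have "0 < K * real n powr a" using n by simp
  then show "X > 0" using X by linarith
  show "X = 1" if "n = 1" using X(2) that .
  fix t assume t: "X = (\<Prod>p\<in>prime_factors n. real p powr e (real (multiplicity p n))) * real n powr t" and n1: "n > 1"
  have ab: "a \<le> t" using X(1) K0 n1 unfolding t K[symmetric] by simp
  show "\<forall>v\<ge>0. e v + t * v \<in> e v +o Omega_err a v"
    using ab by (auto simp: elt_set_plus_def Omega_err_def mult_right_mono)
qed

definition quarter_prod :: "nat \<Rightarrow> real" where
  "quarter_prod n = (\<Prod>p\<in>prime_factors n. real p powr (real (multiplicity p n) ^ 2 / 4))"

text \<open>
  If \<open>v = i + j\<close>, then \<open>i * j \<le> v\<^sup>2 / 4\<close>.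
\<close>

lemma mult_pairing_le_quarter_prod:
  assumes n: "n > 0" and m: "m dvd n"
  shows "real (mult_pairing (prime_factors n) m (n div m)) \<le> quarter_prod n"
  unfolding mult_pairing_def quarter_prod_def of_nat_prod
proof (rule prod_mono, intro conjI)
  fix p assume p: "p \<in> prime_factors n"
  then have pp: "prime p" by auto
  let ?i = "multiplicity p m" and ?j = "multiplicity p (n div m)"
  have n': "n = m * (n div m)" using m by simp
  have nz: "m \<noteq> 0" "n div m \<noteq> 0" using n n' by (metis mult_0 mult_0_right neq0_conv)+
  have "multiplicity p (m * (n div m)) = ?i + ?j"
    using pp nz by (intro prime_elem_multiplicity_mult_distrib) auto
  then have ij: "multiplicity p n = ?i + ?j" using n' by simp
  have "0 \<le> (real ?i - real ?j) ^ 2" by simp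
  then have le: "real (?i * ?j) \<le> real (multiplicity p n) ^ 2 / 4"
    unfolding ij by (simp add: power2_eq_square algebra_simps)
  have "real (p ^ (?i * ?j)) = real p powr real (?i * ?j)"
    using prime_gt_0_nat[OF pp] by (simp add: powr_realpow del: of_nat_mult)
  also have "\<dots> \<le> real p powr (real (multiplicity p n) ^ 2 / 4)"
    using le prime_ge_1_nat[OF pp] by (intro powr_mono) auto
  finally show "real (p ^ (?i * ?j)) \<le> real p powr (real (multiplicity p n) ^ 2 / 4)" .
qed simp

text \<open>
  There are at most \<open>n\<close> possible orders of subgroups, and the bound for each of them has one more
  factor \<open>n\<close>; together this is the factor \<open>n\<^sup>2\<close>, a linear term in all exponents.
\<close>

lemma num_subgroups_le:
  assumes G: "nilpotent_group G" "finite (carrier G)"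
  shows "real (num_subgroups G) \<le> quarter_prod (order G) * real (order G) powr 2"
proof -
  have g: "group G" using G by (simp add: nilpotent_group_def)
  interpret group G by fact
  let ?n = "order G" and ?e = "{\<one>\<^bsub>G\<^esub>}"
  have n: "?n > 0" using G(2) order_gt_0_iff_finite by blast
  have "{H. subgroup H G} \<subseteq> (\<Union>m\<in>{1..?n}. between G ?e m)"
  proof
    fix H assume "H \<in> {H. subgroup H G}"
    then have H: "subgroup H G" by simp
    have "card H \<in> {1..?n}"
      using subgroup.finite_imp_card_positive[OF H G(2)] card_mono[OF G(2) subgroup.subset[OF H]]
      by (simp add: order_def)
    moreover have "H \<in> between G ?e (card H)"
      using H subgroup.one_closed[OF H] by (simp add: between_def)
    ultimately show "H \<in> (\<Union>m\<in>{1..?n}. between G ?e m)" by blast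
  qed
  then have "num_subgroups G \<le> card (\<Union>m\<in>{1..?n}. between G ?e m)"
    unfolding num_subgroups_def using finite_between[OF G(2)] by (intro card_mono) auto
  also have "\<dots> \<le> (\<Sum>m\<in>{1..?n}. card (between G ?e m))" by (rule card_UN_le) simp
  finally have "real (num_subgroups G) \<le> (\<Sum>m\<in>{1..?n}. real (card (between G ?e m)))"
    by (metis of_nat_le_iff of_nat_sum)
  also have "\<dots> \<le> (\<Sum>m\<in>{1..?n}. real ?n * quarter_prod ?n)"
  proof (rule sum_mono)
    fix m
    have q0: "quarter_prod ?n \<ge> 0" unfolding quarter_prod_def by (intro prod_nonneg) auto
    show "real (card (between G ?e m)) \<le> real ?n * quarter_prod ?n"
    proof (cases "m dvd ?n")
      case True
      have "real (card (between G ?e m)) \<le> real (?n * mult_pairing (prime_factors ?n) m (?n div m))"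
        using card_between_le[OF G one_is_normal, of m] unfolding of_nat_le_iff by simp
      also have "\<dots> \<le> real ?n * quarter_prod ?n"
        using mult_pairing_le_quarter_prod[OF n True] by (simp add: mult_left_mono)
      finally show ?thesis .
    next
      case False
      have "between G ?e m = {}"
        using False card_subgroup_dvd[OF _ subgroup_self subgroup.subset] unfolding between_def order_def by blast
      then show ?thesis using q0 by simp
    qed
  qed
  also have "\<dots> = quarter_prod ?n * real ?n powr 2"
    using n by (simp add: powr_numeral power2_eq_square)
  finally show ?thesis .
qed

lemma Max_image_bounds:
  fixes f :: "'a \<Rightarrow> nat"
  assumes "G \<in> X" "L \<le> real (f G)" and U: "\<And>G. G \<in> X \<Longrightarrow> real (f G) \<le> U"
  shows "L \<le> real (Max (f ` X))" "real (Max (f ` X)) \<le> U"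
proof -
  have "f ` X \<subseteq> {..nat \<lceil>U\<rceil>}"
  proof (rule image_subsetI)
    fix G assume "G \<in> X"
    from U[OF this] show "f G \<in> {..nat \<lceil>U\<rceil>}" by (simp add: le_nat_iff) linarith
  qed
  then have fin: "finite (f ` X)" using finite_subset by blast
  have "f G \<le> Max (f ` X)" using fin assms(1) by (intro Max_ge) auto
  then show "L \<le> real (Max (f ` X))" using assms(2) by linarith
  have "Max (f ` X) \<in> f ` X" using fin assms(1) by (intro Max_in) auto
  then show "real (Max (f ` X)) \<le> U" using U by auto
qed

lemma max_num_bounds:
  assumes X: "\<And>H. H \<in> X \<Longrightarrow> finite (carrier H) \<and> real (num_subgroups H) \<le> U"
    and G: "G \<in> X" "L \<le> real (num_subgroup_types G)"
  shows "L \<le> real (max_num_subgroup_types X)" "real (max_num_subgroup_types X) \<le> U"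
    "L \<le> real (max_num_subgroups X)" "real (max_num_subgroups X) \<le> U"
proof -
  have U: "real (num_subgroups H) \<le> U" if "H \<in> X" for H using X that by blast
  have le: "real (num_subgroup_types H) \<le> real (num_subgroups H)" if "H \<in> X" for H
    using num_subgroup_types_le X that by auto
  show "L \<le> real (max_num_subgroup_types X)" "real (max_num_subgroup_types X) \<le> U"
    unfolding max_num_subgroup_types_def
    using Max_image_bounds[where f = num_subgroup_types, OF G order_trans[OF le U]] by simp_all
  show "L \<le> real (max_num_subgroups X)" "real (max_num_subgroups X) \<le> U"
    unfolding max_num_subgroups_def
    using Max_image_bounds[where f = num_subgroups, OF G(1) order_trans[OF G(2) le[OF G(1)]] U] by simp_all
qed

lemma exists_many_subgroup_types:
  assumes n: "n > 0"
  shows "\<exists>G\<in>nilpotent_groups n. quarter_prod n * real n powr (-57) \<le> real (num_subgroup_types G)"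
proof -
  let ?v = "\<lambda>p. multiplicity p n"
  have "nilpotent_family (\<Prod>p\<in>prime_factors n. p ^ ?v p) (\<Prod>p\<in>prime_factors n. real p powr (- (real (?v p) ^ 2)))
     (\<Prod>p\<in>prime_factors n. real p powr (real (?v p) ^ 2 / 4 - 57 * real (?v p)))"
    by (rule nilpotent_family_prod) (use multiplicity_prime_factor_ge_1 in \<open>auto intro!: nilpotent_family_quarter\<close>)
  moreover have "(\<Prod>p\<in>prime_factors n. real p powr (real (?v p) ^ 2 / 4 - 57 * real (?v p))) = quarter_prod n * real n powr (-57)"
    using prod_prime_powr[OF n, of "\<lambda>v. v ^ 2 / 4" "-57"] unfolding quarter_prod_def by simp
  ultimately obtain \<G> :: "nat monoid set" where G: "(\<Prod>p\<in>prime_factors n. real p powr (- (real (?v p) ^ 2))) \<le> real (card \<G>)"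
    "\<forall>G\<in>\<G>. nilpotent_group G \<and> finite (carrier G) \<and> order G = n \<and> quarter_prod n * real n powr (-57) \<le> real (num_subgroup_types G)"
    unfolding nilpotent_family_def nat_prime_factorization_power[OF n] by auto
  have "0 < (\<Prod>p\<in>prime_factors n. real p powr (- (real (?v p) ^ 2)))"
    by (rule prod_prime_powr_pos)
  then have "card \<G> > 0" using G(1) by linarith
  then obtain G where "G \<in> \<G>" by fastforce
  then show ?thesis using G(2) unfolding nilpotent_groups_def by blast
qed

lemma nilpotent_groups_bounds:
  assumes n: "n > 0"
  shows "quarter_prod n * real n powr (-57) \<le> real (max_num_subgroup_types (nilpotent_groups n))"
    "real (max_num_subgroup_types (nilpotent_groups n)) \<le> quarter_prod n * real n powr 2"
    "quarter_prod n * real n powr (-57) \<le> real (max_num_subgroups (nilpotent_groups n))"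
    "real (max_num_subgroups (nilpotent_groups n)) \<le> quarter_prod n * real n powr 2"
proof -
  obtain G where G: "G \<in> nilpotent_groups n" "quarter_prod n * real n powr (-57) \<le> real (num_subgroup_types G)"
    using exists_many_subgroup_types[OF n] by blast
  have U: "finite (carrier H) \<and> real (num_subgroups H) \<le> quarter_prod n * real n powr 2"
    if "H \<in> nilpotent_groups n" for H
    using num_subgroups_le[of H] that unfolding nilpotent_groups_def by auto
  show "quarter_prod n * real n powr (-57) \<le> real (max_num_subgroup_types (nilpotent_groups n))"
    "real (max_num_subgroup_types (nilpotent_groups n)) \<le> quarter_prod n * real n powr 2"
    "quarter_prod n * real n powr (-57) \<le> real (max_num_subgroups (nilpotent_groups n))"
    "real (max_num_subgroups (nilpotent_groups n)) \<le> quarter_prod n * real n powr 2"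
    by (rule max_num_bounds[OF U G]; assumption)+
qed

text \<open>
  With \<open>l = log 2 p \<ge> 1\<close>, each \<open>l * v\<^sup>2\<close> is at most \<open>(l * v) * log 2 n\<close>, because \<open>v \<le> l * v\<close> is at most the sum
  \<open>log 2 n\<close> of the \<open>l * v\<close> over all primes.
\<close>

lemma quarter_prod_le:
  assumes n: "n > 0"
  shows "quarter_prod n \<le> 2 powr (log 2 (real n) ^ 2 / 4)"
proof -
  let ?P = "prime_factors n" and ?v = "\<lambda>p. real (multiplicity p n)"
  have pw: "real p powr x = 2 powr (log 2 (real p) * x)" if "p \<in> ?P" for p x
  proof -
    have "p > 0" using that by (auto intro: prime_gt_0_nat)
    then show ?thesis by (simp flip: powr_powr)
  qed
  have log1: "log 2 (real p) \<ge> 1" if "p \<in> ?P" for p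
  proof -
    have "p \<ge> 2" using that by (intro prime_ge_2_nat in_prime_factors_imp_prime)
    then show ?thesis by (subst le_log_iff) auto
  qed
  have prod_2: "(\<Prod>p\<in>?P. 2 powr f p) = (2::real) powr (\<Sum>p\<in>?P. f p)" for f
    by (simp add: powr_sum)
  have "real n = (\<Prod>p\<in>?P. real p powr ?v p)"
    using prod_prime_powr[OF n, of "\<lambda>v. 0" 1] n by simp
  also have "\<dots> = 2 powr (\<Sum>p\<in>?P. log 2 (real p) * ?v p)"
    unfolding prod_2[symmetric] by (intro prod.cong refl pw)
  finally have logn: "log 2 (real n) = (\<Sum>p\<in>?P. log 2 (real p) * ?v p)" by simp
  have "(\<Sum>p\<in>?P. log 2 (real p) * ?v p ^ 2) \<le> (\<Sum>p\<in>?P. (log 2 (real p) * ?v p) * log 2 (real n))"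
  proof (rule sum_mono)
    fix p assume p: "p \<in> ?P"
    have nn: "0 \<le> log 2 (real q) * ?v q" if "q \<in> ?P" for q
      using log1[OF that] by (intro mult_nonneg_nonneg) auto
    have "?v p \<le> log 2 (real p) * ?v p" using log1[OF p] by (intro mult_le_cancel_right1[THEN iffD2]) auto
    also have "\<dots> \<le> log 2 (real n)" unfolding logn using p nn by (intro member_le_sum) auto
    finally have "(log 2 (real p) * ?v p) * ?v p \<le> (log 2 (real p) * ?v p) * log 2 (real n)"
      using nn[OF p] by (intro mult_left_mono)
    then show "log 2 (real p) * ?v p ^ 2 \<le> (log 2 (real p) * ?v p) * log 2 (real n)"
      by (simp add: power2_eq_square mult.assoc)
  qed
  also have "\<dots> = log 2 (real n) ^ 2"
    unfolding sum_distrib_right[symmetric] logn[symmetric] by (simp add: power2_eq_square)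
  finally have sq: "(\<Sum>p\<in>?P. log 2 (real p) * (?v p ^ 2 / 4)) \<le> log 2 (real n) ^ 2 / 4"
    by (simp add: sum_divide_distrib[symmetric])
  have "quarter_prod n = 2 powr (\<Sum>p\<in>?P. log 2 (real p) * (?v p ^ 2 / 4))"
    unfolding quarter_prod_def prod_2[symmetric] by (intro prod.cong refl pw)
  also have "\<dots> \<le> 2 powr (log 2 (real n) ^ 2 / 4)" using sq by simp
  finally show ?thesis .
qed

lemma mem_powr_Theta:
  assumes "2 powr (s + a * x) \<le> X" "X \<le> 2 powr (s + b * x)"
  shows "X \<in> (\<lambda>e. 2 powr e) ` (s +o Theta_err a b x)"
proof -
  have X: "X > 0" using assms(1) by (smt (verit) powr_gt_zero)
  then have "s + a * x \<le> log 2 X" "log 2 X \<le> s + b * x"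
    using assms by (simp_all add: le_log_iff log_le_iff)
  then have "log 2 X \<in> s +o Theta_err a b x"
    unfolding elt_set_plus_def Theta_err_def by (intro CollectI bexI[of _ "log 2 X - s"]) auto
  moreover have "X = 2 powr (log 2 X)" using X by simp
  ultimately show ?thesis by (rule rev_image_eqI)
qed

text \<open>
  The lower bounds come from the 2-groups of the largest order \<open>2 ^ v \<le> n\<close>. The upper bounds
  follow from \<open>quarter_prod_le\<close>, because the resulting exponent increases with the order of the group.
\<close>

lemma nilpotent_groups_le_bounds:
  assumes n: "n > 0"
  defines "l \<equiv> log 2 (real n)"
  shows "2 powr (l ^ 2 / 4 + (-58) * l) \<le> real (max_num_subgroup_types (nilpotent_groups_le n))"
    "real (max_num_subgroup_types (nilpotent_groups_le n)) \<le> 2 powr (l ^ 2 / 4 + 2 * l)"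
    "2 powr (l ^ 2 / 4 + (-58) * l) \<le> real (max_num_subgroups (nilpotent_groups_le n))"
    "real (max_num_subgroups (nilpotent_groups_le n)) \<le> 2 powr (l ^ 2 / 4 + 2 * l)"
proof -
  have l0: "l \<ge> 0" unfolding l_def using n by simp
  (* 2 ^ v is the largest power of 2 that is at most n. *)
  define v where "v = nat \<lfloor>l\<rfloor>"
  have v: "real v \<le> l" "l < real v + 1" unfolding v_def using l0 by linarith+
  have "real (2 ^ v) = 2 powr real v" by (simp add: powr_realpow)
  also have "\<dots> \<le> 2 powr l" using v by simp
  also have "\<dots> = real n" unfolding l_def using n by simp
  finally have vn: "2 ^ v \<le> n" by linarith
  have low: "2 powr (l ^ 2 / 4 + (-58) * l) \<le> quarter_prod (2 ^ v) * real (2 ^ v) powr (-57)"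
  proof -
    have q: "quarter_prod (2 ^ v) = 2 powr (real v ^ 2 / 4)"
    proof (cases "v = 0")
      case False
      then have "prime_factors (2 ^ v :: nat) = {2}" by (simp add: prime_factorization_prime_power)
      then show ?thesis unfolding quarter_prod_def by simp
    qed (simp add: quarter_prod_def)
    have r: "real (2 ^ v) powr (-57) = 2 powr (- 57 * real v)"
      by (simp add: powr_powr mult.commute flip: powr_realpow)
    have "l ^ 2 - 2 * l \<le> real v ^ 2"
    proof (cases "l \<ge> 1")
      case True
      then have "(l - 1) ^ 2 \<le> real v ^ 2" using v by (intro power_mono) auto
      then show ?thesis by (simp add: power2_eq_square algebra_simps)
    next
      case False
      then have "l * l \<le> 2 * l" using l0 by (intro mult_right_mono) auto
      then show ?thesis by (smt (verit) power2_eq_square zero_le_power2)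
    qed
    then have "l ^ 2 / 4 + (-58) * l \<le> real v ^ 2 / 4 + - 57 * real v" using v l0 by linarith
    then show ?thesis unfolding q r powr_add[symmetric] by simp
  qed
  obtain G where G: "G \<in> nilpotent_groups (2 ^ v)" "quarter_prod (2 ^ v) * real (2 ^ v) powr (-57) \<le> real (num_subgroup_types G)"
    using exists_many_subgroup_types[of "2 ^ v"] by auto
  have Gn: "G \<in> nilpotent_groups_le n" using G(1) vn unfolding nilpotent_groups_def nilpotent_groups_le_def by auto
  have GL: "2 powr (l ^ 2 / 4 + (-58) * l) \<le> real (num_subgroup_types G)" using low G(2) by linarith
  have U: "finite (carrier H) \<and> real (num_subgroups H) \<le> 2 powr (l ^ 2 / 4 + 2 * l)"
    if H: "H \<in> nilpotent_groups_le n" for H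
  proof -
    have h: "nilpotent_group H" "finite (carrier H)" "order H \<le> n" using H unfolding nilpotent_groups_le_def by auto
    let ?m = "order H"
    have m: "?m > 0" using h monoid.order_gt_0_iff_finite group.is_monoid unfolding nilpotent_group_def by blast
    have ml: "0 \<le> log 2 (real ?m)" "log 2 (real ?m) \<le> l" unfolding l_def using m h(3) by auto
    have "real (num_subgroups H) \<le> quarter_prod ?m * real ?m powr 2" by (rule num_subgroups_le[OF h(1,2)])
    also have "\<dots> \<le> 2 powr (log 2 (real ?m) ^ 2 / 4) * real ?m powr 2"
      using quarter_prod_le[OF m] by (intro mult_right_mono) auto
    also have "real ?m powr 2 = 2 powr (2 * log 2 (real ?m))"
      using m by (metis mult.commute of_nat_0_less_iff powr_powr powr_log_cancel zero_less_numeral numeral_One numeral_eq_iff semiring_norm(85))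
    also have "2 powr (log 2 (real ?m) ^ 2 / 4) * 2 powr (2 * log 2 (real ?m)) = 2 powr (log 2 (real ?m) ^ 2 / 4 + 2 * log 2 (real ?m))"
      by (simp add: powr_add)
    also have "\<dots> \<le> 2 powr (l ^ 2 / 4 + 2 * l)"
    proof (rule powr_mono)
      have "log 2 (real ?m) ^ 2 \<le> l ^ 2" by (rule power_mono[OF ml(2,1)])
      then show "log 2 (real ?m) ^ 2 / 4 + 2 * log 2 (real ?m) \<le> l ^ 2 / 4 + 2 * l" using ml(2) by linarith
    qed simp
    finally show ?thesis using h(2) by blast
  qed
  show "2 powr (l ^ 2 / 4 + (-58) * l) \<le> real (max_num_subgroup_types (nilpotent_groups_le n))"
    "real (max_num_subgroup_types (nilpotent_groups_le n)) \<le> 2 powr (l ^ 2 / 4 + 2 * l)"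
    "2 powr (l ^ 2 / 4 + (-58) * l) \<le> real (max_num_subgroups (nilpotent_groups_le n))"
    "real (max_num_subgroups (nilpotent_groups_le n)) \<le> 2 powr (l ^ 2 / 4 + 2 * l)"
    by (rule max_num_bounds[OF U Gn GL]; assumption)+
qed

lemma many_nilpotent_groups:
  assumes n: "n > 0"
  shows "\<exists>N \<in> prime_powr_prods n (\<lambda>v. v ^ 3 / 108 +o Theta_err (-2) (-2) (v ^ 2)).
        \<exists>\<G> :: nat monoid set.
          finite \<G> \<and> real (card \<G>) \<ge> N \<and>
          pairwise (\<lambda>G H. \<not> G \<cong> H) \<G> \<and>
          (\<forall>G\<in>\<G>. group G \<and> order G = n \<and>
             real (num_subgroup_types G)
               \<in> prime_powr_prods n (\<lambda>v. v ^ 2 / 36 +o Omega_err (-57) v))"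
proof -
  let ?v = "\<lambda>p. multiplicity p n"
  define N where "N = (\<Prod>p\<in>prime_factors n. real p powr (real (?v p) ^ 3 / 108 - 2 * real (?v p) ^ 2))"
  define K where "K = (\<Prod>p\<in>prime_factors n. real p powr (real (?v p) ^ 2 / 36))"
  have "nilpotent_family (\<Prod>p\<in>prime_factors n. p ^ ?v p) N
     (\<Prod>p\<in>prime_factors n. real p powr (real (?v p) ^ 2 / 36 - 57 * real (?v p)))"
    unfolding N_def
    by (rule nilpotent_family_prod) (use multiplicity_prime_factor_ge_1 in \<open>auto intro!: nilpotent_family_cubic\<close>)
  moreover have "(\<Prod>p\<in>prime_factors n. real p powr (real (?v p) ^ 2 / 36 - 57 * real (?v p))) = K * real n powr (-57)"
    using prod_prime_powr[OF n, of "\<lambda>v. v ^ 2 / 36" "-57"] unfolding K_def by simp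
  ultimately obtain \<G> :: "nat monoid set" where G: "finite \<G>" "N \<le> real (card \<G>)" "pairwise (\<lambda>G H. \<not> G \<cong> H) \<G>"
    "\<And>G. G \<in> \<G> \<Longrightarrow> nilpotent_group G \<and> finite (carrier G) \<and> order G = n \<and> K * real n powr (-57) \<le> real (num_subgroup_types G)"
    unfolding nilpotent_family_def nat_prime_factorization_power[OF n] by auto
  have NP: "N \<in> prime_powr_prods n (\<lambda>v. v ^ 3 / 108 +o Theta_err (-2) (-2) (v ^ 2))"
    unfolding prime_powr_prods_def mem_Collect_eq
    by (rule exI[of _ "\<lambda>p. real (?v p) ^ 3 / 108 - 2 * real (?v p) ^ 2"])
      (simp add: N_def elt_set_plus_def Theta_err_def)
  have "group G \<and> order G = n \<and> real (num_subgroup_types G) \<in> prime_powr_prods n (\<lambda>v. v ^ 2 / 36 +o Omega_err (-57) v)"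
    if GG: "G \<in> \<G>" for G
  proof -
    have g: "group G" "finite (carrier G)" "order G = n" "K * real n powr (-57) \<le> real (num_subgroup_types G)"
      using G(4)[OF GG] by (auto simp: nilpotent_group_def)
    have "real (num_subgroup_types G) = 1" if "n = 1"
    proof -
      have "real (num_subgroup_types G) \<le> real (num_subgroups G)" using num_subgroup_types_le[OF g(2)] by simp
      also have "\<dots> \<le> quarter_prod n * real n powr 2" using num_subgroups_le[of G] G(4)[OF GG] by auto
      also have "\<dots> = 1" using that by (simp add: quarter_prod_def)
      finally show ?thesis using num_subgroup_types_pos[OF g(1,2)] by linarith
    qed
    then have "real (num_subgroup_types G) \<in> prime_powr_prods n (\<lambda>v. v ^ 2 / 36 +o Omega_err (-57) v)"
      by (intro mem_Omega_prods[OF n K_def g(4)]) auto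
    then show ?thesis using g by blast
  qed
  then show ?thesis using NP G(1,2,3) by blast
qed

theorem theorem1p2:
  shows
    "(\<exists>a b. \<forall>n>0. real (max_num_subgroup_types (nilpotent_groups n))
        \<in> prime_powr_prods n (\<lambda>v. v ^ 2 / 4 +o Theta_err a b v))
   \<and> (\<exists>a b. \<forall>n>0. real (max_num_subgroups (nilpotent_groups n))
        \<in> prime_powr_prods n (\<lambda>v. v ^ 2 / 4 +o Theta_err a b v))
   \<and> (\<exists>a b c. \<forall>n>0.
        \<exists>N \<in> prime_powr_prods n (\<lambda>v. v ^ 3 / 108 +o Theta_err a b (v ^ 2)).
        \<exists>\<G> :: nat monoid set.
          finite \<G> \<and> real (card \<G>) \<ge> N \<and>
          pairwise (\<lambda>G H. \<not> G \<cong> H) \<G> \<and>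
          (\<forall>G\<in>\<G>. group G \<and> order G = n \<and>
             real (num_subgroup_types G)
               \<in> prime_powr_prods n (\<lambda>v. v ^ 2 / 36 +o Omega_err c v)))
   \<and> (\<exists>a b. \<forall>n>0. real (max_num_subgroup_types (nilpotent_groups_le n))
        \<in> (\<lambda>e. 2 powr e) ` ((log 2 (real n)) ^ 2 / 4 +o Theta_err a b (log 2 (real n))))
   \<and> (\<exists>a b. \<forall>n>0. real (max_num_subgroups (nilpotent_groups_le n))
        \<in> (\<lambda>e. 2 powr e) ` ((log 2 (real n)) ^ 2 / 4 +o Theta_err a b (log 2 (real n))))"
proof (intro conjI, goal_cases)
  case 1
  show ?case
    by (intro exI[of _ "-57"] exI[of _ 2] allI impI mem_Theta_prods[OF _ quarter_prod_def]
        nilpotent_groups_bounds)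
next
  case 2
  show ?case
    by (intro exI[of _ "-57"] exI[of _ 2] allI impI mem_Theta_prods[OF _ quarter_prod_def]
        nilpotent_groups_bounds)
next
  case 3
  show ?case
    by (rule exI[of _ "-2"], rule exI[of _ "-2"], rule exI[of _ "-57"])
      (intro allI impI many_nilpotent_groups)
next
  case 4
  show ?case
    by (rule exI[of _ "-58"], rule exI[of _ 2], intro allI impI mem_powr_Theta nilpotent_groups_le_bounds)
next
  case 5
  show ?case
    by (rule exI[of _ "-58"], rule exI[of _ 2], intro allI impI mem_powr_Theta nilpotent_groups_le_bounds)
qed

end
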